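(* Suppose $L\subset\mathbb{R}^3$ is an embedded connected curve, nicely balanced by kink measure alone (for fixed endpoints with fixed tangents). If $L$ has any point of nonzero torsion, then it is a subarc of some supercoiled helix (for instance a helix of torsion less than $1$). Otherwise $L$ is either a straight segment (possibly joined to circular arcs at each end), a circle (or arc thereof), or a subarc of some wave. (All circles and circular arcs here have radius $1$.)
   Context: Let $L$ be a compact connected $C^{1,1}$ curve (arc or closed) with arclength derivative $'$, unit tangent $T$, curvature vector $\kappa=T'$ (defined a.e.), satisfying the curvature bound that $T$ is 1-Lipschitz in arclength (i.e. $|\kappa|\le1$ a.e.). Nicely balanced by kink measure alone (fixed endpoints, fixed tangents): there is a nonnegative function $\phi\in W^{1,BV}(L)$ (distributional derivative of bounded variation), called a kink tension function, such that on the open set $U=\{\phi>0\}$ the curve $L$ is $C^2$ with $|\kappa|\equiv1$ and, with $N=\kappa/|\kappa|$ on $U$ and $\phi N:=0$ off $U$, the virtual tangent $V=(1-2\phi)T-(\phi N)'$ is a constant vector along $L$. (With fixed endpoints and fixed tangents, no conditions are imposed at the endpoints.) On $U$ the principal normal $N$ is then locally in $W^{1,BV}$, so with $B=T\times N$ the torsion $\tau=\langle N',B\rangle$ is defined there; "a point of nonzero torsion" is a point of $U$ where $\tau\ne0$. A supercoiled helix is a curve of constant curvature $1$ with torsion $\tau=c/\phi^2$, where $c\ne0$ is a constant and $\phi>0$ is a solution on $\mathbb{R}$ (in arclength) of $\phi''=1-\phi+c^2/\phi^3$. (Circular helices of curvature $1$ and torsion of absolute value in $(0,1)$ arise from constant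 $\phi$.) A wave is an infinite planar $C^1$ concatenation of congruent arcs of unit circles, all with the same turning angle $\theta\in(\pi,2\pi)$, such that at each junction the principal normal flips sign. *)

theory Defs
  imports "HOL-Analysis.Analysis"
begin

section \<open>Sobolev-type regularity on an interval\<close>

text \<open>
  In this section \<open>D\<close> is an interval, either compact or the whole line. Test functions are
  continuously differentiable with compact support in the interior of \<open>D\<close>. For periodic
  functions on the line, testing in this way is the same as testing on the circle.
\<close>

definition test_function :: "real set \<Rightarrow> (real \<Rightarrow> real) \<Rightarrow> bool" where
  "test_function D \<eta> \<longleftrightarrow>
     (\<forall>s. \<eta> differentiable (at s)) \<and> continuous_on UNIV (deriv \<eta>) \<and>
     (\<exists>a b. {a..b} \<subseteq> interior D \<and> (\<forall>s. s \<notin> {a..b} \<longrightarrow> \<eta> s = 0))"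

definition has_weak_derivative ::
  "(real \<Rightarrow> 'a::euclidean_space) \<Rightarrow> (real \<Rightarrow> 'a) \<Rightarrow> real set \<Rightarrow> bool" where
  "has_weak_derivative F G D \<longleftrightarrow>
     (\<forall>a b. {a..b} \<subseteq> D \<longrightarrow> F absolutely_integrable_on {a..b} \<and> G absolutely_integrable_on {a..b}) \<and>
     (\<forall>\<eta>. test_function D \<eta> \<longrightarrow>
        integral D (\<lambda>s. deriv \<eta> s *\<^sub>R F s) = - integral D (\<lambda>s. \<eta> s *\<^sub>R G s))"

definition bounded_variation_on :: "(real \<Rightarrow> real) \<Rightarrow> real \<Rightarrow> real \<Rightarrow> bool" where
  "bounded_variation_on g a b \<longleftrightarrow>
     (\<exists>M. \<forall>(p :: nat \<Rightarrow> real) n. mono p \<and> range p \<subseteq> {a..b} \<longrightarrow>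
        (\<Sum>i<n. \<bar>g (p (Suc i)) - g (p i)\<bar>) \<le> M)"

text \<open>
  As usual for a Sobolev function, \<open>f\<close> is taken to be its continuous representative, and \<open>g\<close> is
  some representative of the distributional derivative of \<open>f\<close>. For \<open>D = UNIV\<close> (used only with
  periodic functions) bounded variation is required on each compact interval.
\<close>

definition W1BV :: "real set \<Rightarrow> (real \<Rightarrow> real) \<Rightarrow> bool" where
  "W1BV D f \<longleftrightarrow> continuous_on D f \<and>
     (\<exists>g. has_weak_derivative f g D \<and>
          (\<forall>a b. {a..b} \<subseteq> D \<longrightarrow> bounded_variation_on g a b))"


section \<open>Curves parametrized by arclength\<close>

text \<open>
  An arc of length \<open>l\<close> is parametrized by \<open>{0..l}\<close>, with one-sided derivatives at the two
  endpoints; a closed curve of length \<open>l\<close> is parametrized by an \<open>l\<close>-periodic map on the line.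
\<close>

datatype curve_kind = Arc | Closed

fun param_domain :: "curve_kind \<Rightarrow> real \<Rightarrow> real set" where
  "param_domain Arc l = {0..l}"
| "param_domain Closed l = UNIV"

definition unit_tangent :: "real set \<Rightarrow> (real \<Rightarrow> real^3) \<Rightarrow> real \<Rightarrow> real^3" where
  "unit_tangent D \<gamma> s = vector_derivative \<gamma> (at s within D)"

definition curvature :: "real set \<Rightarrow> (real \<Rightarrow> real^3) \<Rightarrow> real \<Rightarrow> real^3" where
  "curvature D \<gamma> s = vector_derivative (unit_tangent D \<gamma>) (at s within D)"

definition principal_normal :: "real set \<Rightarrow> (real \<Rightarrow> real^3) \<Rightarrow> real \<Rightarrow> real^3" where
  "principal_normal D \<gamma> s = curvature D \<gamma> s /\<^sub>R norm (curvature D \<gamma> s)"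

definition binormal :: "real set \<Rightarrow> (real \<Rightarrow> real^3) \<Rightarrow> real \<Rightarrow> real^3" where
  "binormal D \<gamma> s = cross3 (unit_tangent D \<gamma> s) (principal_normal D \<gamma> s)"

definition torsion :: "real set \<Rightarrow> (real \<Rightarrow> real^3) \<Rightarrow> real \<Rightarrow> real" where
  "torsion D \<gamma> s =
     inner (vector_derivative (principal_normal D \<gamma>) (at s within D)) (binormal D \<gamma> s)"

definition arclength_param :: "real set \<Rightarrow> (real \<Rightarrow> real^3) \<Rightarrow> bool" where
  "arclength_param D \<gamma> \<longleftrightarrow>
     (\<forall>s\<in>D. \<gamma> differentiable (at s within D) \<and> norm (unit_tangent D \<gamma> s) = 1)"

text \<open>A compact connected \<open>C\<^sup>1\<^sup>,\<^sup>1\<close> curve whose unit tangent is 1-Lipschitz in arclength.\<close>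

definition C11_curve :: "curve_kind \<Rightarrow> real \<Rightarrow> (real \<Rightarrow> real^3) \<Rightarrow> bool" where
  "C11_curve k l \<gamma> \<longleftrightarrow>
     0 < l \<and>
     (k = Closed \<longrightarrow> (\<forall>s. \<gamma> (s + l) = \<gamma> s)) \<and>
     arclength_param (param_domain k l) \<gamma> \<and>
     1-lipschitz_on (param_domain k l) (unit_tangent (param_domain k l) \<gamma>)"

definition embedded :: "curve_kind \<Rightarrow> real \<Rightarrow> (real \<Rightarrow> real^3) \<Rightarrow> bool" where
  "embedded k l \<gamma> \<longleftrightarrow> (case k of Arc \<Rightarrow> inj_on \<gamma> {0..l} | Closed \<Rightarrow> inj_on \<gamma> {0..<l})"


section \<open>Balance by kink measure alone\<close>

definition tension_support :: "real set \<Rightarrow> (real \<Rightarrow> real) \<Rightarrow> real set" where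
  "tension_support D \<phi> = {s \<in> D. \<phi> s > 0}"

definition kink_force :: "real set \<Rightarrow> (real \<Rightarrow> real^3) \<Rightarrow> (real \<Rightarrow> real) \<Rightarrow> real \<Rightarrow> real^3" where
  "kink_force D \<gamma> \<phi> s =
     (if s \<in> tension_support D \<phi> then \<phi> s *\<^sub>R principal_normal D \<gamma> s else 0)"

text \<open>
  The last clause says that the virtual tangent
  \<open>(1 - 2 \<phi>) T - (\<phi> N)'\<close>, with \<open>(\<phi> N)'\<close> the distributional derivative, is the constant vector \<open>V\<close>.
\<close>

definition kink_tension_function ::
  "curve_kind \<Rightarrow> real \<Rightarrow> (real \<Rightarrow> real^3) \<Rightarrow> (real \<Rightarrow> real) \<Rightarrow> bool" where
  "kink_tension_function k l \<gamma> \<phi> \<longleftrightarrow>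
     (let D = param_domain k l; U = tension_support D \<phi> in
       (\<forall>s\<in>D. 0 \<le> \<phi> s) \<and>
       (k = Closed \<longrightarrow> (\<forall>s. \<phi> (s + l) = \<phi> s)) \<and>
       W1BV D \<phi> \<and>
       (\<forall>s\<in>U. unit_tangent D \<gamma> differentiable (at s within D)) \<and>
       continuous_on U (curvature D \<gamma>) \<and>
       (\<forall>s\<in>U. norm (curvature D \<gamma> s) = 1) \<and>
       (\<exists>V. has_weak_derivative (kink_force D \<gamma> \<phi>)
              (\<lambda>s. (1 - 2 * \<phi> s) *\<^sub>R unit_tangent D \<gamma> s - V) D))"


section \<open>The model curves\<close>

definition supercoiled_helix :: "(real \<Rightarrow> real^3) \<Rightarrow> bool" where
  "supercoiled_helix \<delta> \<longleftrightarrow>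
     (\<exists>c \<phi> \<phi>'. c \<noteq> 0 \<and>
        (\<forall>s. \<phi> s > 0) \<and>
        (\<forall>s. (\<phi> has_real_derivative \<phi>' s) (at s)) \<and>
        (\<forall>s. (\<phi>' has_real_derivative (1 - \<phi> s + c\<^sup>2 / \<phi> s ^ 3)) (at s)) \<and>
        arclength_param UNIV \<delta> \<and>
        (\<forall>s. unit_tangent UNIV \<delta> differentiable (at s)) \<and>
        (\<forall>s. norm (curvature UNIV \<delta> s) = 1) \<and>
        (\<forall>s. principal_normal UNIV \<delta> differentiable (at s)) \<and>
        (\<forall>s. torsion UNIV \<delta> s = c / (\<phi> s)\<^sup>2))"

text \<open>On an interval \<open>D\<close>: an arc of a circle of radius 1, parametrized by arclength.\<close>

definition unit_circle_arc :: "real set \<Rightarrow> (real \<Rightarrow> real^3) \<Rightarrow> bool" where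
  "unit_circle_arc D \<gamma> \<longleftrightarrow>
     (\<exists>m u v. norm u = 1 \<and> norm v = 1 \<and> inner u v = 0 \<and>
        (\<forall>s\<in>D. \<gamma> s = m + cos s *\<^sub>R u + sin s *\<^sub>R v))"

text \<open>
  The junctions of a wave are at \<open>p + k \<theta>\<close> for integers \<open>k\<close>; the radius being 1, an arc of turning
  angle \<open>\<theta>\<close> has length \<open>\<theta>\<close>. The two principal normals at a junction are those of the two
  adjacent arcs, computed with one-sided derivatives.
\<close>

definition wave :: "(real \<Rightarrow> real^3) \<Rightarrow> bool" where
  "wave \<delta> \<longleftrightarrow>
     (\<exists>\<theta> p. pi < \<theta> \<and> \<theta> < 2 * pi \<and>
        (\<exists>P. affine P \<and> aff_dim P = 2 \<and> range \<delta> \<subseteq> P) \<and>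
        arclength_param UNIV \<delta> \<and> continuous_on UNIV (unit_tangent UNIV \<delta>) \<and>
        (\<forall>k::int.
           let q = p + of_int k * \<theta> in
             unit_circle_arc {q..q + \<theta>} \<delta> \<and>
             principal_normal {q - \<theta>..q} \<delta> q = - principal_normal {q..q + \<theta>} \<delta> q))"

definition subarc_of :: "curve_kind \<Rightarrow> real \<Rightarrow> (real \<Rightarrow> real^3) \<Rightarrow> (real \<Rightarrow> real^3) \<Rightarrow> bool" where
  "subarc_of k l \<gamma> \<delta> \<longleftrightarrow> k = Arc \<and> (\<exists>a. \<forall>s\<in>{0..l}. \<gamma> s = \<delta> (a + s))"

text \<open>
  Each of the three pieces \<open>{0..a}\<close>, \<open>{a..b}\<close>, \<open>{b..l}\<close> may be trivial. The straight piece must be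
  allowed to have length 0: two arcs of unit circles in different planes, tangent at a common point
  \<open>s = 0\<close>, are balanced by \<open>\<phi> s = 1 - cos s\<close>.
\<close>

definition segment_with_arcs :: "curve_kind \<Rightarrow> real \<Rightarrow> (real \<Rightarrow> real^3) \<Rightarrow> bool" where
  "segment_with_arcs k l \<gamma> \<longleftrightarrow> k = Arc \<and>
     (\<exists>a b. 0 \<le> a \<and> a \<le> b \<and> b \<le> l \<and>
        unit_circle_arc {0..a} \<gamma> \<and>
        (\<exists>x u. norm u = 1 \<and> (\<forall>s\<in>{a..b}. \<gamma> s = x + s *\<^sub>R u)) \<and>
        unit_circle_arc {b..l} \<gamma>)"

end

theory Submission
  imports Defs
begin

text \<open>
  Put \<open>F = \<phi> N\<close>, extended by 0. Since the virtual tangent is a constant \<open>V\<close>, \<open>F\<close> is \<open>C\<^sup>1\<close> with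
  \<open>F' = (1 - 2 \<phi>) T - V\<close>. Two identities hold on the whole curve, zeros of \<open>\<phi>\<close> included:
  \<open>\<langle>V, T\<rangle> = 1 - \<phi>\<close> and \<open>\<langle>V, F \<times> T\<rangle> = \<phi>\<^sup>2 \<tau> = c\<close>.

  If \<open>c \<noteq> 0\<close>, then \<open>\<phi>\<close> has no zero and solves \<open>\<phi>'' = 1 - \<phi> + c\<^sup>2 / \<phi>\<^sup>3\<close>; extending the solution of this
  equation and then of the Frenet equations to the line gives the supercoiled helix. The curve is
  not closed, because \<open>\<langle>V, \<gamma>\<rangle> - \<phi>'\<close> is bounded on a closed curve but has derivative
  \<open>- c\<^sup>2 / \<phi>\<^sup>3 < 0\<close>.

  If \<open>c = 0\<close>, each component of \<open>{\<phi> > 0}\<close> is an arc of a unit circle, and at a zero of \<open>\<phi>\<close> the derivative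
  \<open>F' = T - V\<close> has squared length \<open>|V|\<^sup>2 - 1\<close>. When \<open>|V| = 1\<close>, a component with both ends
  inside the curve is a full circle, which embeddedness forbids unless it is the whole curve; where \<open>\<phi> = 0\<close> the
  curve is straight with tangent \<open>V\<close>. When \<open>|V| > 1\<close>, the zeros are isolated, the normal flips there because \<open>F\<close>
  crosses 0 transversally, and the arcs between consecutive zeros all turn by the same angle.
\<close>

section \<open>Globally Lipschitz ordinary differential equations\<close>

text \<open>At a zero of \<phi> the tangent T may have no derivative and \<phi> = |F| may have a
  corner, so the Frenet equations hold only on pieces. What survives is F: its length is \<phi>, so
  it is continuous across the zeros, and a continuous function with a continuous weak derivative is
  C^1. A product of F with the merely continuous T is still differentiable where F vanishes. Hence
  <F, T> = 0 can be differentiated everywhere, giving 1 - 2\<phi> - <V, T> + \<phi> = 0, and <V, F x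
  T> has derivative -<V, V x T> = 0.

  On the support the Frenet expansion of V gives |V|^2 = (1 - \<phi>)^2 + \<phi>'^2 + c^2/\<phi>^2.
  For nonzero c this energy keeps \<phi> away from 0, which is what allows an extension to the line.
  For c = 0 an arc issuing from a zero has \<phi> = 1 - cos x + \<beta> sin x, where x is the
  distance to the zero and \<beta> = sqrt (|V|^2 - 1). Its first positive zero is 2 pi - 2 arctan
  \<beta>: the turning angle of the wave, or the full turn 2 pi if \<beta> = 0.\<close>

lemma antiderivative_exists:
  fixes g :: "real \<Rightarrow> 'a::euclidean_space"
  assumes "continuous_on UNIV g"
  obtains G where "G 0 = a" "\<And>t. (G has_vector_derivative g t) (at t)"
proof -
  obtain F where F: "\<And>x. (F has_vector_derivative g x) (at x)"
    using einterval_antiderivative[of "-\<infinity>" "\<infinity>" g] assms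
    by (auto simp: continuous_on_eq_continuous_at)
  have "((\<lambda>t. F t - F 0 + a) has_vector_derivative g t) (at t)" for t
    by (auto intro!: derivative_eq_intros F)
  with that[of "\<lambda>t. F t - F 0 + a"] show thesis by simp
qed

text \<open>Integrating the weight gains the factor 1/K, which is what makes the Picard operator
  contract in the weighted norm. Negative times reduce to positive ones by reflecting
  \<open>G\<close>.\<close>

lemma exp_bound_antiderivative:
  fixes G :: "real \<Rightarrow> 'a::euclidean_space"
  assumes G: "\<And>t. (G has_vector_derivative g t) (at t)" and K: "0 < K"
    and g: "\<And>t. norm (g t) \<le> M * exp (K * \<bar>t\<bar>)"
  shows "norm (G t - G 0) \<le> M / K * exp (K * \<bar>t\<bar>)"
proof -
  have M: "0 \<le> M" using order_trans[OF norm_ge_zero g[of 0]] by simp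
  have *: "norm (H t - H 0) \<le> M / K * exp (K * t)"
    if H: "\<And>t. (H has_vector_derivative h t) (at t)"
      and h: "\<And>t. norm (h t) \<le> M * exp (K * \<bar>t\<bar>)" and t: "0 < t"
    for H :: "real \<Rightarrow> 'a" and h t
  proof -
    have "norm (H t - H 0) \<le> M / K * exp (K * t) - M / K * exp (K * 0)"
    proof (rule differentiable_bound_general[OF t, where f' = h and \<phi>' = "\<lambda>t. M * exp (K * t)"])
      show "continuous_on {0..t} H"
        using H by (meson continuous_at_imp_continuous_on has_vector_derivative_continuous)
      show "norm (h x) \<le> M * exp (K * x)" if "0 < x" for x using h[of x] that by simp
      show "((\<lambda>t. M / K * exp (K * t)) has_vector_derivative M * exp (K * x)) (at x)" for x
        unfolding has_real_derivative_iff_has_vector_derivative[symmetric]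
        using K by (auto intro!: derivative_eq_intros)
    qed (use K in \<open>auto intro!: H continuous_intros\<close>)
    also have "\<dots> \<le> M / K * exp (K * t)" using M K by simp
    finally show ?thesis .
  qed
  consider "0 < t" | "t < 0" | "t = 0" by linarith
  then show ?thesis
  proof cases
    case 1 then show ?thesis using *[OF G g, of t] by simp
  next
    case 2
    have "((\<lambda>s. G (- s)) has_vector_derivative - g (- s)) (at s)" for s
    proof -
      have "((\<lambda>s::real. - s) has_vector_derivative - 1) (at s)"
        by (auto intro!: derivative_eq_intros)
      from vector_diff_chain_at[OF this G[of "- s"]] show ?thesis by (simp add: o_def)
    qed
    from *[OF this, of "- t"] 2 g[of "- _"] show ?thesis by simp
  next
    case 3 then show ?thesis using M K by simp
  qed
qed

text \<open>The Picard operator is a contraction for the norm weighted by \<open>exp (- K \<bar>t\<bar>)\<close> with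
  \<open>K\<close> larger than the Lipschitz constant, so no continuation argument is needed.\<close>

proposition lipschitz_ode_solution_exists:
  fixes f :: "real \<Rightarrow> 'a::euclidean_space \<Rightarrow> 'a"
  assumes cont: "continuous_on UNIV (\<lambda>(t, x). f t x)"
    and L: "0 \<le> L" "\<And>t x y. norm (f t x - f t y) \<le> L * norm (x - y)"
    and bnd: "\<And>t. norm (f t 0) \<le> C"
  obtains y where "y 0 = a" "\<And>t. (y has_vector_derivative f t (y t)) (at t)"
proof -
  define K where "K = L + 1"
  have K: "0 < K" "L / K < 1" "0 \<le> L / K" using L(1) by (auto simp: K_def)
  define w where "w = (\<lambda>t. exp (K * \<bar>t\<bar>))"
  have w: "w t > 0" "1 \<le> w t" for t using K by (auto simp: w_def)
  have contw: "continuous_on UNIV w" unfolding w_def by (intro continuous_intros)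
  \<comment> \<open>The candidate solution is w z with z bounded and continuous, so the fixed point
    can be sought in the complete space of bounded continuous functions.\<close>
  define g where "g z t = f t (w t *\<^sub>R z t)" for z t
  have contg: "continuous_on UNIV (g (apply_bcontfun z))" for z
  proof -
    have "continuous_on UNIV ((\<lambda>(t, x). f t x) \<circ> (\<lambda>t. (t, w t *\<^sub>R apply_bcontfun z t)))"
      by (rule continuous_on_compose)
         (auto intro!: continuous_intros contw continuous_on_subset[OF cont])
    then show ?thesis by (simp add: g_def[abs_def] o_def)
  qed
  define G where "G z = (SOME G. G 0 = a \<and> (\<forall>t. (G has_vector_derivative g (apply_bcontfun z) t) (at t)))"
    for z
  have G: "G z 0 = a" "(G z has_vector_derivative g (apply_bcontfun z) t) (at t)" for z t
  proof -
    have "\<exists>G. G 0 = a \<and> (\<forall>t. (G has_vector_derivative g (apply_bcontfun z) t) (at t))"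
      using antiderivative_exists[OF contg[of z], of a] by blast
    from someI_ex[OF this, folded G_def]
    show "G z 0 = a" "(G z has_vector_derivative g (apply_bcontfun z) t) (at t)" by auto
  qed
  \<comment> \<open>The Picard image of the candidate w z, divided by w again to return to bounded
    functions.\<close>
  define P where "P z t = G z t /\<^sub>R w t" for z t
  have P: "P z \<in> bcontfun" for z
  proof -
    obtain B where B: "\<And>t. norm (apply_bcontfun z t) \<le> B"
      using bounded_apply_bcontfun[of z] by (auto simp: bounded_iff)
    have "norm (g (apply_bcontfun z) t) \<le> (C + L * B) * w t" for t
    proof -
      have "norm (g (apply_bcontfun z) t) \<le> norm (f t 0) + norm (g (apply_bcontfun z) t - f t 0)"
        by (metis add.commute diff_add_cancel norm_triangle_ineq)
      also have "\<dots> \<le> C + L * norm (w t *\<^sub>R apply_bcontfun z t - 0)"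
        unfolding g_def by (intro add_mono bnd L)
      also have "\<dots> \<le> C * w t + L * (w t * B)"
        using w[of t] B[of t] L(1) order_trans[OF norm_ge_zero bnd[of t]]
        by (intro add_mono mult_left_mono) (auto simp: mult_le_cancel_left1)
      finally show ?thesis by (simp add: algebra_simps)
    qed
    then have "norm (G z t - G z 0) \<le> (C + L * B) / K * w t" for t
      unfolding w_def by (intro exp_bound_antiderivative[OF G(2) K(1)])
    note 1 = this[unfolded G(1)]
    have "norm (P z t) \<le> norm a + (C + L * B) / K" for t
    proof -
      have "norm (G z t) \<le> norm a + (C + L * B) / K * w t"
        using 1[of t] norm_triangle_ineq2[of "G z t" a] by linarith
      also have "\<dots> \<le> norm a * w t + (C + L * B) / K * w t"
        using w[of t] by (simp add: mult_le_cancel_left1)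
      finally show ?thesis using w[of t] by (simp add: P_def field_simps)
    qed
    moreover have "continuous_on UNIV (G z)"
      using G(2) by (meson continuous_at_imp_continuous_on has_vector_derivative_continuous)
    then have "continuous_on UNIV (P z)"
      using w unfolding P_def by (auto intro!: continuous_intros contw simp: less_imp_neq[symmetric])
    ultimately show ?thesis by (auto simp: bcontfun_def bounded_iff)
  qed
  define \<Psi> where "\<Psi> z = Bcontfun (P z)" for z
  have \<Psi>: "apply_bcontfun (\<Psi> z) = P z" for z
    unfolding \<Psi>_def by (rule Bcontfun_inverse[OF P])
  have "dist (\<Psi> z1) (\<Psi> z2) \<le> L / K * dist z1 z2" for z1 z2
  proof (rule dist_bound)
    fix t
    have "norm (g (apply_bcontfun z1) t - g (apply_bcontfun z2) t) \<le> (L * dist z1 z2) * w t" for t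
    proof -
      have "norm (g (apply_bcontfun z1) t - g (apply_bcontfun z2) t)
        \<le> L * norm (w t *\<^sub>R apply_bcontfun z1 t - w t *\<^sub>R apply_bcontfun z2 t)"
        unfolding g_def by (rule L)
      also have "\<dots> = L * (w t * dist (apply_bcontfun z1 t) (apply_bcontfun z2 t))"
        using w[of t] by (simp add: scaleR_diff_right[symmetric] dist_norm)
      also have "\<dots> \<le> L * (w t * dist z1 z2)"
        using w[of t] L(1) dist_bounded[of z1 t z2] by (intro mult_left_mono) auto
      finally show ?thesis by (simp add: algebra_simps)
    qed
    then have "norm ((G z1 t - G z2 t) - (G z1 0 - G z2 0)) \<le> (L * dist z1 z2) / K * w t"
      unfolding w_def
      by (intro exp_bound_antiderivative[where G = "\<lambda>t. G z1 t - G z2 t", OF _ K(1)])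
         (auto intro!: derivative_eq_intros G(2))
    then have "norm (G z1 t - G z2 t) \<le> L / K * dist z1 z2 * w t" by (simp add: G(1))
    then have "norm (G z1 t - G z2 t) / w t \<le> L / K * dist z1 z2"
      using w[of t] by (simp add: pos_divide_le_eq)
    moreover have "dist (P z1 t) (P z2 t) = norm (G z1 t - G z2 t) / w t"
      using w[of t] by (simp add: P_def dist_norm scaleR_diff_right[symmetric] divide_inverse mult.commute)
    ultimately show "dist (apply_bcontfun (\<Psi> z1) t) (apply_bcontfun (\<Psi> z2) t) \<le> L / K * dist z1 z2"
      by (simp add: \<Psi>)
  qed
  then obtain z where z: "\<Psi> z = z"
    using banach_fix_type[of "L / K" \<Psi>] K by blast
  have "G z t = w t *\<^sub>R apply_bcontfun z t" for t
    using w[of t] arg_cong[OF z, of "\<lambda>u. w t *\<^sub>R apply_bcontfun u t"] by (simp add: \<Psi> P_def)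
  with G[of z] that[of "G z"] show thesis by (simp add: g_def)
qed

text \<open>Gronwall in differential form: exp(-2Lt) |y - z|^2 is nonincreasing and starts at 0.
  Derivatives are taken within the interval because an arc has only one-sided derivatives at its
  ends.\<close>

proposition lipschitz_ode_solution_unique:
  fixes y z :: "real \<Rightarrow> 'a::euclidean_space"
  assumes y: "\<And>t. t \<in> {a..b} \<Longrightarrow> (y has_vector_derivative f t (y t)) (at t within {a..b})"
    and z: "\<And>t. t \<in> {a..b} \<Longrightarrow> (z has_vector_derivative f t (z t)) (at t within {a..b})"
    and L: "\<And>t u v. t \<in> {a..b} \<Longrightarrow> norm (f t u - f t v) \<le> L * norm (u - v)"
    and eq: "y a = z a" and t: "t \<in> {a..b}"
  shows "y t = z t"
proof -
  define d where "d t = exp (- (2 * L) * t) * inner (y t - z t) (y t - z t)" for t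
  have yz: "((\<lambda>t. y t - z t) has_vector_derivative f t (y t) - f t (z t)) (at t within {a..b})"
    if "t \<in> {a..b}" for t
    by (intro has_vector_derivative_diff y z that)
  have cont: "continuous_on {a..b} (\<lambda>t. y t - z t)"
    using yz continuous_on_eq_continuous_within has_vector_derivative_continuous by blast
  have "d t \<le> d a"
  proof (rule DERIV_nonpos_imp_decreasing_open[of a t d])
    show "a \<le> t" using t by simp
    show "continuous_on {a..t} d"
      unfolding d_def using t
      by (intro continuous_intros continuous_on_subset[OF cont]) auto
    fix x assume x: "a < x" "x < t"
    have 1: "((\<lambda>t. y t - z t) has_derivative (\<lambda>h. h *\<^sub>R (f x (y x) - f x (z x)))) (at x)"
      using yz[of x] x t by (simp add: at_within_Icc_at has_vector_derivative_def)
    have e: "((\<lambda>t. exp (- (2 * L) * t)) has_real_derivative - (2 * L) * exp (- (2 * L) * x)) (at x)"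
      by (auto intro!: derivative_eq_intros)
    have "((\<lambda>t. inner (y t - z t) (y t - z t)) has_real_derivative
        2 * inner (y x - z x) (f x (y x) - f x (z x))) (at x)"
      unfolding has_field_derivative_def
      by (rule has_derivative_eq_rhs[OF has_derivative_inner[OF 1 1]])
         (auto simp: inner_commute algebra_simps)
    note DERIV_mult[OF e this]
    then have 2: "(d has_real_derivative exp (- (2 * L) * x) *
        (2 * inner (y x - z x) (f x (y x) - f x (z x)) - 2 * L * inner (y x - z x) (y x - z x))) (at x)"
      unfolding d_def
      by (rule DERIV_cong) (simp add: algebra_simps)
    have "inner (y x - z x) (f x (y x) - f x (z x)) \<le> norm (y x - z x) * norm (f x (y x) - f x (z x))"
      by (rule norm_cauchy_schwarz)
    also have "\<dots> \<le> norm (y x - z x) * (L * norm (y x - z x))"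
      using x t by (intro mult_left_mono L) auto
    also have "\<dots> = L * inner (y x - z x) (y x - z x)"
      by (simp add: power2_norm_eq_inner[symmetric] power2_eq_square)
    finally show "\<exists>y. (d has_real_derivative y) (at x) \<and> y \<le> 0"
      using 2 by (intro exI conjI) (auto simp: mult_le_0_iff)
  qed
  then have "inner (y t - z t) (y t - z t) \<le> 0" by (simp add: d_def eq mult_le_0_iff)
  then show ?thesis using inner_ge_zero[of "y t - z t"] by (simp add: order_antisym_conv)
qed

section \<open>The du Bois-Reymond lemma\<close>

text \<open>Localizes the weak formulation to a compact interval, where continuity gives
  integrability. The derivative of \<eta> vanishes off the interval because \<eta> is zero on an
  open neighbourhood of each such point.\<close>

lemma integral_test_function:
  fixes F G :: "real \<Rightarrow> 'a::banach"
  assumes "test_function D \<eta>" and "{a..b} \<subseteq> D" "\<And>s. s \<notin> {a..b} \<Longrightarrow> \<eta> s = 0"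
  shows "integral D (\<lambda>s. \<eta> s *\<^sub>R G s) = integral {a..b} (\<lambda>s. \<eta> s *\<^sub>R G s)"
    "integral D (\<lambda>s. deriv \<eta> s *\<^sub>R F s) = integral {a..b} (\<lambda>s. deriv \<eta> s *\<^sub>R F s)"
proof -
  have *: "integral D h = integral {a..b} h" if "\<And>s. s \<notin> {a..b} \<Longrightarrow> h s = 0" for h :: "real \<Rightarrow> 'a"
  proof -
    have "integral D h = integral D (\<lambda>s. if s \<in> {a..b} then h s else 0)"
      using that by (intro integral_cong) auto
    also have "\<dots> = integral ({a..b} \<inter> D) h"
      by (rule Henstock_Kurzweil_Integration.integral_restrict_Int)
    finally show ?thesis using assms(2) by (simp add: Int_absorb2)
  qed
  show "integral D (\<lambda>s. \<eta> s *\<^sub>R G s) = integral {a..b} (\<lambda>s. \<eta> s *\<^sub>R G s)"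
    using assms by (intro *) simp
  have "deriv \<eta> s = 0" if "s \<notin> {a..b}" for s
  proof -
    have "eventually (\<lambda>x. x \<in> - {a..b}) (nhds s)"
      using that by (intro eventually_nhds_in_open) auto
    then have "eventually (\<lambda>x. \<eta> x = 0) (nhds s)"
      by eventually_elim (use assms in auto)
    then have "deriv \<eta> s = deriv (\<lambda>_. 0) s" by (intro deriv_cong_ev) auto
    then show ?thesis by simp
  qed
  then show "integral D (\<lambda>s. deriv \<eta> s *\<^sub>R F s) = integral {a..b} (\<lambda>s. deriv \<eta> s *\<^sub>R F s)"
    by (intro *) simp
qed

text \<open>Du Bois-Reymond: test with the primitive of \<open>w (k - m)\<close>, where \<open>k\<close> is a component of
  \<open>F - \<integral> G\<close>, the weight \<open>w\<close> vanishes at both ends and \<open>m\<close> is the weighted mean of \<open>k\<close>.\<close>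

proposition weak_derivative_imp_derivative:
  fixes F :: "real \<Rightarrow> 'a::euclidean_space"
  assumes wd: "has_weak_derivative F G D" and D: "{a..b} \<subseteq> interior D"
    and F: "continuous_on {a..b} F" and G: "continuous_on {a..b} G" and t: "a < t" "t < b"
  shows "(F has_vector_derivative G t) (at t)"
proof -
  have ab: "a < b" using t by simp
  define H where "H t = integral {a..t} G" for t
  have H: "(H has_vector_derivative G t) (at t within {a..b})" if "t \<in> {a..b}" for t
    unfolding H_def by (rule integral_has_vector_derivative[OF G that])
  then have contH: "continuous_on {a..b} H"
    using continuous_on_eq_continuous_within has_vector_derivative_continuous by blast
  have const: "inner (F s - H s) e = inner (F t - H t) e" if s: "a < s" "s < b" for s e
  proof -
    define k where "k t = inner (F t - H t) e" for t
    \<comment> \<open>Because the weight vanishes at both ends, \<open>h\<close> below extends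
      continuously by 0, so its primitive is an admissible C^1 test function.\<close>
    define w where "w t = (t - a) * (b - t)" for t :: real
    have k: "continuous_on {a..b} k" unfolding k_def by (intro continuous_intros F contH)
    have w: "continuous_on A w" for A unfolding w_def by (intro continuous_intros)
    have wpos: "0 < w t" if "a < t" "t < b" for t using that by (simp add: w_def)
    have "integral {a..b} w \<noteq> 0"
    proof
      assume "integral {a..b} w = 0"
      moreover have "0 \<le> w x" if "x \<in> {a..b}" for x using that by (simp add: w_def)
      ultimately have "\<forall>x\<in>{a..b}. w x = 0" using integral_eq_0_iff[OF w ab] by blast
      then have "w t = 0" using t by (meson atLeastAtMost_iff less_imp_le)
      with wpos[OF t] show False by simp
    qed
    \<comment> \<open>This mean makes the integral of \<open>h\<close> zero, so the primitive that
      starts at 0 returns to 0 at b and has compact support.\<close>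
    define m where "m = integral {a..b} (\<lambda>t. w t * k t) / integral {a..b} w"
    define h where "h t = w t * (k t - m)" for t
    have h: "continuous_on {a..b} h" unfolding h_def by (intro continuous_intros w k)
    have int_h: "integral {a..b} h = 0"
    proof -
      have "integral {a..b} h = integral {a..b} (\<lambda>t. w t * k t - w t * m)"
        by (simp add: h_def[abs_def] algebra_simps)
      also have "\<dots> = integral {a..b} (\<lambda>t. w t * k t) - integral {a..b} w * m"
        by (subst integral_diff) (auto intro!: integrable_continuous_interval continuous_intros w k)
      finally show ?thesis using \<open>integral {a..b} w \<noteq> 0\<close> by (simp add: m_def)
    qed
    define h' where "h' t = (if t \<in> {a..b} then h t else 0)" for t
    have ends: "h a = 0" "h b = 0" by (simp_all add: h_def w_def)
    have h': "continuous_on UNIV h'"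
    proof -
      have "continuous_on ({a..b} \<union> ({..a} \<union> {b..})) h'"
        unfolding h'_def
        by (rule continuous_on_cases) (auto simp: h ends intro!: closed_Un dest: order_antisym)
      also have "{a..b} \<union> ({..a} \<union> {b..}) = (UNIV :: real set)" by auto
      finally show ?thesis .
    qed
    from antiderivative_exists[OF h'] obtain E where E: "\<And>t. (E has_vector_derivative h' t) (at t)"
      by metis
    define \<eta> where "\<eta> t = E t - E a" for t
    have \<eta>: "(\<eta> has_real_derivative h' t) (at t)" for t
      unfolding \<eta>_def has_real_derivative_iff_has_vector_derivative
      by (auto intro!: derivative_eq_intros E)
    have "(h has_integral \<eta> b - \<eta> a) {a..b}"
    proof (rule fundamental_theorem_of_calculus)
      show "(\<eta> has_vector_derivative h x) (at x within {a..b})" if "x \<in> {a..b}" for x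
        using \<eta>[of x] that unfolding has_real_derivative_iff_has_vector_derivative
        by (auto simp: h'_def intro: has_vector_derivative_at_within)
    qed (use ab in auto)
    then have \<eta>ab: "\<eta> a = 0" "\<eta> b = 0"
      using int_h by (auto simp: integral_unique \<eta>_def)
    have "\<eta> x = 0" if "x \<notin> {a..b}" for x
    proof (cases "x < a")
      case True
      have "\<exists>c. \<forall>t\<in>{..a}. \<eta> t = c"
      proof (rule has_field_derivative_zero_constant)
        show "(\<eta> has_field_derivative 0) (at t within {..a})" if "t \<in> {..a}" for t
          using \<eta>[of t] that ab by (cases "t = a")
            (auto simp: h'_def h_def w_def intro: has_field_derivative_at_within)
      qed simp
      then show ?thesis using True \<eta>ab by force
    next
      case False
      with that have x: "b < x" by simp
      have "\<exists>c. \<forall>t\<in>{b..}. \<eta> t = c"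
      proof (rule has_field_derivative_zero_constant)
        show "(\<eta> has_field_derivative 0) (at t within {b..})" if "t \<in> {b..}" for t
          using \<eta>[of t] that ab by (cases "t = b")
            (auto simp: h'_def h_def w_def intro: has_field_derivative_at_within)
      qed simp
      then show ?thesis using x \<eta>ab by force
    qed
    note out = this
    have deriv: "deriv \<eta> = h'" using \<eta> by (auto intro!: ext DERIV_imp_deriv)
    have test: "test_function D \<eta>"
      unfolding test_function_def deriv using \<eta> h' D out
      by (meson real_differentiable_def)
    have cont\<eta>: "continuous_on {a..b} \<eta>"
      using \<eta> by (meson DERIV_continuous continuous_at_imp_continuous_on)
    have "{a..b} \<subseteq> D" using D interior_subset by blast
    have IT: "integral D (\<lambda>s. \<eta> s *\<^sub>R G s) = integral {a..b} (\<lambda>s. \<eta> s *\<^sub>R G s)"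
      "integral D (\<lambda>s. h' s *\<^sub>R F s) = integral {a..b} (\<lambda>s. h' s *\<^sub>R F s)"
      using integral_test_function(1)[OF test \<open>{a..b} \<subseteq> D\<close> out, of G]
        integral_test_function(2)[OF test \<open>{a..b} \<subseteq> D\<close> out, of F] unfolding deriv by blast+
    have "integral D (\<lambda>s. deriv \<eta> s *\<^sub>R F s) = - integral D (\<lambda>s. \<eta> s *\<^sub>R G s)"
      using wd test unfolding has_weak_derivative_def by blast
    then have 1: "integral {a..b} (\<lambda>s. h' s *\<^sub>R F s) = - integral {a..b} (\<lambda>s. \<eta> s *\<^sub>R G s)"
      unfolding deriv IT .
    have hh: "integral {a..b} (\<lambda>s. h' s *\<^sub>R u s) = integral {a..b} (\<lambda>s. h s *\<^sub>R u s)" for u :: "real \<Rightarrow> 'a"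
      by (rule integral_cong) (auto simp: h'_def)
    have "((\<lambda>s. h s *\<^sub>R H s + \<eta> s *\<^sub>R G s) has_integral \<eta> b *\<^sub>R H b - \<eta> a *\<^sub>R H a) {a..b}"
    proof (rule fundamental_theorem_of_calculus)
      fix x assume x: "x \<in> {a..b}"
      have "(\<eta> has_real_derivative h x) (at x within {a..b})"
        using has_field_derivative_at_within[OF \<eta>[of x]] x by (simp add: h'_def)
      from has_vector_derivative_scaleR[OF this H[OF x]]
      show "((\<lambda>s. \<eta> s *\<^sub>R H s) has_vector_derivative h x *\<^sub>R H x + \<eta> x *\<^sub>R G x) (at x within {a..b})"
        by (simp add: add.commute)
    qed (use ab in auto)
    then have "integral {a..b} (\<lambda>s. h s *\<^sub>R H s + \<eta> s *\<^sub>R G s) = 0"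
      by (simp add: integral_unique \<eta>ab)
    then have 2: "integral {a..b} (\<lambda>s. h s *\<^sub>R H s) + integral {a..b} (\<lambda>s. \<eta> s *\<^sub>R G s) = 0"
      by (subst (asm) integral_add)
        (auto intro!: integrable_continuous_interval continuous_intros h cont\<eta> G contH)
    have int: "(\<lambda>s. h s *\<^sub>R (F s - H s)) integrable_on {a..b}"
      by (intro integrable_continuous_interval continuous_intros h F contH)
    have "integral {a..b} (\<lambda>s. h s *\<^sub>R (F s - H s)) = 0"
      unfolding scaleR_diff_right using 1 2
      by (subst integral_diff) (auto simp: hh add_eq_0_iff intro!: integrable_continuous_interval continuous_intros h F contH)
    then have "integral {a..b} (\<lambda>s. inner (h s *\<^sub>R (F s - H s)) e) = 0"
      using integral_linear[OF int bounded_linear_inner_left[of e]] by (simp add: o_def)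
    then have 3: "integral {a..b} (\<lambda>s. h s * k s) = 0" by (simp add: k_def)
    \<comment> \<open>Subtracting the constant m is free since \<open>h\<close> has integral 0, and
      it turns the integrand into the nonnegative w (k - m)^2.\<close>
    have "integral {a..b} (\<lambda>s. h s * (k s - m)) = 0"
      unfolding right_diff_distrib using 3 int_h
      by (subst integral_diff) (auto intro!: integrable_continuous_interval continuous_intros h k)
    then have "integral {a..b} (\<lambda>s. w s * (k s - m)\<^sup>2) = 0"
      by (simp add: h_def power2_eq_square mult.assoc)
    then have "\<forall>s\<in>{a..b}. w s * (k s - m)\<^sup>2 = 0"
      by (subst (asm) integral_eq_0_iff) (auto intro!: continuous_intros w k ab simp: w_def)
    then have "k s = m" if "a < s" "s < b" for s
      using that wpos[of s] by force
    then show ?thesis using s t by (simp add: k_def)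
  qed
  have eq: "H s + (F t - H t) = F s" if "s \<in> {a<..<b}" for s
  proof -
    have "F s - H s = F t - H t" by (rule euclidean_eqI) (use that in \<open>intro const, auto\<close>)
    then show ?thesis by (simp add: algebra_simps)
  qed
  have "((\<lambda>s. H s + (F t - H t)) has_vector_derivative G t) (at t)"
    using H[of t] t by (auto intro!: derivative_eq_intros simp: at_within_Icc_at)
  from has_vector_derivative_transform_within_open[OF this open_greaterThanLessThan _ eq] t
  show ?thesis by simp
qed

text \<open>Test functions see only the interior. At the ends of an arc the one-sided derivative
  comes from F s = F a + integral of G, which holds up to the boundary because F and G are
  continuous there.\<close>

proposition weak_derivative_imp_derivative_within:
  fixes F :: "real \<Rightarrow> 'a::euclidean_space"
  assumes wd: "has_weak_derivative F G D" and D: "D = {a..b} \<and> a < b \<or> D = UNIV"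
    and F: "continuous_on D F" and G: "continuous_on D G" and t: "t \<in> D"
  shows "(F has_vector_derivative G t) (at t within D)"
  using D
proof
  assume "D = UNIV"
  then show ?thesis
    using weak_derivative_imp_derivative[OF wd, of "t - 1" "t + 1" t] F G
    by (auto intro: continuous_on_subset)
next
  assume D: "D = {a..b} \<and> a < b"
  have *: "(F has_vector_derivative G s) (at s)" if "a < s" "s < b" for s
  proof -
    let ?I = "{(a + s) / 2..(s + b) / 2}"
    have sub: "?I \<subseteq> {a<..<b}" using that by auto
    moreover have "{a<..<b} \<subseteq> D" "interior D = {a<..<b}" using D by auto
    ultimately have I: "?I \<subseteq> D" "?I \<subseteq> interior D" by blast+
    have "continuous_on ?I F" "continuous_on ?I G"
      using F G I(1) by (auto intro: continuous_on_subset)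
    from weak_derivative_imp_derivative[OF wd I(2) this] that
    show ?thesis by simp
  qed
  have eq: "F s = F a + integral {a..s} G" if "s \<in> {a..b}" for s
  proof -
    have "(G has_integral F s - F a) {a..s}"
      using that D by (intro fundamental_theorem_of_calculus_interior continuous_on_subset[OF F] *) auto
    then show ?thesis by (simp add: integral_unique)
  qed
  have "((\<lambda>s. F a + integral {a..s} G) has_vector_derivative G t) (at t within {a..b})"
    using integral_has_vector_derivative[of a b G t] G t D by (auto intro!: derivative_eq_intros)
  with has_vector_derivative_transform[OF _ eq this] D t show ?thesis by simp
qed

section \<open>Derivatives of products, and frames\<close>

lemma has_vector_derivative_iff_quotient:
  fixes f :: "real \<Rightarrow> 'a::real_normed_vector"
  shows "(f has_vector_derivative f') (at x within S) \<longleftrightarrow>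
    ((\<lambda>y. (f y - f x) /\<^sub>R (y - x)) \<longlongrightarrow> f') (at x within S)"
proof -
  have eq: "norm ((f y - f x) /\<^sub>R (y - x) - f') = norm ((f y - f x) - (y - x) *\<^sub>R f') / norm (y - x)"
    if "y \<noteq> x" for y
  proof -
    have "(f y - f x) /\<^sub>R (y - x) - f' = ((f y - f x) - (y - x) *\<^sub>R f') /\<^sub>R (y - x)"
      using that by (simp add: scaleR_diff_right)
    then show ?thesis by (simp add: divide_inverse_commute)
  qed
  have "((\<lambda>y. (f y - f x) /\<^sub>R (y - x)) \<longlongrightarrow> f') (at x within S) \<longleftrightarrow>
    ((\<lambda>y. norm ((f y - f x) /\<^sub>R (y - x) - f')) \<longlongrightarrow> 0) (at x within S)"
    by (simp add: tendsto_norm_zero_iff LIM_zero_iff)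
  also have "\<dots> \<longleftrightarrow> ((\<lambda>y. norm ((f y - f x) - (y - x) *\<^sub>R f') / norm (y - x)) \<longlongrightarrow> 0) (at x within S)"
    by (rule tendsto_cong) (auto simp: eventually_at_filter eq)
  finally show ?thesis
    by (simp add: has_vector_derivative_def has_derivative_iff_norm bounded_linear_scaleR_left)
qed

text \<open>Where f vanishes, the difference quotient of the product is the product of the quotient
  of f with g, so continuity of g suffices. This is the product rule for F and T at a zero of
  \<phi>.\<close>

lemma (in bounded_bilinear) has_vector_derivative_at_zero:
  assumes f: "(f has_vector_derivative f') (at x within S)" "f x = 0"
    and g: "continuous (at x within S) g"
  shows "((\<lambda>x. prod (f x) (g x)) has_vector_derivative prod f' (g x)) (at x within S)"
proof -
  have "((\<lambda>y. prod ((f y - f x) /\<^sub>R (y - x)) (g y)) \<longlongrightarrow> prod f' (g x)) (at x within S)"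
    using f(1) g unfolding has_vector_derivative_iff_quotient continuous_within
    by (rule tendsto)
  then show ?thesis
    unfolding has_vector_derivative_iff_quotient using f(2) by (simp add: scaleR_left zero_left)
qed

lemma has_vector_derivative_nonzero_eventually:
  fixes f :: "real \<Rightarrow> 'a::real_normed_vector"
  assumes "(f has_vector_derivative f') (at x within S)" "f x = 0" "f' \<noteq> 0"
  shows "eventually (\<lambda>y. f y \<noteq> 0) (at x within S)"
proof -
  have "eventually (\<lambda>y. (f y - f x) /\<^sub>R (y - x) \<noteq> 0) (at x within S)"
    using tendsto_imp_eventually_ne assms(1,3) unfolding has_vector_derivative_iff_quotient by blast
  then show ?thesis by eventually_elim (use assms in auto)
qed

lemma bounded_bilinear_cross3: "bounded_bilinear cross3"
  using bilinear_cross by (simp add: bilinear_conv_bounded_bilinear)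

lemmas cross3_diff_left = bounded_bilinear.diff_left[OF bounded_bilinear_cross3]
lemmas cross3_diff_right = bounded_bilinear.diff_right[OF bounded_bilinear_cross3]

lemmas has_vector_derivative_cross3 =
  bounded_bilinear.has_vector_derivative[OF bounded_bilinear_cross3]

lemma has_vector_derivative_inner:
  assumes "(f has_vector_derivative f') (at x within S)" "(g has_vector_derivative g') (at x within S)"
  shows "((\<lambda>x. inner (f x) (g x)) has_real_derivative inner (f x) g' + inner f' (g x)) (at x within S)"
  unfolding has_real_derivative_iff_has_vector_derivative
  by (rule bounded_bilinear.has_vector_derivative[OF bounded_bilinear_inner assms])

lemma has_vector_derivative_inner_const:
  assumes "(g has_vector_derivative g') (at x within S)"
  shows "((\<lambda>x. inner v (g x)) has_real_derivative inner v g') (at x within S)"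
  using has_vector_derivative_inner[OF has_vector_derivative_const assms] by simp

lemma has_real_derivative_zero_const:
  fixes f :: "real \<Rightarrow> real"
  assumes "convex S" "\<And>x. x \<in> S \<Longrightarrow> (f has_real_derivative 0) (at x within S)" "x \<in> S" "y \<in> S"
  shows "f x = f y"
  using has_field_derivative_zero_constant[OF assms(1,2)] assms(3,4) by metis

lemma has_vector_derivative_zero_const:
  assumes "convex S" "\<And>x. x \<in> S \<Longrightarrow> (f has_vector_derivative 0) (at x within S)" "x \<in> S" "y \<in> S"
  shows "f x = f y"
  using has_vector_derivative_zero_constant[OF assms(1,2)] assms(3,4) by metis

lemma norm_1_inner [simp]: "norm x = 1 \<Longrightarrow> inner x x = 1"
  by (simp add: dot_square_norm)

lemma orthonormal_frame_expansion:
  fixes T N x :: "real^3"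
  assumes T: "norm T = 1" and N: "norm N = 1" and TN: "inner T N = 0"
  shows "x = inner x T *\<^sub>R T + inner x N *\<^sub>R N + inner x (cross3 T N) *\<^sub>R cross3 T N"
    and "norm (cross3 T N) = 1"
    and "cross3 T (cross3 T N) = - N" "cross3 N (cross3 T N) = T"
proof -
  note perp = dot_cross_self
  have "(norm (cross3 T N))\<^sup>2 = 1" using norm_cross_dot[of T N] assms by simp
  then show B: "norm (cross3 T N) = 1" by (simp add: power2_eq_1_iff)
      (metis norm_ge_zero not_one_le_zero zero_le_one neg_0_le_iff_le order_trans)
  show "cross3 T (cross3 T N) = - N" "cross3 N (cross3 T N) = T"
    using assms by (simp_all add: Lagrange inner_commute)
  \<comment> \<open>The remainder is orthogonal to T, N and T x N. By Lagrange's formula its cross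
    product with T x N vanishes as well, and together with orthogonality this forces it to be
    0.\<close>
  define w where "w = x - (inner x T *\<^sub>R T + inner x N *\<^sub>R N + inner x (cross3 T N) *\<^sub>R cross3 T N)"
  have "inner w T = 0" "inner w N = 0" "inner w (cross3 T N) = 0"
    using assms B by (simp_all add: w_def inner_diff_left inner_add_left perp inner_commute[of N T])
  then have "w = 0"
    using norm_cross_dot[of w "cross3 T N"] B by (simp add: Lagrange)
  then show "x = inner x T *\<^sub>R T + inner x N *\<^sub>R N + inner x (cross3 T N) *\<^sub>R cross3 T N"
    by (simp add: w_def)
qed

section \<open>The conservation laws of a balanced curve\<close>

text \<open>The balance condition with its weak derivative already upgraded to a classical one,
  one-sided at the ends of an arc. N is constrained only where \<phi> > 0; \<open>not_bot\<close>
  makes derivatives within D unique.\<close>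

locale kink_balanced =
  fixes D :: "real set" and \<gamma> T N :: "real \<Rightarrow> real^3" and \<phi> :: "real \<Rightarrow> real" and V :: "real^3"
  assumes convex_D: "convex D" and closed_D: "closed D"
    and not_bot: "\<And>s. s \<in> D \<Longrightarrow> at s within D \<noteq> bot"
    and \<gamma>_deriv: "\<And>s. s \<in> D \<Longrightarrow> (\<gamma> has_vector_derivative T s) (at s within D)"
    and norm_T: "\<And>s. s \<in> D \<Longrightarrow> norm (T s) = 1"
    and cont_T: "continuous_on D T"
    and \<phi>_nonneg: "\<And>s. s \<in> D \<Longrightarrow> 0 \<le> \<phi> s"
    and T_deriv: "\<And>s. s \<in> D \<Longrightarrow> 0 < \<phi> s \<Longrightarrow> (T has_vector_derivative N s) (at s within D)"
    and norm_N: "\<And>s. s \<in> D \<Longrightarrow> 0 < \<phi> s \<Longrightarrow> norm (N s) = 1"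
    and F_deriv: "\<And>s. s \<in> D \<Longrightarrow>
      ((\<lambda>s. \<phi> s *\<^sub>R N s) has_vector_derivative (1 - 2 * \<phi> s) *\<^sub>R T s - V) (at s within D)"
begin

definition F where "F s = \<phi> s *\<^sub>R N s"
definition B where "B s = cross3 (T s) (N s)"
definition N' where "N' s = vector_derivative N (at s within D)"
definition \<tau> where "\<tau> s = inner (N' s) (B s)"
text \<open>This is \<phi>' on the support. The formula in N shows that it can be differentiated
  once more as soon as N can.\<close>

definition \<psi> where "\<psi> s = - inner V (N s)"

lemma DF: "s \<in> D \<Longrightarrow> (F has_vector_derivative (1 - 2 * \<phi> s) *\<^sub>R T s - V) (at s within D)"
  using F_deriv unfolding F_def[abs_def] .

lemma cont_F: "continuous_on D F"
  using DF continuous_on_eq_continuous_within has_vector_derivative_continuous by blast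

lemma norm_F: "s \<in> D \<Longrightarrow> norm (F s) = \<phi> s"
  using \<phi>_nonneg[of s] norm_N[of s] by (cases "\<phi> s = 0") (auto simp: F_def)

lemma cont_\<phi>: "continuous_on D \<phi>"
proof -
  have "continuous_on D (\<lambda>s. norm (F s))" by (intro continuous_intros cont_F)
  then show ?thesis by (rule continuous_on_eq) (rule norm_F)
qed

lemma DT_cont: "s \<in> D \<Longrightarrow> continuous (at s within D) T"
  using cont_T continuous_on_eq_continuous_within by blast

lemma positive_nbhd:
  assumes "s \<in> D" "0 < \<phi> s"
  obtains d where "0 < d" "\<And>x. x \<in> D \<Longrightarrow> dist x s < d \<Longrightarrow> 0 < \<phi> x"
proof -
  obtain d where "d > 0" "\<forall>x\<in>D. dist x s < d \<longrightarrow> dist (\<phi> x) (\<phi> s) < \<phi> s"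
    using cont_\<phi>[unfolded continuous_on_iff] assms by blast
  with that[of d] show thesis by (force simp: dist_real_def)
qed

lemma TN: assumes "s \<in> D" "0 < \<phi> s" shows "inner (T s) (N s) = 0"
proof -
  have "((\<lambda>s. inner (T s) (T s)) has_real_derivative 2 * inner (T s) (N s)) (at s within D)"
    using has_vector_derivative_inner[OF T_deriv T_deriv, OF assms assms] by (simp add: inner_commute)
  then have "((\<lambda>s. inner (T s) (T s)) has_vector_derivative 2 * inner (T s) (N s)) (at s within D)"
    by (simp add: has_real_derivative_iff_has_vector_derivative)
  moreover have "((\<lambda>s. inner (T s) (T s)) has_vector_derivative 0) (at s within D)"
    by (rule has_vector_derivative_transform[OF assms(1) _ has_vector_derivative_const[of 1]])
       (simp add: norm_T)
  ultimately show ?thesis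
    using vector_derivative_unique_within[OF not_bot[OF assms(1)]] by fastforce
qed

lemma frame:
  assumes "s \<in> D" "0 < \<phi> s"
  shows "x = inner x (T s) *\<^sub>R T s + inner x (N s) *\<^sub>R N s + inner x (B s) *\<^sub>R B s"
    "norm (B s) = 1" "cross3 (T s) (B s) = - N s" "cross3 (N s) (B s) = T s"
    "inner (T s) (B s) = 0" "inner (N s) (B s) = 0"
  unfolding B_def
  using orthonormal_frame_expansion[OF norm_T norm_N TN] assms by (auto simp: dot_cross_self)

text \<open>Here \<phi> = sqrt <F, F> with F nonzero. In <F, F'> the T-part of F' drops out because
  F is parallel to N, leaving -\<phi> <V, N>.\<close>

lemma D\<phi>:
  assumes "s \<in> D" "0 < \<phi> s"
  shows "(\<phi> has_real_derivative \<psi> s) (at s within D)"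
proof -
  have F0: "F s \<noteq> 0" using norm_F assms by force
  have "((\<lambda>s. inner (F s) (F s)) has_real_derivative 2 * inner (F s) ((1 - 2 * \<phi> s) *\<^sub>R T s - V)) (at s within D)"
    using has_vector_derivative_inner[OF DF DF, OF assms(1,1)] by (simp add: inner_commute)
  moreover have "inner (F s) ((1 - 2 * \<phi> s) *\<^sub>R T s - V) = \<phi> s * \<psi> s"
    using TN[OF assms] by (simp add: F_def \<psi>_def inner_diff_right inner_commute)
  ultimately have "((\<lambda>s. sqrt (inner (F s) (F s))) has_real_derivative
      (inverse (sqrt (inner (F s) (F s))) / 2) * (2 * (\<phi> s * \<psi> s))) (at s within D)"
    using F0 by (intro DERIV_chain'[where g = sqrt] DERIV_real_sqrt) auto
  then have "(norm \<circ> F has_real_derivative \<psi> s) (at s within D)"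
    using norm_F[OF assms(1)] assms(2)
    by (simp add: norm_eq_sqrt_inner[symmetric] o_def field_simps)
  then show ?thesis
    unfolding has_real_derivative_iff_has_vector_derivative
    by (rule has_vector_derivative_transform[OF assms(1), rotated]) (simp add: norm_F)
qed

text \<open>Near a point of the support N = F/\<phi> inherits differentiability from F, although N
  enters only as the derivative of T. The second claim equates the product rule for \<phi> N with
  the balance equation.\<close>

lemma DN:
  assumes "s \<in> D" "0 < \<phi> s"
  shows "(N has_vector_derivative N' s) (at s within D)"
    and "(1 - 2 * \<phi> s) *\<^sub>R T s - V = \<phi> s *\<^sub>R N' s + \<psi> s *\<^sub>R N s"
proof -
  obtain d where d: "0 < d" "\<And>x. x \<in> D \<Longrightarrow> dist x s < d \<Longrightarrow> 0 < \<phi> x"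
    using positive_nbhd[OF assms] by metis
  have "((\<lambda>s. inverse (\<phi> s)) has_real_derivative - (\<psi> s / (\<phi> s)\<^sup>2)) (at s within D)"
    using DERIV_inverse_fun[OF D\<phi>[OF assms]] assms(2)
    by (simp add: power2_eq_square divide_inverse)
  from has_vector_derivative_scaleR[OF this DF[OF assms(1)]]
  obtain n where "((\<lambda>s. inverse (\<phi> s) *\<^sub>R F s) has_vector_derivative n) (at s within D)"
    by blast
  then have "(N has_vector_derivative n) (at s within D)"
    by (rule has_vector_derivative_transform_within[OF _ d(1) assms(1)])
       (use d(2) in \<open>force simp: F_def\<close>)
  then show *: "(N has_vector_derivative N' s) (at s within D)"
    unfolding N'_def by (metis differentiableI_vector vector_derivative_works)
  from has_vector_derivative_scaleR[OF D\<phi>[OF assms] this]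
  show "(1 - 2 * \<phi> s) *\<^sub>R T s - V = \<phi> s *\<^sub>R N' s + \<psi> s *\<^sub>R N s"
    using vector_derivative_unique_within[OF not_bot DF] assms unfolding F_def[abs_def] by blast
qed

text \<open>The frame relations hold only where \<phi> > 0. They may be differentiated because
  \<phi> stays positive on a neighbourhood in D.\<close>

lemma derivative_zero_if_const_on_support:
  assumes s: "s \<in> D" "0 < \<phi> s"
    and f: "(f has_real_derivative f') (at s within D)"
    and eq: "\<And>x. x \<in> D \<Longrightarrow> 0 < \<phi> x \<Longrightarrow> f x = c"
  shows "f' = 0"
proof -
  obtain d where d: "0 < d" "\<And>x. x \<in> D \<Longrightarrow> dist x s < d \<Longrightarrow> 0 < \<phi> x"
    using positive_nbhd[OF s] by metis
  have "(f has_vector_derivative 0) (at s within D)"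
    by (rule has_vector_derivative_transform_within[OF has_vector_derivative_const[of c] d(1) s(1)])
       (use d eq in auto)
  then show ?thesis
    using f vector_derivative_unique_within[OF not_bot[OF s(1)]]
    unfolding has_real_derivative_iff_has_vector_derivative by blast
qed

lemma Frenet_N:
  assumes "s \<in> D" "0 < \<phi> s"
  shows "N' s = - T s + \<tau> s *\<^sub>R B s"
proof -
  have "inner (T s) (N' s) + inner (N s) (N s) = 0"
    by (rule derivative_zero_if_const_on_support[OF assms has_vector_derivative_inner[OF T_deriv DN(1)]])
       (use assms TN in auto)
  moreover have "inner (N s) (N' s) + inner (N' s) (N s) = 0"
    by (rule derivative_zero_if_const_on_support[OF assms has_vector_derivative_inner[OF DN(1) DN(1)]])
       (use assms norm_N in auto)
  ultimately have "inner (N' s) (T s) = -1" "inner (N' s) (N s) = 0"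
    using norm_N[OF assms] by (auto simp: inner_commute)
  then show ?thesis using frame(1)[OF assms, of "N' s"] by (simp add: \<tau>_def)
qed

lemma Frenet_B:
  assumes "s \<in> D" "0 < \<phi> s"
  shows "(B has_vector_derivative - \<tau> s *\<^sub>R N s) (at s within D)"
  using has_vector_derivative_cross3[OF T_deriv DN(1), OF assms assms]
  by (simp add: Frenet_N[OF assms] frame(3)[OF assms] cross3_diff_right cross_mult_right B_def[symmetric]
      B_def[abs_def, symmetric])

lemma V_T: assumes "s \<in> D" shows "inner V (T s) = 1 - \<phi> s"
proof -
  have *: "((\<lambda>s. inner (F s) (T s)) has_vector_derivative 0) (at s within D)"
  proof (rule has_vector_derivative_transform[OF assms _ has_vector_derivative_const[of 0]])
    show "inner (F x) (T x) = 0" if "x \<in> D" for x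
      using TN[OF that] \<phi>_nonneg[OF that] by (cases "\<phi> x = 0") (auto simp: F_def inner_commute)
  qed
  note unique = vector_derivative_unique_within[OF not_bot[OF assms] *]
  show ?thesis
  proof (cases "\<phi> s = 0")
    case True
    have "((\<lambda>s. inner (F s) (T s)) has_vector_derivative inner ((1 - 2 * \<phi> s) *\<^sub>R T s - V) (T s)) (at s within D)"
      by (rule bounded_bilinear.has_vector_derivative_at_zero[OF bounded_bilinear_inner DF[OF assms] _ DT_cont[OF assms]])
         (simp add: F_def True)
    from unique[OF this] show ?thesis using True norm_T[OF assms] by (simp add: inner_diff_left)
  next
    case False
    then have pos: "0 < \<phi> s" using \<phi>_nonneg[OF assms] by simp
    have "0 = inner (F s) (N s) + inner ((1 - 2 * \<phi> s) *\<^sub>R T s - V) (T s)"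
      by (rule unique[OF has_vector_derivative_inner[OF DF[OF assms] T_deriv[OF assms pos],
            unfolded has_real_derivative_iff_has_vector_derivative]])
    then show ?thesis using norm_T[OF assms] norm_N[OF assms pos]
      by (simp add: inner_diff_left F_def)
  qed
qed

lemma V_N: "inner V (N s) = - \<psi> s"
  by (simp add: \<psi>_def)

lemma V_B: assumes "s \<in> D" "0 < \<phi> s" shows "inner V (B s) = - \<phi> s * \<tau> s"
  using arg_cong[OF DN(2)[OF assms], of "\<lambda>v. inner v (B s)"] frame[OF assms]
  by (simp add: inner_diff_left inner_add_left \<tau>_def)

text \<open>With \<phi>^2 \<tau> = c the last term is c^2/\<phi>^3, so this is the radial equation
  for \<phi>.\<close>

lemma D\<psi>:
  assumes "s \<in> D" "0 < \<phi> s"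
  shows "(\<psi> has_real_derivative 1 - \<phi> s + \<phi> s * (\<tau> s)\<^sup>2) (at s within D)"
  using DERIV_minus[OF has_vector_derivative_inner_const[OF DN(1)[OF assms], of V]]
  by (simp add: \<psi>_def[abs_def, symmetric] Frenet_N[OF assms] V_T[OF assms(1)] V_B[OF assms]
      inner_diff_right power2_eq_square algebra_simps)

text \<open>The Frenet components of V are <V, T>, <V, N> and <V, B>. The squared length of V is the
  first integral of the radial equation, with (\<phi> \<tau>)^2 = c^2/\<phi>^2 as centrifugal
  term.\<close>

lemma energy:
  assumes "s \<in> D" "0 < \<phi> s"
  shows "V = (1 - \<phi> s) *\<^sub>R T s - \<psi> s *\<^sub>R N s - (\<phi> s * \<tau> s) *\<^sub>R B s"
    and "(norm V)\<^sup>2 = (1 - \<phi> s)\<^sup>2 + (\<psi> s)\<^sup>2 + (\<phi> s * \<tau> s)\<^sup>2"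
proof -
  show V: "V = (1 - \<phi> s) *\<^sub>R T s - \<psi> s *\<^sub>R N s - (\<phi> s * \<tau> s) *\<^sub>R B s"
    using frame(1)[OF assms, of V] V_T[OF assms(1)] V_B[OF assms] V_N by simp
  have "inner V V = inner V ((1 - \<phi> s) *\<^sub>R T s - \<psi> s *\<^sub>R N s - (\<phi> s * \<tau> s) *\<^sub>R B s)"
    using V by simp
  also have "\<dots> = (1 - \<phi> s)\<^sup>2 + (\<psi> s)\<^sup>2 + (\<phi> s * \<tau> s)\<^sup>2"
    unfolding inner_diff_right inner_scaleR_right V_T[OF assms(1)] V_B[OF assms] V_N
    by (simp add: power2_eq_square)
  finally show "(norm V)\<^sup>2 = (1 - \<phi> s)\<^sup>2 + (\<psi> s)\<^sup>2 + (\<phi> s * \<tau> s)\<^sup>2"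
    by (simp add: power2_norm_eq_inner)
qed

text \<open>The conserved quantity c of the overview. Writing it with F and T instead of \<tau>
  gives it a meaning at the zeros of \<phi>.\<close>

definition C where "C s = inner V (cross3 (F s) (T s))"

lemma C_eq: "s \<in> D \<Longrightarrow> 0 < \<phi> s \<Longrightarrow> C s = (\<phi> s)\<^sup>2 * \<tau> s"
  using V_B[of s] by (simp add: C_def F_def B_def cross_mult_left power2_eq_square
      cross_skew[of "N s" "T s"])

text \<open>Since \<open>F\<close> vanishes where \<open>\<phi>\<close> does and \<open>T\<close> is continuous, \<open>C\<close> is differentiable also at the
  zeros of \<open>\<phi>\<close>; hence it is constant across them.\<close>

lemma C_const: assumes "s \<in> D" "t \<in> D" shows "C s = C t"
proof (rule has_real_derivative_zero_const[OF convex_D _ assms])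
  fix s assume s: "s \<in> D"
  let ?F' = "(1 - 2 * \<phi> s) *\<^sub>R T s - V"
  have "((\<lambda>s. cross3 (F s) (T s)) has_vector_derivative cross3 ?F' (T s)) (at s within D)"
  proof (cases "\<phi> s = 0")
    case True
    then show ?thesis
      by (intro bounded_bilinear.has_vector_derivative_at_zero[OF bounded_bilinear_cross3 DF _ DT_cont] s)
         (simp add: F_def)
  next
    case False
    then show ?thesis
      using has_vector_derivative_cross3[OF DF T_deriv, OF s s] \<phi>_nonneg[OF s]
      by (simp add: F_def cross_mult_left)
  qed
  from has_vector_derivative_inner_const[OF this, of V]
  show "(C has_real_derivative 0) (at s within D)"
    by (simp add: C_def[abs_def] cross3_diff_left cross_mult_left inner_diff_right dot_cross_self)
qed

end

section \<open>Nonzero torsion\<close>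

text \<open>B is an independent unknown, which keeps the system linear; the relation B = T x N is
  recovered from the initial data in \<open>frenet_on_orthonormal\<close>.\<close>

definition frenet_on ::
  "real set \<Rightarrow> (real \<Rightarrow> real) \<Rightarrow> (real \<Rightarrow> real^3) \<Rightarrow> (real \<Rightarrow> real^3) \<Rightarrow> (real \<Rightarrow> real^3) \<Rightarrow> bool"
  where "frenet_on S \<tau> T N B \<longleftrightarrow> (\<forall>s\<in>S.
    (T has_vector_derivative N s) (at s within S) \<and>
    (N has_vector_derivative - T s + \<tau> s *\<^sub>R B s) (at s within S) \<and>
    (B has_vector_derivative - \<tau> s *\<^sub>R N s) (at s within S))"

lemma frenet_on_subset: "frenet_on S \<tau> T N B \<Longrightarrow> R \<subseteq> S \<Longrightarrow> frenet_on R \<tau> T N B"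
  unfolding frenet_on_def by (meson has_vector_derivative_within_subset subsetD)

lemma frenet_on_diff:
  assumes "frenet_on S \<tau> T N B" "frenet_on S \<tau> T' N' B'"
  shows "frenet_on S \<tau> (\<lambda>s. T s - T' s) (\<lambda>s. N s - N' s) (\<lambda>s. B s - B' s)"
  unfolding frenet_on_def
proof
  fix s assume s: "s \<in> S"
  note d = assms[unfolded frenet_on_def, rule_format, OF s]
  have "- T s + \<tau> s *\<^sub>R B s - (- T' s + \<tau> s *\<^sub>R B' s) = - (T s - T' s) + \<tau> s *\<^sub>R (B s - B' s)"
    "- \<tau> s *\<^sub>R N s - (- \<tau> s *\<^sub>R N' s) = - \<tau> s *\<^sub>R (N s - N' s)"
    by (simp_all add: algebra_simps)
  then show "((\<lambda>s. T s - T' s) has_vector_derivative N s - N' s) (at s within S) \<and>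
    ((\<lambda>s. N s - N' s) has_vector_derivative - (T s - T' s) + \<tau> s *\<^sub>R (B s - B' s)) (at s within S) \<and>
    ((\<lambda>s. B s - B' s) has_vector_derivative - \<tau> s *\<^sub>R (N s - N' s)) (at s within S)"
    using has_vector_derivative_diff[OF d(1)[THEN conjunct1] d(2)[THEN conjunct1]]
      has_vector_derivative_diff[OF d(1)[THEN conjunct2, THEN conjunct1] d(2)[THEN conjunct2, THEN conjunct1]]
      has_vector_derivative_diff[OF d(1)[THEN conjunct2, THEN conjunct2] d(2)[THEN conjunct2, THEN conjunct2]]
    by (simp only: simp_thms)
qed

text \<open>The coefficient matrix of the Frenet system is skew-symmetric. Applied to a difference
  of two solutions, this gives uniqueness.\<close>

lemma frenet_on_norm_const:
  assumes "frenet_on S \<tau> T N B" "convex S" "s \<in> S" "t \<in> S"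
  shows "(norm (T s))\<^sup>2 + (norm (N s))\<^sup>2 + (norm (B s))\<^sup>2 = (norm (T t))\<^sup>2 + (norm (N t))\<^sup>2 + (norm (B t))\<^sup>2"
  unfolding power2_norm_eq_inner
proof (rule has_real_derivative_zero_const[OF assms(2) _ assms(3,4)])
  fix s assume "s \<in> S"
  note d = assms(1)[unfolded frenet_on_def, rule_format, OF this]
  note dT = d[THEN conjunct1] and dN = d[THEN conjunct2, THEN conjunct1]
    and dB = d[THEN conjunct2, THEN conjunct2]
  show "((\<lambda>s. inner (T s) (T s) + inner (N s) (N s) + inner (B s) (B s)) has_real_derivative 0) (at s within S)"
    by (rule DERIV_cong[OF DERIV_add[OF DERIV_add[OF has_vector_derivative_inner[OF dT dT]
            has_vector_derivative_inner[OF dN dN]] has_vector_derivative_inner[OF dB dB]]])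
       (simp add: inner_commute algebra_simps)
qed

lemma frenet_on_unique:
  assumes "frenet_on S \<tau> T N B" "frenet_on S \<tau> T' N' B'" "convex S" "a \<in> S"
    and eq: "T a = T' a" "N a = N' a" "B a = B' a" and s: "s \<in> S"
  shows "T s = T' s" "N s = N' s" "B s = B' s"
proof -
  have "(norm (T s - T' s))\<^sup>2 + (norm (N s - N' s))\<^sup>2 + (norm (B s - B' s))\<^sup>2 = 0"
    using frenet_on_norm_const[OF frenet_on_diff[OF assms(1,2)] assms(3) s assms(4)] eq by simp
  then show "T s = T' s" "N s = N' s" "B s = B' s"
    by (simp_all add: add_nonneg_eq_0_iff)
qed

text \<open>The defects \<open>T - N \<times> B\<close>, \<open>N - B \<times> T\<close>, \<open>B - T \<times> N\<close> satisfy the Frenet equations themselves,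
  so they vanish identically when they vanish at one point.\<close>

lemma frenet_on_orthonormal:
  assumes fr: "frenet_on S \<tau> T N B" and S: "convex S" "a \<in> S" "s \<in> S"
    and a: "norm (T a) = 1" "norm (N a) = 1" "inner (T a) (N a) = 0" "B a = cross3 (T a) (N a)"
  shows "norm (T s) = 1" "norm (N s) = 1" "inner (T s) (N s) = 0" "B s = cross3 (T s) (N s)"
proof -
  have fr': "frenet_on S \<tau> (\<lambda>s. cross3 (N s) (B s)) (\<lambda>s. cross3 (B s) (T s)) (\<lambda>s. cross3 (T s) (N s))"
    unfolding frenet_on_def
  proof
    fix s assume s: "s \<in> S"
    note d = fr[unfolded frenet_on_def, rule_format, OF s]
    note dT = d[THEN conjunct1] and dN = d[THEN conjunct2, THEN conjunct1]
      and dB = d[THEN conjunct2, THEN conjunct2]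
    note cr = cross_add_right cross_add_left cross_mult_right cross_mult_left cross3_diff_left cross3_diff_right
    show "((\<lambda>s. cross3 (N s) (B s)) has_vector_derivative cross3 (B s) (T s)) (at s within S) \<and>
      ((\<lambda>s. cross3 (B s) (T s)) has_vector_derivative - cross3 (N s) (B s) + \<tau> s *\<^sub>R cross3 (T s) (N s)) (at s within S) \<and>
      ((\<lambda>s. cross3 (T s) (N s)) has_vector_derivative - \<tau> s *\<^sub>R cross3 (B s) (T s)) (at s within S)"
    proof (intro conjI)
      show "((\<lambda>s. cross3 (N s) (B s)) has_vector_derivative cross3 (B s) (T s)) (at s within S)"
        by (rule has_vector_derivative_eq_rhs[OF has_vector_derivative_cross3[OF dN dB]])
           (simp add: cr cross_skew[of "T s" "B s"])
      show "((\<lambda>s. cross3 (B s) (T s)) has_vector_derivative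
          - cross3 (N s) (B s) + \<tau> s *\<^sub>R cross3 (T s) (N s)) (at s within S)"
        by (rule has_vector_derivative_eq_rhs[OF has_vector_derivative_cross3[OF dB dT]])
           (simp add: cr cross_skew[of "B s" "N s"] cross_skew[of "N s" "T s"])
      show "((\<lambda>s. cross3 (T s) (N s)) has_vector_derivative - \<tau> s *\<^sub>R cross3 (B s) (T s)) (at s within S)"
        by (rule has_vector_derivative_eq_rhs[OF has_vector_derivative_cross3[OF dT dN]])
           (simp add: cr cross_skew[of "T s" "B s"])
    qed
  qed
  have "inner (T a) (N a) = 0 \<and> norm (B a) = 1 \<and> cross3 (T a) (B a) = - N a \<and> cross3 (N a) (B a) = T a"
    using orthonormal_frame_expansion[OF a(1,2,3)] a by simp
  then have Ta: "T a = cross3 (N a) (B a)" and Na: "N a = cross3 (B a) (T a)" and "norm (B a) = 1"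
    using cross_skew[of "B a" "T a"] by auto
  note eqs = frenet_on_unique[OF fr fr' S(1,2) Ta Na a(4) S(3)]
  show "B s = cross3 (T s) (N s)" by (rule eqs)
  have orth: "inner (T s) (N s) = 0" "inner (N s) (B s) = 0" "inner (T s) (B s) = 0"
    using dot_cross_self(1)[of "N s" "B s"] dot_cross_self(1)[of "B s" "T s"] dot_cross_self(1)[of "T s" "N s"]
      dot_cross_self(2)[of "N s" "T s"] eqs by (metis dot_cross_self inner_commute)+
  then show "inner (T s) (N s) = 0" by simp
  \<comment> \<open>Each vector is the cross product of the other two, orthogonal ones, hence x =
    yz, y = zx, z = xy. So x^2 = y^2 = z^2 = xyz, and the conserved sum 3 excludes the zero
    solution.\<close>
  define x y z where "x = (norm (T s))\<^sup>2" "y = (norm (N s))\<^sup>2" "z = (norm (B s))\<^sup>2"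
  have nn: "0 \<le> x" "0 \<le> y" "0 \<le> z" by (simp_all add: x_y_z_def)
  have "x = y * z" "y = z * x" "z = x * y"
    using norm_cross_dot[of "N s" "B s", folded eqs(1)] norm_cross_dot[of "B s" "T s", folded eqs(2)]
      norm_cross_dot[of "T s" "N s", folded eqs(3)] orth by (simp_all add: x_y_z_def power_mult_distrib inner_commute)
  moreover have sum: "x + y + z = 3"
    using frenet_on_norm_const[OF fr S(1,3,2)] a \<open>norm (B a) = 1\<close> by (simp add: x_y_z_def)
  ultimately have "x\<^sup>2 = y\<^sup>2" "y\<^sup>2 = z\<^sup>2"
    by (metis mult.assoc mult.commute power2_eq_square)+
  then have "x = y" "y = z" using nn power2_eq_imp_eq by blast+
  with sum have "(norm (T s))\<^sup>2 = 1\<^sup>2" "(norm (N s))\<^sup>2 = 1\<^sup>2" by (auto simp: x_y_z_def)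
  then show "norm (T s) = 1" "norm (N s) = 1"
    by (simp_all only: power2_eq_imp_eq[OF _ norm_ge_zero zero_le_one])
qed

text \<open>Bounded torsion makes the linear Frenet system globally Lipschitz, so the frame exists
  on the whole line; orthonormality propagates from 0, and \<delta> is a primitive of T.\<close>

lemma frenet_curve_exists:
  fixes T0 N0 p :: "real^3"
  assumes \<tau>: "continuous_on UNIV \<tau>" "\<And>s. \<bar>\<tau> s\<bar> \<le> K"
    and a: "norm T0 = 1" "norm N0 = 1" "inner T0 N0 = 0"
  obtains \<delta> T N B where "\<delta> 0 = p" "T 0 = T0" "N 0 = N0" "\<And>s. (\<delta> has_vector_derivative T s) (at s)"
    "frenet_on UNIV \<tau> T N B"
    "\<And>s. norm (T s) = 1" "\<And>s. norm (N s) = 1" "\<And>s. inner (T s) (N s) = 0"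
    "\<And>s. B s = cross3 (T s) (N s)"
proof -
  define f :: "real \<Rightarrow> (real^3) \<times> (real^3) \<times> (real^3) \<Rightarrow> (real^3) \<times> (real^3) \<times> (real^3)"
    where "f t x = (fst (snd x), - fst x + \<tau> t *\<^sub>R snd (snd x), - \<tau> t *\<^sub>R fst (snd x))" for t x
  have K: "0 \<le> K" using \<tau>(2)[of 0] by simp
  have nb: "norm (f t x) \<le> (2 + 2 * K) * norm x" for t x
  proof -
    have x: "norm (fst x) \<le> norm x" "norm (fst (snd x)) \<le> norm x" "norm (snd (snd x)) \<le> norm x"
      using norm_fst_le[of "fst x" "snd x"] norm_snd_le[of "snd x" "fst x"]
        norm_fst_le[of "fst (snd x)" "snd (snd x)"] norm_snd_le[of "snd (snd x)" "fst (snd x)"]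
      unfolding prod.collapse by linarith+
    have *: "norm (\<tau> t *\<^sub>R v) \<le> K * norm x" if "norm v \<le> norm x" for v :: "real^3"
      using \<tau>(2)[of t] that by (simp add: mult_mono K)
    have "norm (f t x) \<le> norm (fst (snd x)) + (norm (- fst x + \<tau> t *\<^sub>R snd (snd x)) + norm (- \<tau> t *\<^sub>R fst (snd x)))"
      unfolding f_def by (meson add_left_mono norm_Pair_le order_trans)
    also have "\<dots> \<le> norm x + ((norm x + K * norm x) + K * norm x)"
      using *[OF x(3)] *[OF x(2)] x norm_triangle_ineq[of "- fst x" "\<tau> t *\<^sub>R snd (snd x)"]
      by (intro add_mono) auto
    finally show ?thesis by (simp add: algebra_simps)
  qed
  have lin: "f t x - f t y = f t (x - y)" for t x y
    by (simp add: f_def algebra_simps)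
  have cont: "continuous_on UNIV (\<lambda>(t, x). f t x)"
    unfolding f_def case_prod_beta
    by (intro continuous_intros continuous_on_compose2[OF \<tau>(1)]) auto
  obtain y where y: "y 0 = (T0, N0, cross3 T0 N0)" "\<And>t. (y has_vector_derivative f t (y t)) (at t)"
  proof (rule lipschitz_ode_solution_exists[OF cont])
    show "norm (f t x - f t y) \<le> (2 + 2 * K) * norm (x - y)" for t x y
      unfolding lin by (rule nb)
    show "norm (f t 0) \<le> 0" for t using nb[of t 0] by simp
  qed (use K in auto)
  define T where "T s = fst (y s)" for s
  define N where "N s = fst (snd (y s))" for s
  define B where "B s = snd (snd (y s))" for s
  have fr: "frenet_on UNIV \<tau> T N B"
    unfolding frenet_on_def
  proof safe
    fix s
    show "(T has_vector_derivative N s) (at s)"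
      using bounded_linear.has_vector_derivative[OF bounded_linear_fst y(2)[of s]]
      by (simp add: T_def[abs_def] N_def f_def)
    note sn = bounded_linear.has_vector_derivative[OF bounded_linear_snd y(2)[of s]]
    show "(N has_vector_derivative - T s + \<tau> s *\<^sub>R B s) (at s)"
      using bounded_linear.has_vector_derivative[OF bounded_linear_fst sn]
      by (simp add: T_def N_def[abs_def] B_def f_def)
    show "(B has_vector_derivative - \<tau> s *\<^sub>R N s) (at s)"
      using bounded_linear.has_vector_derivative[OF bounded_linear_snd sn]
      by (simp add: B_def[abs_def] N_def f_def)
  qed
  have "continuous_on UNIV T"
    using fr unfolding frenet_on_def
    by (auto simp: continuous_on_eq_continuous_within intro: has_vector_derivative_continuous)
  from antiderivative_exists[OF this] obtain \<delta>
    where \<delta>: "\<delta> 0 = p" "\<And>s. (\<delta> has_vector_derivative T s) (at s)" by blast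
  have 0: "T 0 = T0" "N 0 = N0" "B 0 = cross3 T0 N0" by (simp_all add: T_def N_def B_def y)
  with frenet_on_orthonormal[OF fr, of 0] a that[of \<delta> T N B] \<delta> fr show thesis by simp
qed

text \<open>For the radial equation \<open>x'' = 1 - x + c\<^sup>2 / x\<^sup>3\<close> replace \<open>x\<^sup>3\<close> by \<open>(max x m)\<^sup>3\<close>, which
  makes the system globally Lipschitz. With \<open>c\<^sup>2 / m\<^sup>2\<close> equal to the energy, conservation of
  energy keeps the solution above \<open>m\<close>, where both systems agree.\<close>

lemma radial_solution_exists:
  fixes c x0 y0 :: real
  assumes c: "c \<noteq> 0" and x0: "0 < x0"
    and m: "0 < m" "c\<^sup>2 / m\<^sup>2 = y0\<^sup>2 + (1 - x0)\<^sup>2 + c\<^sup>2 / x0\<^sup>2"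
  obtains x y where "x 0 = x0" "y 0 = y0" "\<And>t. m \<le> x t"
    "\<And>t. (x has_real_derivative y t) (at t)"
    "\<And>t. (y has_real_derivative 1 - x t + c\<^sup>2 / x t ^ 3) (at t)"
    "\<And>u v l. u 0 = x0 \<and> v 0 = y0 \<and> (\<forall>t\<in>{0..l}.
        (u has_real_derivative v t) (at t within {0..l}) \<and>
        (v has_real_derivative 1 - u t + c\<^sup>2 / u t ^ 3) (at t within {0..l}) \<and> m \<le> u t) \<Longrightarrow>
      \<forall>t\<in>{0..l}. u t = x t"
proof -
  define g where "g x = c\<^sup>2 / (max x m) ^ 3" for x :: real
  have contg: "continuous_on A g" for A
    unfolding g_def using m(1) by (intro continuous_intros) (auto simp: max_def)
  have gpos: "0 < g x" for x using c m(1) by (auto simp: g_def max_def)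
  \<comment> \<open>The maximal slope of c^2/z^3 on z \<ge> m, hence a Lipschitz constant of the
    truncated force.\<close>
  define M where "M = 3 * c\<^sup>2 / m ^ 4"
  have M: "0 \<le> M" by (simp add: M_def)
  have g_lip: "\<bar>g x - g y\<bar> \<le> M * \<bar>x - y\<bar>" for x y
  proof -
    have "norm (c\<^sup>2 / (max x m) ^ 3 - c\<^sup>2 / (max y m) ^ 3) \<le> M * norm (max x m - max y m)"
    proof (rule field_differentiable_bound[where S = "{m..}" and f' = "\<lambda>z. - (3 * c\<^sup>2 / z ^ 4)"])
      show "((\<lambda>a. c\<^sup>2 / a ^ 3) has_field_derivative - (3 * c\<^sup>2 / z ^ 4)) (at z within {m..})"
        if "z \<in> {m..}" for z
        using that m(1) by (auto intro!: derivative_eq_intros simp: field_simps eval_nat_numeral)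
      show "norm (- (3 * c\<^sup>2 / z ^ 4)) \<le> M" if "z \<in> {m..}" for z
        using that m(1) by (auto simp: M_def intro!: divide_left_mono power_mono)
    qed auto
    also have "\<dots> \<le> M * \<bar>x - y\<bar>" using M by (intro mult_left_mono) (auto simp: max_def)
    finally show ?thesis by (simp add: g_def)
  qed
  define f :: "real \<Rightarrow> real \<times> real \<Rightarrow> real \<times> real"
    where "f t p = (snd p, 1 - fst p + g (fst p))" for t p
  define L where "L = 2 + M"
  have f_lip: "norm (f t p - f t q) \<le> L * norm (p - q)" for t p q
  proof -
    have n: "\<bar>fst p - fst q\<bar> \<le> norm (p - q)" "\<bar>snd p - snd q\<bar> \<le> norm (p - q)"
      using norm_fst_le[of "fst (p - q)" "snd (p - q)"] norm_snd_le[of "snd (p - q)" "fst (p - q)"]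
      unfolding prod.collapse by simp_all
    have "norm (f t p - f t q) \<le> \<bar>snd p - snd q\<bar> + \<bar>(1 - fst p + g (fst p)) - (1 - fst q + g (fst q))\<bar>"
      using norm_Pair_le[of "snd p - snd q" "(1 - fst p + g (fst p)) - (1 - fst q + g (fst q))"]
      by (simp add: f_def)
    also have "\<dots> \<le> \<bar>snd p - snd q\<bar> + (\<bar>fst p - fst q\<bar> + M * \<bar>fst p - fst q\<bar>)"
      using g_lip[of "fst p" "fst q"] by linarith
    also have "\<dots> \<le> norm (p - q) + (norm (p - q) + M * norm (p - q))"
      using n M by (intro add_mono mult_left_mono) auto
    finally show ?thesis by (simp add: L_def algebra_simps)
  qed
  have cont: "continuous_on UNIV (\<lambda>(t, p). f t p)"
    unfolding f_def case_prod_beta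
    by (intro continuous_intros continuous_on_compose2[OF contg[of UNIV]]) auto
  obtain z where z: "z 0 = (x0, y0)" "\<And>t. (z has_vector_derivative f t (z t)) (at t)"
  proof (rule lipschitz_ode_solution_exists[OF cont _ f_lip])
    show "norm (f t 0) \<le> norm (f 0 0)" for t by (simp add: f_def)
  qed (use M in \<open>auto simp: L_def\<close>)
  define x where "x t = fst (z t)" for t
  define y where "y t = snd (z t)" for t
  have dx: "(x has_real_derivative y t) (at t)" for t
    using bounded_linear.has_vector_derivative[OF bounded_linear_fst z(2)[of t]]
    by (simp add: x_def[abs_def] y_def f_def has_real_derivative_iff_has_vector_derivative)
  have dy: "(y has_real_derivative 1 - x t + g (x t)) (at t)" for t
    using bounded_linear.has_vector_derivative[OF bounded_linear_snd z(2)[of t]]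
    by (simp add: y_def[abs_def] x_def f_def has_real_derivative_iff_has_vector_derivative)
  \<comment> \<open>The potential of the truncated force, so that y^2 + (1 - x)^2 + W(x) is
    conserved. It equals c^2/x^2 above m. Below m it exceeds W(m), the total energy, so the solution
    cannot get there.\<close>
  obtain W where W: "\<And>x. (W has_real_derivative - 2 * g x) (at x)" "W m = c\<^sup>2 / m\<^sup>2"
  proof -
    have "continuous_on UNIV (\<lambda>x. - 2 * g x)" by (intro continuous_intros contg)
    from antiderivative_exists[OF this] obtain W where
      W: "\<And>x. (W has_vector_derivative - 2 * g x) (at x)" by metis
    show thesis
    proof (rule that[of "\<lambda>x. W x - W m + c\<^sup>2 / m\<^sup>2"])
      show "((\<lambda>x. W x - W m + c\<^sup>2 / m\<^sup>2) has_real_derivative - 2 * g x) (at x)" for x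
        unfolding has_real_derivative_iff_has_vector_derivative by (auto intro!: derivative_eq_intros W)
    qed simp
  qed
  have W_eq: "W a = c\<^sup>2 / a\<^sup>2" if "m \<le> a" for a
  proof -
    have "W a - c\<^sup>2 / a\<^sup>2 = W m - c\<^sup>2 / m\<^sup>2"
    proof (rule has_real_derivative_zero_const[of "{m..}" "\<lambda>a. W a - c\<^sup>2 / a\<^sup>2" a m])
      fix b assume b: "b \<in> {m..}"
      then have "((\<lambda>a. c\<^sup>2 / a\<^sup>2) has_real_derivative - 2 * g b) (at b within {m..})"
        using m(1) by (auto intro!: derivative_eq_intros simp: g_def max_def field_simps eval_nat_numeral)
      from DERIV_diff[OF has_field_derivative_at_within[OF W(1)] this]
      show "((\<lambda>a. W a - c\<^sup>2 / a\<^sup>2) has_real_derivative 0) (at b within {m..})" by simp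
    qed (use that in auto)
    then show ?thesis using W(2) by simp
  qed
  have W_gt: "c\<^sup>2 / m\<^sup>2 < W a" if "a < m" for a
  proof -
    have "\<exists>y. (W has_real_derivative y) (at b) \<and> y < 0" for b
      using W(1)[of b] gpos[of b] by (intro exI[of _ "- 2 * g b"]) simp
    with DERIV_neg_imp_decreasing[OF that, of W] W(2) show ?thesis by simp
  qed
  have mx0: "m \<le> x0"
  proof (rule ccontr)
    assume "\<not> m \<le> x0"
    then have "x0\<^sup>2 < m\<^sup>2" using x0 by (intro power_strict_mono) auto
    then have "c\<^sup>2 / m\<^sup>2 < c\<^sup>2 / x0\<^sup>2"
      using c x0 m(1) by (intro divide_strict_left_mono) auto
    then show False using m(2) zero_le_power2[of y0] zero_le_power2[of "1 - x0"] by linarith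
  qed
  have en: "(y t)\<^sup>2 + (1 - x t)\<^sup>2 + W (x t) = c\<^sup>2 / m\<^sup>2" for t
  proof -
    have "(y t)\<^sup>2 + (1 - x t)\<^sup>2 + W (x t) = (y 0)\<^sup>2 + (1 - x 0)\<^sup>2 + W (x 0)"
    proof (rule has_real_derivative_zero_const[of UNIV "\<lambda>t. (y t)\<^sup>2 + (1 - x t)\<^sup>2 + W (x t)" t 0])
      fix t
      show "((\<lambda>t. (y t)\<^sup>2 + (1 - x t)\<^sup>2 + W (x t)) has_real_derivative 0) (at t within UNIV)"
        by (auto intro!: derivative_eq_intros dx dy DERIV_chain2[OF W(1) dx] simp: algebra_simps)
    qed auto
    also have "\<dots> = c\<^sup>2 / m\<^sup>2" using W_eq[OF mx0] m(2) by (simp add: x_def y_def z)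
    finally show ?thesis .
  qed
  have xm: "m \<le> x t" for t
  proof (rule ccontr)
    assume "\<not> m \<le> x t"
    then have "c\<^sup>2 / m\<^sup>2 < W (x t)" using W_gt by simp
    then show False
      using en[of t] zero_le_power2[of "y t"] zero_le_power2[of "1 - x t"] by linarith
  qed
  have g: "g a = c\<^sup>2 / a ^ 3" if "m \<le> a" for a using that by (simp add: g_def max_absorb1)
  show thesis
  proof (rule that[of x y, OF _ _ xm dx])
    show "x 0 = x0" "y 0 = y0" by (simp_all add: x_def y_def z)
    show "(y has_real_derivative 1 - x t + c\<^sup>2 / x t ^ 3) (at t)" for t
      using dy[of t] g[OF xm] by simp
    fix u v :: "real \<Rightarrow> real" and l
    assume uv: "u 0 = x0 \<and> v 0 = y0 \<and> (\<forall>t\<in>{0..l}.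
        (u has_real_derivative v t) (at t within {0..l}) \<and>
        (v has_real_derivative 1 - u t + c\<^sup>2 / u t ^ 3) (at t within {0..l}) \<and> m \<le> u t)"
    then have du: "\<And>t. t \<in> {0..l} \<Longrightarrow> (u has_real_derivative v t) (at t within {0..l})"
      and dv: "\<And>t. t \<in> {0..l} \<Longrightarrow> (v has_real_derivative 1 - u t + c\<^sup>2 / u t ^ 3) (at t within {0..l})"
      and um: "\<And>t. t \<in> {0..l} \<Longrightarrow> m \<le> u t" by auto
    show "\<forall>t\<in>{0..l}. u t = x t"
    proof
      fix t assume t: "t \<in> {0..l}"
      have "(u t, v t) = z t"
      proof (rule lipschitz_ode_solution_unique[where f = f, OF _ _ f_lip _ t])
        show "((\<lambda>t. (u t, v t)) has_vector_derivative f t (u t, v t)) (at t within {0..l})"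
          if "t \<in> {0..l}" for t
          using has_vector_derivative_Pair[OF du[OF that, unfolded has_real_derivative_iff_has_vector_derivative]
              dv[OF that, unfolded has_real_derivative_iff_has_vector_derivative]] g[OF um[OF that]]
          by (simp add: f_def)
        show "(z has_vector_derivative f t (z t)) (at t within {0..l})" for t
          by (rule has_vector_derivative_at_within[OF z(2)])
      qed (simp add: uv z)
      then show "u t = x t" by (metis fst_conv x_def)
    qed
  qed
qed

lemma no_bounded_strict_decrease:
  fixes g :: "real \<Rightarrow> real"
  assumes "\<And>t. (g has_real_derivative g' t) (at t)" "\<And>t. g' t \<le> - e" "0 < e" "\<And>t. \<bar>g t\<bar> \<le> M"
  shows False
proof -
  \<comment> \<open>By this time g has dropped by at least 2M + 1, more than the bound M
    allows.\<close>
  define t where "t = (2 * M + 1) / e"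
  have M: "0 \<le> M" using assms(4)[of 0] by simp
  have "g t + e * t \<le> g 0 + e * 0"
  proof (rule DERIV_nonpos_imp_nonincreasing[of 0 t "\<lambda>t. g t + e * t"])
    show "0 \<le> t" using M assms(3) by (simp add: t_def)
    fix x
    have "((\<lambda>t. g t + e * t) has_real_derivative g' x + e) (at x)"
      by (auto intro!: derivative_eq_intros assms(1))
    then show "\<exists>y. ((\<lambda>t. g t + e * t) has_real_derivative y) (at x) \<and> y \<le> 0"
      using assms(2)[of x] by force
  qed
  moreover have "e * t = 2 * M + 1" using assms(3) by (simp add: t_def)
  ultimately show False using assms(4)[of t] assms(4)[of 0] by linarith
qed

section \<open>Balanced curves with nonzero c\<close>

context kink_balanced
begin

lemma \<phi>_pos: assumes "C a \<noteq> 0" "a \<in> D" "s \<in> D" shows "0 < \<phi> s"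
  using C_const[OF assms(2,3)] assms(1) \<phi>_nonneg[OF assms(3)]
  by (cases "\<phi> s = 0") (auto simp: C_def F_def)

lemma not_closed_if_twisted:
  assumes "D = UNIV" "bounded (range \<gamma>)" "C a \<noteq> 0"
  shows False
proof -
  have pos: "0 < \<phi> s" and s: "s \<in> D" for s using \<phi>_pos[OF assms(3)] assms(1) by auto
  have C: "C s = C a" for s using C_const s by blast
  obtain K where K: "\<And>s. norm (\<gamma> s) \<le> K" using assms(2) by (auto simp: bounded_iff)
  \<comment> \<open>The energy bounds |1 - \<phi>| by |V|. This upper bound for \<phi> keeps
    c^2/\<phi>^3 away from 0, so the decrease is uniform.\<close>
  define m where "m = 1 + norm V"
  have \<phi>_le: "\<phi> s \<le> m" for s
  proof -
    have "(1 - \<phi> s)\<^sup>2 \<le> (norm V)\<^sup>2" using energy(2)[OF s pos, of s] by simp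
    then have "\<bar>1 - \<phi> s\<bar> \<le> norm V" by (metis abs_le_square_iff abs_norm_cancel)
    then show ?thesis by (simp add: m_def)
  qed
  have m: "0 < m" by (simp add: m_def add_pos_nonneg)
  show False
  proof (rule no_bounded_strict_decrease)
    show "((\<lambda>s. inner V (\<gamma> s) - \<psi> s) has_real_derivative - (\<phi> s * (\<tau> s)\<^sup>2)) (at s)" for s
      using DERIV_diff[OF has_vector_derivative_inner_const[OF \<gamma>_deriv[OF s], of V] D\<psi>[OF s pos], of s]
        V_T[OF s] assms(1) by simp
    show "- (\<phi> s * (\<tau> s)\<^sup>2) \<le> - ((C a)\<^sup>2 / m ^ 3)" for s
    proof -
      have "\<phi> s * (\<tau> s)\<^sup>2 = (C a)\<^sup>2 / \<phi> s ^ 3"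
        using C_eq[OF s pos, of s] C[of s] pos[of s] by (simp add: field_simps eval_nat_numeral)
      moreover have "(C a)\<^sup>2 / m ^ 3 \<le> (C a)\<^sup>2 / \<phi> s ^ 3"
        using \<phi>_le[of s] pos[of s] m by (intro divide_left_mono power_mono) auto
      ultimately show ?thesis by simp
    qed
    show "0 < (C a)\<^sup>2 / m ^ 3" using assms(3) m by simp
    show "\<bar>inner V (\<gamma> s) - \<psi> s\<bar> \<le> norm V * K + norm V" for s
    proof -
      have "\<bar>inner V (\<gamma> s)\<bar> \<le> norm V * K"
        using Cauchy_Schwarz_ineq2[of V "\<gamma> s"] mult_left_mono[OF K[of s] norm_ge_zero[of V]] by linarith
      moreover have "\<bar>\<psi> s\<bar> \<le> norm V"
        using Cauchy_Schwarz_ineq2[of V "N s"] norm_N[OF s pos, of s] by (simp add: \<psi>_def)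
      ultimately show ?thesis by linarith
    qed
  qed
qed

lemma supercoiled_if_twisted:
  assumes D: "D = {0..l}" and l: "0 < l" and a: "a \<in> D" "C a \<noteq> 0"
  shows "\<exists>\<delta>. supercoiled_helix \<delta> \<and> (\<forall>s\<in>{0..l}. \<gamma> s = \<delta> s)"
proof -
  define c where "c = C a"
  have pos: "0 < \<phi> s" if "s \<in> D" for s using \<phi>_pos a that by blast
  have \<tau>: "\<tau> s = c / (\<phi> s)\<^sup>2" if "s \<in> D" for s
    using C_eq[OF that pos[OF that]] C_const[OF that a(1)] pos[OF that] by (simp add: c_def)
  have \<phi>\<tau>: "(\<phi> s * \<tau> s)\<^sup>2 = c\<^sup>2 / (\<phi> s)\<^sup>2" if "s \<in> D" for s
    using pos[OF that] by (simp add: \<tau>[OF that] field_simps eval_nat_numeral)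
  have c: "c \<noteq> 0" using a by (simp add: c_def)
  have 0: "0 \<in> D" using D l by simp
  have le: "c\<^sup>2 / (\<phi> s)\<^sup>2 \<le> (norm V)\<^sup>2" if "s \<in> D" for s
    using energy(2)[OF that pos[OF that]] \<phi>\<tau>[OF that] by simp
  have "0 < c\<^sup>2 / (\<phi> 0)\<^sup>2" using c pos[OF 0] by simp
  with le[OF 0] have V: "0 < norm V" by (cases "V = 0") auto
  \<comment> \<open>The energy gives c^2/\<phi>^2 \<le> |V|^2, that is \<phi> \<ge> |c|/|V|. With
    this threshold c^2/m^2 is exactly the energy |V|^2, as the radial existence lemma
    demands.\<close>
  define m where "m = \<bar>c\<bar> / norm V"
  have m: "0 < m" using V c by (simp add: m_def)
  have m2: "c\<^sup>2 / m\<^sup>2 = (norm V)\<^sup>2" using c V by (simp add: m_def power_divide)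
  have m\<phi>: "m \<le> \<phi> s" if "s \<in> D" for s
  proof -
    have "c\<^sup>2 \<le> (norm V * \<phi> s)\<^sup>2" using le[OF that] pos[OF that] by (simp add: divide_simps power_mult_distrib)
    then have "\<bar>c\<bar> \<le> norm V * \<phi> s" using pos[OF that] by (simp add: abs_le_square_iff[symmetric] abs_mult)
    then show ?thesis using V by (simp add: m_def divide_simps mult.commute)
  qed
  have "c\<^sup>2 / m\<^sup>2 = (\<psi> 0)\<^sup>2 + (1 - \<phi> 0)\<^sup>2 + c\<^sup>2 / (\<phi> 0)\<^sup>2"
    using energy(2)[OF 0 pos[OF 0]] m2 \<phi>\<tau>[OF 0] by simp
  then show ?thesis
  proof (rule radial_solution_exists[OF c pos[OF 0] m])
    fix x y
    assume x: "x 0 = \<phi> 0" "y 0 = \<psi> 0" "\<And>t. m \<le> x t"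
      "\<And>t. (x has_real_derivative y t) (at t)"
      "\<And>t. (y has_real_derivative 1 - x t + c\<^sup>2 / x t ^ 3) (at t)"
      and uniq: "\<And>u v l. u 0 = \<phi> 0 \<and> v 0 = \<psi> 0 \<and> (\<forall>t\<in>{0..l}.
          (u has_real_derivative v t) (at t within {0..l}) \<and>
          (v has_real_derivative 1 - u t + c\<^sup>2 / u t ^ 3) (at t within {0..l}) \<and> m \<le> u t) \<Longrightarrow>
        \<forall>t\<in>{0..l}. u t = x t"
    have \<phi>\<tau>': "\<phi> s * (\<tau> s)\<^sup>2 = c\<^sup>2 / \<phi> s ^ 3" if "s \<in> D" for s
      using pos[OF that] by (simp add: \<tau>[OF that] field_simps eval_nat_numeral)
    have "\<forall>s\<in>{0..l}. \<phi> s = x s"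
    proof (rule uniq[of \<phi> \<psi> l], intro conjI ballI)
      fix s assume "s \<in> {0..l}"
      then have s: "s \<in> D" by (simp add: D)
      show "(\<phi> has_real_derivative \<psi> s) (at s within {0..l})"
        using D\<phi>[OF s pos[OF s]] by (simp add: D)
      show "(\<psi> has_real_derivative 1 - \<phi> s + c\<^sup>2 / \<phi> s ^ 3) (at s within {0..l})"
        using D\<psi>[OF s pos[OF s]] unfolding \<phi>\<tau>'[OF s] by (simp add: D)
      show "m \<le> \<phi> s" by (rule m\<phi>[OF s])
    qed simp_all
    then have \<phi>x: "\<phi> s = x s" if "s \<in> D" for s using that D by simp
    define \<sigma> where "\<sigma> s = c / (x s)\<^sup>2" for s
    have xpos: "0 < x s" for s using x(3)[of s] m by linarith
    have "continuous_on UNIV x"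
      using x(4) by (meson DERIV_continuous continuous_at_imp_continuous_on)
    then have \<sigma>_cont: "continuous_on UNIV \<sigma>"
      unfolding \<sigma>_def using xpos by (intro continuous_intros) (auto simp: less_imp_neq[symmetric])
    have \<sigma>_le: "\<bar>\<sigma> s\<bar> \<le> \<bar>c\<bar> / m\<^sup>2" for s
      using x(3)[of s] m by (auto simp: \<sigma>_def abs_divide intro!: divide_left_mono power_mono)
    obtain \<delta> T' N' B' where \<delta>: "\<delta> 0 = \<gamma> 0" "T' 0 = T 0" "N' 0 = N 0"
      and d\<delta>: "\<And>s. (\<delta> has_vector_derivative T' s) (at s)"
      and fr: "frenet_on UNIV \<sigma> T' N' B'"
      and on: "\<And>s. norm (T' s) = 1" "\<And>s. norm (N' s) = 1" "\<And>s. inner (T' s) (N' s) = 0"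
      and B': "\<And>s. B' s = cross3 (T' s) (N' s)"
      using frenet_curve_exists[OF \<sigma>_cont \<sigma>_le norm_T[OF 0] norm_N[OF 0 pos[OF 0]] TN[OF 0 pos[OF 0]], of "\<gamma> 0"]
      by blast
    have "frenet_on D \<sigma> T N B"
      unfolding frenet_on_def
    proof safe
      fix s assume s: "s \<in> D"
      have "\<sigma> s = \<tau> s" using \<tau>[OF s] \<phi>x[OF s] by (simp add: \<sigma>_def)
      then show "(T has_vector_derivative N s) (at s within D)"
        "(N has_vector_derivative - T s + \<sigma> s *\<^sub>R B s) (at s within D)"
        "(B has_vector_derivative - \<sigma> s *\<^sub>R N s) (at s within D)"
        using T_deriv DN(1) Frenet_B Frenet_N s pos[OF s] by auto
    qed
    from frenet_on_unique(1)[OF this frenet_on_subset[OF fr subset_UNIV] convex_D 0]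
    have TT': "T s = T' s" if "s \<in> D" for s using that \<delta> B'[of 0] by (simp add: B_def)
    have eq: "\<gamma> s = \<delta> s" if "s \<in> D" for s
    proof -
      have "\<gamma> s - \<delta> s = \<gamma> 0 - \<delta> 0"
      proof (rule has_vector_derivative_zero_const[OF convex_D _ that 0])
        show "((\<lambda>s. \<gamma> s - \<delta> s) has_vector_derivative 0) (at s within D)" if "s \<in> D" for s
          using has_vector_derivative_diff[OF \<gamma>_deriv[OF that] has_vector_derivative_at_within[OF d\<delta>, of s D]]
            TT'[OF that] by simp
      qed
      then show ?thesis by (simp add: \<delta>)
    qed
    have frs: "(T' has_vector_derivative N' s) (at s)"
      "(N' has_vector_derivative - T' s + \<sigma> s *\<^sub>R B' s) (at s)" for s
      using fr by (auto simp: frenet_on_def)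
    have ut: "unit_tangent UNIV \<delta> = T'"
      using d\<delta> by (auto simp: unit_tangent_def vector_derivative_at)
    have cu: "curvature UNIV \<delta> = N'"
      using frs by (auto simp: curvature_def ut vector_derivative_at)
    have pn: "principal_normal UNIV \<delta> = N'"
      using on by (auto simp: principal_normal_def cu)
    have "norm (cross3 (T' s) (N' s)) = 1" for s
      using orthonormal_frame_expansion(2)[OF on] .
    then have to: "torsion UNIV \<delta> s = c / (x s)\<^sup>2" for s
      using frs(2)[of s] B'[of s]
      by (simp add: torsion_def pn binormal_def ut vector_derivative_at inner_diff_left dot_cross_self \<sigma>_def)
    have "supercoiled_helix \<delta>"
      unfolding supercoiled_helix_def arclength_param_def ut cu pn
      using c xpos x(4,5) on(1,2) to differentiableI_vector[OF d\<delta>]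
        differentiableI_vector[OF frs(1)] differentiableI_vector[OF frs(2)]
      by (intro exI[of _ c] exI[of _ x] exI[of _ y]) auto
    with eq D show ?thesis by auto
  qed
qed

end

section \<open>Zero torsion\<close>

lemma circle_of_tangent:
  fixes \<gamma> :: "real \<Rightarrow> real^3"
  assumes S: "convex S"
    and \<gamma>: "\<And>s. s \<in> S \<Longrightarrow> (\<gamma> has_vector_derivative cos (s - p) *\<^sub>R e + sin (s - p) *\<^sub>R n) (at s within S)"
  obtains m where "\<And>s. s \<in> S \<Longrightarrow> \<gamma> s = m + sin (s - p) *\<^sub>R e - cos (s - p) *\<^sub>R n"
proof -
  let ?g = "\<lambda>s. \<gamma> s - (sin (s - p) *\<^sub>R e - cos (s - p) *\<^sub>R n)"
  have "(?g has_vector_derivative 0) (at s within S)" if "s \<in> S" for s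
    by (auto intro!: derivative_eq_intros \<gamma> that)
  from has_vector_derivative_zero_constant[OF S this] obtain m where "\<And>s. s \<in> S \<Longrightarrow> ?g s = m"
    by blast
  with that[of m] show thesis by (simp add: algebra_simps)
qed

lemma unit_circle_arcI:
  assumes "norm e = 1" "norm n = 1" "inner e n = 0"
    and \<gamma>: "\<And>s. s \<in> S \<Longrightarrow> \<gamma> s = m + sin (s - p) *\<^sub>R e - cos (s - p) *\<^sub>R n"
  shows "unit_circle_arc S \<gamma>"
  unfolding unit_circle_arc_def
proof (intro exI conjI ballI)
  \<comment> \<open>The coefficients of cos s and sin s after expanding sin(s - p) and cos(s -
    p).\<close>
  let ?u = "- sin p *\<^sub>R e - cos p *\<^sub>R n" and ?v = "cos p *\<^sub>R e - sin p *\<^sub>R n"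
  have "sin p * sin p + cos p * cos p = 1" using sin_cos_squared_add3[of p] by linarith
  then have "inner ?u ?u = 1" "inner ?v ?v = 1"
    using assms(1-3) by (simp_all add: inner_diff_left inner_diff_right inner_commute[of n e] add.commute)
  then show "norm ?u = 1" "norm ?v = 1" by (simp_all add: norm_eq_sqrt_inner)
  show "inner ?u ?v = 0"
    using assms(1-3) by (simp add: inner_diff_left inner_diff_right inner_commute[of n e])
  show "\<gamma> s = m + cos s *\<^sub>R ?u + sin s *\<^sub>R ?v" if "s \<in> S" for s
    unfolding \<gamma>[OF that] sin_diff cos_diff by (simp add: algebra_simps)
qed

text \<open>Serves the trivial end pieces that \<open>segment_with_arcs\<close> allows. Any
  orthonormal pair will do, with the centre chosen to match.\<close>

lemma unit_circle_arc_point: "unit_circle_arc {p} \<gamma>"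
  using unit_circle_arcI[of "axis 1 1" "axis 2 1" "{p}" \<gamma> "\<gamma> p + axis 2 1" p]
  by (simp add: inner_axis_axis)

lemma compact_zeros:
  fixes f :: "real \<Rightarrow> real"
  assumes "continuous_on {a..b} f"
  shows "compact {x \<in> {a..b}. f x = 0}"
proof -
  have "closed {x \<in> {a..b}. f x = 0}"
    by (rule continuous_closed_preimage_constant[OF assms closed_atLeastAtMost])
  then have "compact ({a..b} \<inter> {x \<in> {a..b}. f x = 0})" by (rule compact_Int_closed[OF compact_Icc])
  also have "{a..b} \<inter> {x \<in> {a..b}. f x = 0} = {x \<in> {a..b}. f x = 0}" by blast
  finally show ?thesis .
qed

text \<open>The last zero before s and the first zero after s exist because the zero sets on [a, s]
  and [s, b] are compact and nonempty.\<close>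

lemma positive_component:
  fixes f :: "real \<Rightarrow> real"
  assumes f: "continuous_on {a..b} f" and z: "f a = 0" "f b = 0" and s: "s \<in> {a..b}" "0 < f s"
    and nn: "\<And>x. x \<in> {a..b} \<Longrightarrow> 0 \<le> f x"
  obtains p q where "a \<le> p" "p < s" "s < q" "q \<le> b" "f p = 0" "f q = 0"
    "\<And>x. p < x \<Longrightarrow> x < q \<Longrightarrow> 0 < f x"
proof -
  let ?L = "{x \<in> {a..s}. f x = 0}" and ?R = "{x \<in> {s..b}. f x = 0}"
  have "continuous_on {a..s} f" "continuous_on {s..b} f"
    using s(1) by (auto intro: continuous_on_subset[OF f])
  then have "compact ?L" "compact ?R" by (simp_all only: compact_zeros)
  moreover have "a \<in> ?L" "b \<in> ?R" using z s by auto
  ultimately obtain p q where p: "p \<in> ?L" "\<And>x. x \<in> ?L \<Longrightarrow> x \<le> p"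
    and q: "q \<in> ?R" "\<And>x. x \<in> ?R \<Longrightarrow> q \<le> x"
    by (metis (no_types, lifting) compact_attains_sup compact_attains_inf empty_iff)
  have "p \<noteq> s" "q \<noteq> s" using p(1) q(1) s by auto
  then have "p < s" "s < q" using p(1) q(1) by auto
  moreover have "0 < f x" if "p < x" "x < q" for x
  proof -
    have "f x \<noteq> 0" using p(2)[of x] q(2)[of x] that p(1) q(1) by force
    moreover have "x \<in> {a..b}" using that p(1) q(1) s by auto
    ultimately show ?thesis using nn[of x] by simp
  qed
  ultimately show thesis using that[of p q] p(1) q(1) by auto
qed

section \<open>Balanced curves with c = 0: circular arcs, and the case |V| = 1\<close>

locale untwisted = kink_balanced +
  assumes untwisted: "\<And>s. s \<in> D \<Longrightarrow> C s = 0"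
begin

lemma untwisted_frame:
  assumes "s \<in> D" "0 < \<phi> s"
  shows "\<tau> s = 0" "N' s = - T s" "V = (1 - \<phi> s) *\<^sub>R T s - \<psi> s *\<^sub>R N s"
proof -
  show "\<tau> s = 0" using untwisted[OF assms(1)] C_eq[OF assms] assms by simp
  with Frenet_N[OF assms] energy(1)[OF assms]
  show "N' s = - T s" "V = (1 - \<phi> s) *\<^sub>R T s - \<psi> s *\<^sub>R N s" by simp_all
qed

lemma closure_in_D: "I \<subseteq> D \<Longrightarrow> closure I \<subseteq> D"
  by (simp add: closed_D closure_minimal)

text \<open>Without torsion T' = N and N' = -T, so rotating the pair (T, N) back by the angle s - p
  gives constants \<open>X\<close>, \<open>Y\<close>. Continuity of T carries the formula to the
  closure, where \<phi> may vanish and N is not controlled. The formula for \<phi> is the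
  V-component of the one for T.\<close>

lemma arc_formula:
  assumes I: "convex I" "I \<noteq> {}" "I \<subseteq> D" and pos: "\<And>s. s \<in> I \<Longrightarrow> 0 < \<phi> s" and p: "p \<in> closure I"
  obtains n where "norm n = 1" "inner (T p) n = 0" "V = inner V (T p) *\<^sub>R T p + inner V n *\<^sub>R n"
    "\<And>s. s \<in> closure I \<Longrightarrow> T s = cos (s - p) *\<^sub>R T p + sin (s - p) *\<^sub>R n"
    "\<And>s. s \<in> closure I \<Longrightarrow> 1 - \<phi> s = cos (s - p) * (1 - \<phi> p) + sin (s - p) * inner V n"
proof -
  define X where "X s = cos (s - p) *\<^sub>R T s - sin (s - p) *\<^sub>R N s" for s
  define Y where "Y s = sin (s - p) *\<^sub>R T s + cos (s - p) *\<^sub>R N s" for s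
  obtain s0 where s0: "s0 \<in> I" using I by blast
  have dT: "(T has_vector_derivative N s) (at s within I)"
    and dN: "(N has_vector_derivative - T s) (at s within I)" if "s \<in> I" for s
    using T_deriv[of s] DN(1)[of s] untwisted_frame(2)[of s] I(3) pos[OF that] that
    by (auto intro: has_vector_derivative_within_subset)
  have XY: "X s = X s0" "Y s = Y s0" if "s \<in> I" for s
  proof -
    have "(X has_vector_derivative 0) (at s within I)" if "s \<in> I" for s
      unfolding X_def by (auto intro!: derivative_eq_intros dT dN that simp: algebra_simps)
    with has_vector_derivative_zero_const[OF I(1) _ that s0] show "X s = X s0" .
    have "(Y has_vector_derivative 0) (at s within I)" if "s \<in> I" for s
      unfolding Y_def by (auto intro!: derivative_eq_intros dT dN that simp: algebra_simps)
    with has_vector_derivative_zero_const[OF I(1) _ that s0] show "Y s = Y s0" .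
  qed
  have cs: "cos t *\<^sub>R (cos t *\<^sub>R v) + sin t *\<^sub>R (sin t *\<^sub>R v) = v" for t and v :: "real^3"
    unfolding scaleR_scaleR scaleR_add_left[symmetric] sin_cos_squared_add3 by simp
  have T_XY: "T s = cos (s - p) *\<^sub>R X s + sin (s - p) *\<^sub>R Y s" for s
    using cs[of "s - p" "T s"] by (simp add: X_def Y_def algebra_simps)
  have N_XY: "N s = cos (s - p) *\<^sub>R Y s - sin (s - p) *\<^sub>R X s" for s
    using cs[of "s - p" "N s"] by (simp add: X_def Y_def algebra_simps)
  define e where "e = X s0"
  define n where "n = Y s0"
  have s0D: "s0 \<in> D" "0 < \<phi> s0" using s0 I pos by auto
  note fr = norm_T[OF s0D(1)] norm_N[OF s0D] TN[OF s0D]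
  have sc: "sin t * sin t + cos t * cos t = 1" for t :: real
    using sin_cos_squared_add3[of t] by linarith
  have "inner e e = 1" "inner n n = 1"
    using fr by (simp_all add: sc e_def n_def X_def Y_def inner_diff_left inner_diff_right
        inner_add_left inner_add_right inner_commute[of "N s0" "T s0"])
  then have en: "norm e = 1" "norm n = 1" by (simp_all add: norm_eq_sqrt_inner)
  have e_n: "inner e n = 0"
    using fr by (simp add: e_def n_def X_def Y_def inner_diff_left inner_diff_right
        inner_add_left inner_add_right inner_commute[of "N s0" "T s0"])
  have "T s - (cos (s - p) *\<^sub>R e + sin (s - p) *\<^sub>R n) = 0" if "s \<in> closure I" for s
  proof (rule continuous_constant_on_closure[OF _ _ that])
    show "continuous_on (closure I) (\<lambda>s. T s - (cos (s - p) *\<^sub>R e + sin (s - p) *\<^sub>R n))"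
      using closure_in_D[OF I(3)] by (intro continuous_intros continuous_on_subset[OF cont_T])
    show "T s - (cos (s - p) *\<^sub>R e + sin (s - p) *\<^sub>R n) = 0" if "s \<in> I" for s
      using T_XY[of s] XY[OF that] by (simp add: e_def n_def)
  qed
  then have Ts: "T s = cos (s - p) *\<^sub>R e + sin (s - p) *\<^sub>R n" if "s \<in> closure I" for s
    using that by simp
  have e: "e = T p" using Ts[OF p] by simp
  \<comment> \<open>The binormal component of V is -\<phi> \<tau> = 0, so V lies in the plane of the
    arc.\<close>
  obtain \<alpha> \<beta> where ab: "V = \<alpha> *\<^sub>R e + \<beta> *\<^sub>R n"
  proof -
    have "V = (1 - \<phi> s0) *\<^sub>R (cos (s0 - p) *\<^sub>R e + sin (s0 - p) *\<^sub>R n)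
        - \<psi> s0 *\<^sub>R (cos (s0 - p) *\<^sub>R n - sin (s0 - p) *\<^sub>R e)"
      using untwisted_frame(3)[OF s0D] T_XY[of s0] N_XY[of s0] by (simp add: e_def n_def)
    also have "\<dots> = ((1 - \<phi> s0) * cos (s0 - p) + \<psi> s0 * sin (s0 - p)) *\<^sub>R e +
        ((1 - \<phi> s0) * sin (s0 - p) - \<psi> s0 * cos (s0 - p)) *\<^sub>R n"
      by (simp add: algebra_simps)
    finally show thesis by (rule that)
  qed
  then have "inner V e = \<alpha>" "inner V n = \<beta>"
    using en e_n by (simp_all add: inner_add_left inner_commute[of n e])
  with ab have V: "V = inner V e *\<^sub>R e + inner V n *\<^sub>R n" by simp
  show thesis
  proof (rule that[of n])
    show "1 - \<phi> s = cos (s - p) * (1 - \<phi> p) + sin (s - p) * inner V n" if "s \<in> closure I" for s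
    proof -
      have D: "s \<in> D" "p \<in> D" using closure_in_D[OF I(3)] that p by auto
      show ?thesis
        unfolding V_T[OF D(1), symmetric] V_T[OF D(2), symmetric] Ts[OF that] e[symmetric]
        by (simp add: inner_add_right)
    qed
  qed (use en e_n V Ts e in simp_all)
qed

lemma circle_on_closure:
  assumes I: "convex I" "I \<noteq> {}" "I \<subseteq> D" and pos: "\<And>s. s \<in> I \<Longrightarrow> 0 < \<phi> s"
  shows "unit_circle_arc (closure I) \<gamma>"
proof -
  obtain p where p: "p \<in> closure I" using I closure_subset by blast
  obtain n where n: "norm n = 1" "inner (T p) n = 0"
    and T: "\<And>s. s \<in> closure I \<Longrightarrow> T s = cos (s - p) *\<^sub>R T p + sin (s - p) *\<^sub>R n"
    using arc_formula[OF I pos p] by metis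
  have "(\<gamma> has_vector_derivative cos (s - p) *\<^sub>R T p + sin (s - p) *\<^sub>R n) (at s within closure I)"
    if "s \<in> closure I" for s
    using has_vector_derivative_within_subset[OF \<gamma>_deriv closure_in_D[OF I(3)]] closure_in_D[OF I(3)] that
    by (metis T subsetD)
  from circle_of_tangent[OF convex_closure[OF I(1)] this]
  obtain m where "\<And>s. s \<in> closure I \<Longrightarrow> \<gamma> s = m + sin (s - p) *\<^sub>R T p - cos (s - p) *\<^sub>R n" by blast
  then show ?thesis
    using norm_T closure_in_D[OF I(3)] p n by (intro unit_circle_arcI[of "T p" n]) auto
qed

lemma circle_on_Icc:
  assumes "{p..q} \<subseteq> D" "\<And>s. p < s \<Longrightarrow> s < q \<Longrightarrow> 0 < \<phi> s" "p \<le> q"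
  shows "unit_circle_arc {p..q} \<gamma>"
proof (cases "p = q")
  case False
  with assms circle_on_closure[of "{p<..<q}"] show ?thesis by (auto simp: subset_eq)
qed (use unit_circle_arc_point in auto)

text \<open>Source of the case distinction: <V, T> = 1 with T a unit vector forces |V| \<ge> 1, and
  F' = T - V vanishes at the zero exactly when |V| = 1.\<close>

lemma zero_facts:
  assumes "p \<in> D" "\<phi> p = 0"
  shows "inner V (T p) = 1" "1 \<le> norm V" "(norm (T p - V))\<^sup>2 = (norm V)\<^sup>2 - 1"
    "(F has_vector_derivative T p - V) (at p within D)" "F p = 0"
proof -
  show 1: "inner V (T p) = 1" using V_T[OF assms(1)] assms(2) by simp
  show "1 \<le> norm V" using norm_cauchy_schwarz[of V "T p"] 1 norm_T[OF assms(1)] by simp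
  show "(norm (T p - V))\<^sup>2 = (norm V)\<^sup>2 - 1"
    using 1 norm_T[OF assms(1)] by (simp add: power2_norm_eq_inner inner_diff_left inner_diff_right inner_commute)
  show "(F has_vector_derivative T p - V) (at p within D)" "F p = 0"
    using DF[OF assms(1)] assms(2) by (simp_all add: F_def)
qed

lemma zero_tangent:
  assumes "norm V = 1" "p \<in> D" "\<phi> p = 0"
  shows "T p = V"
  using zero_facts(3)[OF assms(2,3)] assms(1) by simp

lemma straight:
  assumes S: "convex S" "S \<subseteq> D" and T: "\<And>s. s \<in> S \<Longrightarrow> T s = V"
  obtains x where "\<And>s. s \<in> S \<Longrightarrow> \<gamma> s = x + s *\<^sub>R V"
proof -
  have "((\<lambda>s. \<gamma> s - s *\<^sub>R V) has_vector_derivative 0) (at s within S)" if "s \<in> S" for s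
    using has_vector_derivative_within_subset[OF \<gamma>_deriv S(2)] S(2) that T[OF that]
    by (auto intro!: derivative_eq_intros)
  from has_vector_derivative_zero_constant[OF S(1) this] obtain x
    where "\<And>s. s \<in> S \<Longrightarrow> \<gamma> s - s *\<^sub>R V = x" by blast
  with that[of x] show thesis by (simp add: algebra_simps)
qed

lemma identically_zero:
  assumes "\<And>s. s \<in> D \<Longrightarrow> \<phi> s = 0" "s \<in> D"
  shows "T s = V"
proof -
  have "(F has_vector_derivative 0) (at s within D)"
    by (rule has_vector_derivative_transform[OF assms(2) _ has_vector_derivative_const[of 0]])
       (simp add: F_def assms)
  with zero_facts(4)[OF assms(2)] assms have "T s - V = 0"
    using vector_derivative_unique_within[OF not_bot[OF assms(2)]] by blast
  then show ?thesis by simp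
qed

text \<open>At the left end T = V, so V has no component along n and \<phi> = 1 - cos(s - p) on the
  component. The next zero is therefore exactly one full turn later, where the unit circle closes
  up.\<close>

lemma critical_component:
  assumes V: "norm V = 1" and pq: "p < q" "{p..q} \<subseteq> D" and z: "\<phi> p = 0" "\<phi> q = 0"
    and pos: "\<And>s. p < s \<Longrightarrow> s < q \<Longrightarrow> 0 < \<phi> s"
  shows "q = p + 2 * pi" "\<gamma> q = \<gamma> p"
proof -
  have cl: "closure {p<..<q} = {p..q}" using pq by simp
  have p: "p \<in> D" using pq by auto
  have sub: "{p<..<q} \<subseteq> D" using pq(2) by (auto simp: subset_eq)
  have "convex {p<..<q}" "{p<..<q} \<noteq> {}" "\<And>s. s \<in> {p<..<q} \<Longrightarrow> 0 < \<phi> s" "p \<in> closure {p<..<q}"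
    using pq pos by (auto simp: cl)
  from arc_formula[OF this(1,2) sub this(3,4)] obtain n where
    n: "inner (T p) n = 0" and
    \<phi>: "\<And>s. s \<in> closure {p<..<q} \<Longrightarrow>
      1 - \<phi> s = cos (s - p) * (1 - \<phi> p) + sin (s - p) * inner V n"
    by metis
  have \<phi>: "\<phi> s = 1 - cos (s - p)" if "s \<in> {p..q}" for s
    using \<phi>[of s] that n zero_tangent[OF V p z(1)] z by (simp add: cl)
  show q: "q = p + 2 * pi"
  proof (rule ccontr)
    assume "q \<noteq> p + 2 * pi"
    then consider "q < p + 2 * pi" | "p + 2 * pi < q" by linarith
    then show False
    proof cases
      case 1
      have "cos (q - p) = 1" using \<phi>[of q] z pq by simp
      then obtain k :: int where "q - p = k * (2 * pi)" by (auto simp: cos_one_2pi_int)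
      then have "0 < k * (2 * pi)" "k * (2 * pi) < 1 * (2 * pi)" using 1 pq by linarith+
      then have "0 < real_of_int k" "real_of_int k < 1"
        by (simp_all add: zero_less_mult_iff)
      then show False by (simp only: of_int_0_less_iff of_int_less_1_iff)
    next
      case 2
      then have "0 < \<phi> (p + 2 * pi)" using pos[of "p + 2 * pi"] by simp
      moreover have "\<phi> (p + 2 * pi) = 0" using \<phi>[of "p + 2 * pi"] 2 by simp
      ultimately show False by simp
    qed
  qed
  have "unit_circle_arc {p..q} \<gamma>" using circle_on_Icc[OF pq(2) pos] pq by simp
  then obtain m u v where "\<And>s. s \<in> {p..q} \<Longrightarrow> \<gamma> s = m + cos s *\<^sub>R u + sin s *\<^sub>R v"
    unfolding unit_circle_arc_def by blast
  from this[of p] this[of q] show "\<gamma> q = \<gamma> p" using pq q by simp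
qed

text \<open>Take the first zero a and the last zero b. A positive component between them would have
  ends with the same image under \<gamma>, against injectivity; so \<phi> = 0 and T = V throughout
  [a, b], while \<phi> > 0 outside.\<close>

lemma critical_arc:
  assumes D: "D = {0..l}" and inj: "inj_on \<gamma> D" and V: "norm V = 1" and z: "z \<in> D" "\<phi> z = 0"
  shows "segment_with_arcs Arc l \<gamma>"
proof -
  let ?Z = "{x \<in> {0..l}. \<phi> x = 0}"
  have "compact ?Z" using compact_zeros cont_\<phi> D by blast
  moreover have "z \<in> ?Z" using z D by simp
  ultimately obtain a b where a: "a \<in> ?Z" "\<And>x. x \<in> ?Z \<Longrightarrow> a \<le> x"
    and b: "b \<in> ?Z" "\<And>x. x \<in> ?Z \<Longrightarrow> x \<le> b"
    by (metis (no_types, lifting) compact_attains_sup compact_attains_inf empty_iff)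
  have ab: "0 \<le> a" "a \<le> b" "b \<le> l" using a b by auto
  have zero: "\<phi> s = 0" if "s \<in> {a..b}" for s
  proof (rule ccontr)
    assume "\<phi> s \<noteq> 0"
    then have pos: "0 < \<phi> s" using \<phi>_nonneg[of s] that ab D by simp
    have c: "continuous_on {a..b} \<phi>" and nn: "\<And>x. x \<in> {a..b} \<Longrightarrow> 0 \<le> \<phi> x"
      using ab D \<phi>_nonneg by (auto intro: continuous_on_subset[OF cont_\<phi>])
    have "\<phi> a = 0" "\<phi> b = 0" using a(1) b(1) by auto
    from positive_component[OF c this that pos nn]
    obtain p q where pq: "a \<le> p" "p < s" "s < q" "q \<le> b" "\<phi> p = 0" "\<phi> q = 0"
      "\<And>x. p < x \<Longrightarrow> x < q \<Longrightarrow> 0 < \<phi> x"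
      by metis
    have "\<gamma> q = \<gamma> p"
      using pq ab D by (intro critical_component(2)[OF V]) auto
    then have "q = p" using inj pq ab D by (auto dest: inj_onD)
    then show False using pq by simp
  qed
  have pos: "0 < \<phi> s" if "s \<in> {0..l}" "s < a \<or> b < s" for s
    using a(2)[of s] b(2)[of s] \<phi>_nonneg[of s] that D by force
  obtain x where "\<And>s. s \<in> {a..b} \<Longrightarrow> \<gamma> s = x + s *\<^sub>R V"
    by (rule straight[of "{a..b}"]) (use ab D zero zero_tangent[OF V] in auto)
  moreover have "unit_circle_arc {0..a} \<gamma>" "unit_circle_arc {b..l} \<gamma>"
    using ab D pos by (auto intro!: circle_on_Icc)
  ultimately show ?thesis
    unfolding segment_with_arcs_def using ab V by blast
qed

text \<open>A closed curve is not straight, so some component of the support exists, of length 2 pi.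
  Its ends have the same image, hence 2 pi is a positive multiple of l. The translate p + l is again
  a zero, so it does not precede q = p + 2 pi; thus l = 2 pi and the component covers one
  period.\<close>

lemma critical_closed:
  assumes D: "D = UNIV" and l: "0 < l" and per: "\<And>s. \<gamma> (s + l) = \<gamma> s" "\<And>s. \<phi> (s + l) = \<phi> s"
    and inj: "inj_on \<gamma> {0..<l}" and V: "norm V = 1" and z: "\<phi> z = 0"
  shows "unit_circle_arc UNIV \<gamma>"
proof -
  have per': "\<gamma> (s + of_int k * l) = \<gamma> s" "\<phi> (s + of_int k * l) = \<phi> s" for s and k :: int
  proof (induction k arbitrary: s rule: int_induct[where k = 0])
    case (step1 i) 
    case 1 show ?case using per(1)[of "s + of_int i * l"] step1(2)[of s] by (simp add: algebra_simps)
    case 2 show ?case using per(2)[of "s + of_int i * l"] step1(3)[of s] by (simp add: algebra_simps)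
  next
    case (step2 i)
    case 1 show ?case using per(1)[of "s + of_int (i - 1) * l"] step2(2)[of s] by (simp add: algebra_simps)
    case 2 show ?case using per(2)[of "s + of_int (i - 1) * l"] step2(3)[of s] by (simp add: algebra_simps)
  qed auto
  obtain s where s: "0 < \<phi> s"
  proof (rule ccontr)
    assume "\<not> thesis"
    then have "\<phi> s = 0" for s using that[of s] \<phi>_nonneg[of s] D by force
    then have "T s = V" for s using identically_zero[of s] D by simp
    then obtain x where "\<And>s. \<gamma> s = x + s *\<^sub>R V" using straight[of UNIV] D by auto
    with per(1)[of 0] l V show False by auto
  qed
  \<comment> \<open>Two consecutive periodic copies of the zero z enclose s, so the component of s
    is bounded by zeros.\<close>
  define k where "k = \<lfloor>(s - z) / l\<rfloor>"
  have "of_int k \<le> (s - z) / l" "(s - z) / l \<le> of_int k + 1" unfolding k_def by linarith+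
  then have k: "z + of_int k * l \<le> s" "s \<le> z + of_int (k + 1) * l"
    using l by (simp_all add: field_simps)
  obtain p q where pq: "p < s" "s < q" "\<phi> p = 0" "\<phi> q = 0" "\<And>x. p < x \<Longrightarrow> x < q \<Longrightarrow> 0 < \<phi> x"
  proof -
    let ?a = "z + of_int k * l" and ?b = "z + of_int (k + 1) * l"
    have "continuous_on {?a..?b} \<phi>" using cont_\<phi> D by (auto intro: continuous_on_subset)
    moreover have "\<phi> ?a = 0" "\<phi> ?b = 0" using z per'(2)[of z k] per'(2)[of z "k + 1"] by simp_all
    moreover have "s \<in> {?a..?b}" using k by simp
    moreover have "\<And>x. x \<in> {?a..?b} \<Longrightarrow> 0 \<le> \<phi> x" using \<phi>_nonneg D by simp
    ultimately show thesis using positive_component[of ?a ?b \<phi> s] s that by metis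
  qed
  have q: "q = p + 2 * pi" "\<gamma> q = \<gamma> p"
    using critical_component[OF V _ _ pq(3,4,5)] pq(1,2) D by auto
  have "\<not> p + l < q" using pq(5)[of "p + l"] per(2)[of p] pq(3) l by auto
  moreover obtain j :: int where j: "q - p = of_int j * l"
  proof -
    define a where "a = \<lfloor>p / l\<rfloor>"
    define b where "b = \<lfloor>q / l\<rfloor>"
    have "of_int a \<le> p / l" "p / l < of_int a + 1" "of_int b \<le> q / l" "q / l < of_int b + 1"
      unfolding a_def b_def by linarith+
    then have "p - of_int a * l \<in> {0..<l}" "q - of_int b * l \<in> {0..<l}"
      using l by (simp_all add: field_simps)
    moreover have "\<gamma> (p - of_int a * l) = \<gamma> (q - of_int b * l)"
      using per'(1)[of p "- a"] per'(1)[of q "- b"] q(2) by simp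
    ultimately have "p - of_int a * l = q - of_int b * l" using inj by (auto dest: inj_onD)
    then show thesis using that[of "b - a"] by (simp add: algebra_simps)
  qed
  then have "0 < of_int j * l" using q(1) pi_gt_zero by linarith
  then have "1 \<le> j" using l by (simp add: zero_less_mult_iff)
  then have "l \<le> of_int j * l" using l by (simp add: mult_le_cancel_right1)
  ultimately have l2: "l = 2 * pi" using j q(1) by simp
  have "unit_circle_arc {p..q} \<gamma>"
    by (rule circle_on_Icc) (use D pq in auto)
  then obtain m u v where uv: "norm u = 1" "norm v = 1" "inner u v = 0"
    and \<gamma>: "\<And>s. s \<in> {p..q} \<Longrightarrow> \<gamma> s = m + cos s *\<^sub>R u + sin s *\<^sub>R v"
    unfolding unit_circle_arc_def by blast
  have "\<gamma> t = m + cos t *\<^sub>R u + sin t *\<^sub>R v" for t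
  proof -
    define i where "i = \<lfloor>(t - p) / l\<rfloor>"
    have "of_int i \<le> (t - p) / l" "(t - p) / l \<le> of_int i + 1" unfolding i_def by linarith+
    then have "t - of_int i * l \<in> {p..q}" using l q(1) l2 by (simp add: field_simps)
    from \<gamma>[OF this] show ?thesis
      using per'(1)[of t "- i"] sin.plus_of_int[of t "- i"] cos.plus_of_int[of t "- i"] unfolding l2 by simp
  qed
  with uv show ?thesis unfolding unit_circle_arc_def by blast
qed

end

section \<open>Waves\<close>

definition wave_angle :: "real \<Rightarrow> real" where
  "wave_angle \<beta> = 2 * pi - 2 * arctan \<beta>"

text \<open>With tan a = \<beta> the function 1 - cos x + \<beta> sin x equals 2 sin(x/2) sin(x/2 +
  a) / cos a, whose first positive zero is 2 pi - 2a. The two identities are the double angle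
  formulas at that point.\<close>

lemma wave_angle:
  assumes "0 < \<beta>"
  shows "pi < wave_angle \<beta>" "wave_angle \<beta> < 2 * pi"
    "cos (wave_angle \<beta>) - \<beta> * sin (wave_angle \<beta>) = 1"
    "sin (wave_angle \<beta>) + \<beta> * cos (wave_angle \<beta>) = - \<beta>"
    "\<And>x. 0 < x \<Longrightarrow> x < wave_angle \<beta> \<Longrightarrow> 0 < 1 - cos x + \<beta> * sin x"
proof -
  define a where "a = arctan \<beta>"
  have a: "0 < a" "a < pi / 2" using assms arctan_ubound by (simp_all add: a_def)
  have ca: "0 < cos a" using a by (intro cos_gt_zero) auto
  have "\<beta> = sin a / cos a" by (metis a_def tan_arctan tan_def)
  then have sb: "sin a = \<beta> * cos a" using ca by simp
  have w: "wave_angle \<beta> = 2 * pi - 2 * a" by (simp add: wave_angle_def a_def)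
  show "pi < wave_angle \<beta>" "wave_angle \<beta> < 2 * pi" using a by (simp_all add: w)
  have cw: "cos (wave_angle \<beta>) = cos (2 * a)" and sw: "sin (wave_angle \<beta>) = - sin (2 * a)"
    by (simp_all add: w cos_diff sin_diff)
  have 1: "(sin a)\<^sup>2 + (cos a)\<^sup>2 = 1" by simp
  show "cos (wave_angle \<beta>) - \<beta> * sin (wave_angle \<beta>) = 1"
    using 1 unfolding cw sw sin_double cos_double sb by algebra
  show "sin (wave_angle \<beta>) + \<beta> * cos (wave_angle \<beta>) = - \<beta>"
    using 1 unfolding cw sw sin_double cos_double sb by algebra
  fix x assume x: "0 < x" "x < wave_angle \<beta>"
  have s: "0 < sin (x / 2)" "0 < sin (x / 2 + a)" using x a by (auto intro!: sin_gt_zero simp: w)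
  have "cos x = cos (2 * (x / 2))" "sin x = sin (2 * (x / 2))" by simp_all
  then have cx: "cos x = (cos (x / 2))\<^sup>2 - (sin (x / 2))\<^sup>2" "sin x = 2 * sin (x / 2) * cos (x / 2)"
    by (simp_all only: cos_double sin_double)
  have 2: "(sin (x / 2))\<^sup>2 + (cos (x / 2))\<^sup>2 = 1" by simp
  have "cos a * (1 - cos x + \<beta> * sin x) = 2 * sin (x / 2) * sin (x / 2 + a)"
    using 2 unfolding cx sin_add sb by algebra
  then have "0 < cos a * (1 - cos x + \<beta> * sin x)" using s by simp
  then show "0 < 1 - cos x + \<beta> * sin x" using ca by (simp add: zero_less_mult_iff)
qed

text \<open>The zigzag of slope 1 and -1 between the heights 0 and \<theta>, with corners at the
  multiples of \<theta>. As a single continuous formula it spares any gluing of arcs.\<close>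

definition triangle_wave :: "real \<Rightarrow> real \<Rightarrow> real" where
  "triangle_wave \<theta> x = \<theta> / pi * arccos (cos (pi * x / \<theta>))"

lemma triangle_wave:
  assumes \<theta>: "0 < \<theta>" and x: "\<bar>x - of_int j * \<theta>\<bar> \<le> \<theta>"
  shows "triangle_wave \<theta> x = (if even j then \<bar>x - of_int j * \<theta>\<bar> else \<theta> - \<bar>x - of_int j * \<theta>\<bar>)"
proof -
  define y where "y = pi * (x - of_int j * \<theta>) / \<theta>"
  have y: "pi * x / \<theta> = y + of_int j * pi" using \<theta> by (simp add: y_def field_simps)
  have abs_y: "\<bar>y\<bar> = pi / \<theta> * \<bar>x - of_int j * \<theta>\<bar>"
    using \<theta> by (simp add: y_def abs_mult)
  moreover have "pi / \<theta> * \<bar>x - of_int j * \<theta>\<bar> \<le> pi / \<theta> * \<theta>"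
    using x \<theta> by (intro mult_left_mono) auto
  ultimately have "\<bar>y\<bar> \<le> pi" using \<theta> by simp
  then have ac: "arccos (cos y) = \<bar>y\<bar>" by (rule arccos_cos_eq_abs)
  show ?thesis
  proof (cases "even j")
    case True
    then obtain i where "j = 2 * i" by blast
    then have "cos (pi * x / \<theta>) = cos y"
      using cos.plus_of_int[of y i] by (simp add: y algebra_simps)
    then show ?thesis using True ac \<theta> by (simp add: triangle_wave_def abs_y)
  next
    case False
    then obtain i where "j = 2 * i + 1" using oddE by blast
    then have "cos (pi * x / \<theta>) = cos (y + pi)"
      using cos.plus_of_int[of "y + pi" i] by (simp add: y algebra_simps)
    then have "arccos (cos (pi * x / \<theta>)) = pi - \<bar>y\<bar>"
      using ac by (simp add: arccos_minus)
    then show ?thesis using False \<theta> by (simp add: triangle_wave_def abs_y field_simps)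
  qed
qed

lemma continuous_on_triangle_wave [continuous_intros]:
  fixes f :: "real \<Rightarrow> real"
  assumes "continuous_on S f"
  shows "continuous_on S (\<lambda>s. triangle_wave \<theta> (f s))"
proof -
  have "continuous_on S (\<lambda>s. cos (pi * f s / \<theta>))"
    unfolding divide_inverse by (intro continuous_on_cos continuous_on_mult continuous_on_const assms)
  then have "continuous_on S (\<lambda>s. arccos (cos (pi * f s / \<theta>)))"
    by (rule continuous_on_arccos) simp
  then show ?thesis unfolding triangle_wave_def by (intro continuous_on_mult continuous_on_const)
qed

text \<open>At junction j: the tangent, and the principal normal of the arc that follows. Passing to
  a neighbouring junction acts on this pair by a reflection, which is an involution, so only the
  parity of j matters.\<close>

definition wave_frame :: "real \<Rightarrow> 'a::real_vector \<Rightarrow> 'a \<Rightarrow> int \<Rightarrow> 'a \<times> 'a" where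
  "wave_frame \<theta> e1 e2 j = (if even j then (e1, e2)
     else (cos \<theta> *\<^sub>R e1 + sin \<theta> *\<^sub>R e2, sin \<theta> *\<^sub>R e1 - cos \<theta> *\<^sub>R e2))"

lemma wave_frame_orthonormal:
  fixes e1 e2 :: "'a::real_inner"
  assumes "norm e1 = 1" "norm e2 = 1" "inner e1 e2 = 0"
  shows "norm (fst (wave_frame \<theta> e1 e2 j)) = 1" "norm (snd (wave_frame \<theta> e1 e2 j)) = 1"
    "inner (fst (wave_frame \<theta> e1 e2 j)) (snd (wave_frame \<theta> e1 e2 j)) = 0"
proof -
  let ?f = "cos \<theta> *\<^sub>R e1 + sin \<theta> *\<^sub>R e2" and ?g = "sin \<theta> *\<^sub>R e1 - cos \<theta> *\<^sub>R e2"
  have sc: "cos \<theta> * cos \<theta> + sin \<theta> * sin \<theta> = 1" "sin \<theta> * sin \<theta> + cos \<theta> * cos \<theta> = 1"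
    using sin_cos_squared_add3[of \<theta>] by linarith+
  have "inner ?f ?f = 1" "inner ?g ?g = 1" "inner ?f ?g = 0"
    using assms sc by (simp_all add: inner_add_left inner_add_right inner_diff_left inner_diff_right
        inner_commute[of e2 e1])
  then have "norm ?f = 1" "norm ?g = 1" "inner ?f ?g = 0" by (simp_all add: norm_eq_sqrt_inner)
  then show "norm (fst (wave_frame \<theta> e1 e2 j)) = 1" "norm (snd (wave_frame \<theta> e1 e2 j)) = 1"
    "inner (fst (wave_frame \<theta> e1 e2 j)) (snd (wave_frame \<theta> e1 e2 j)) = 0"
    using assms by (simp_all add: wave_frame_def)
qed

text \<open>The tangent has angle \<omega> to e1, with \<omega> the triangle wave: slope of absolute
  value 1 means unit curvature, and the corners are the junctions. Seen from a junction, the tangent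
  depends only on the distance to it, in the same way on both sides.\<close>

lemma wave_exists:
  fixes e1 e2 x0 :: "real^3"
  assumes \<theta>: "pi < \<theta>" "\<theta> < 2 * pi" and e: "norm e1 = 1" "norm e2 = 1" "inner e1 e2 = 0"
  obtains \<delta> U where "wave \<delta>" "\<delta> p = x0" "\<And>s. (\<delta> has_vector_derivative U s) (at s)"
    "\<And>s j. \<bar>s - (p + of_int j * \<theta>)\<bar> \<le> \<theta> \<Longrightarrow>
      U s = cos \<bar>s - (p + of_int j * \<theta>)\<bar> *\<^sub>R fst (wave_frame \<theta> e1 e2 j)
          + sin \<bar>s - (p + of_int j * \<theta>)\<bar> *\<^sub>R snd (wave_frame \<theta> e1 e2 j)"
proof -
  have \<theta>0: "0 < \<theta>" using \<theta> pi_gt_zero by linarith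
  define \<omega> where "\<omega> s = triangle_wave \<theta> (s - p)" for s
  have \<omega>: "continuous_on UNIV \<omega>" unfolding \<omega>_def by (intro continuous_intros)
  obtain X where X: "\<And>s. (X has_vector_derivative cos (\<omega> s)) (at s)"
    using antiderivative_exists[of "\<lambda>s. cos (\<omega> s)"] continuous_on_cos[OF \<omega>] by metis
  obtain Y where Y: "\<And>s. (Y has_vector_derivative sin (\<omega> s)) (at s)"
    using antiderivative_exists[of "\<lambda>s. sin (\<omega> s)"] continuous_on_sin[OF \<omega>] by metis
  define \<delta> where "\<delta> s = x0 + ((X s - X p) *\<^sub>R e1 + (Y s - Y p) *\<^sub>R e2)" for s
  define U where "U s = cos (\<omega> s) *\<^sub>R e1 + sin (\<omega> s) *\<^sub>R e2" for s
  have d\<delta>: "(\<delta> has_vector_derivative U s) (at s)" for s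
    unfolding \<delta>_def U_def using X[of s] Y[of s]
    by (auto intro!: derivative_eq_intros simp: has_real_derivative_iff_has_vector_derivative)
  define f1 where "f1 j = fst (wave_frame \<theta> e1 e2 j)" for j
  define f2 where "f2 j = snd (wave_frame \<theta> e1 e2 j)" for j
  note f = wave_frame_orthonormal[OF e, of \<theta>, folded f1_def f2_def]
  have U: "U s = cos \<bar>s - (p + of_int j * \<theta>)\<bar> *\<^sub>R f1 j + sin \<bar>s - (p + of_int j * \<theta>)\<bar> *\<^sub>R f2 j"
    if "\<bar>s - (p + of_int j * \<theta>)\<bar> \<le> \<theta>" for s j
  proof -
    define x where "x = \<bar>s - (p + of_int j * \<theta>)\<bar>"
    have "\<omega> s = (if even j then x else \<theta> - x)"
      using triangle_wave[OF \<theta>0, of "s - p" j] that by (simp add: \<omega>_def x_def algebra_simps)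
    then have "U s = cos x *\<^sub>R f1 j + sin x *\<^sub>R f2 j"
      by (simp add: U_def f1_def f2_def wave_frame_def cos_diff sin_diff algebra_simps)
    then show ?thesis by (simp only: x_def)
  qed
  have normU: "norm (U s) = 1" for s
  proof -
    define j where "j = \<lfloor>(s - p) / \<theta>\<rfloor>"
    have "of_int j \<le> (s - p) / \<theta>" "(s - p) / \<theta> \<le> of_int j + 1" unfolding j_def by linarith+
    then have "\<bar>s - (p + of_int j * \<theta>)\<bar> \<le> \<theta>" using \<theta>0 by (simp add: field_simps)
    from U[OF this] obtain x where Us: "U s = cos x *\<^sub>R f1 j + sin x *\<^sub>R f2 j" by blast
    have "inner (U s) (U s) = cos x * cos x + sin x * sin x"
      unfolding Us using f[of j]
      by (simp add: inner_add_left inner_add_right inner_commute[of "f2 j" "f1 j"])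
    then have "inner (U s) (U s) = 1" by (simp only: sin_cos_squared_add3)
    then show ?thesis by (simp add: norm_eq_sqrt_inner)
  qed
  have utU: "unit_tangent UNIV \<delta> = U"
    using d\<delta> by (auto simp: unit_tangent_def vector_derivative_at)
  have arcs: "\<forall>k::int. let q = p + of_int k * \<theta> in unit_circle_arc {q..q + \<theta>} \<delta> \<and>
      principal_normal {q - \<theta>..q} \<delta> q = - principal_normal {q..q + \<theta>} \<delta> q"
  proof
    fix k :: int
    define q where "q = p + of_int k * \<theta>"
    have Uq: "U s = cos \<bar>s - q\<bar> *\<^sub>R f1 k + sin \<bar>s - q\<bar> *\<^sub>R f2 k" if "\<bar>s - q\<bar> \<le> \<theta>" for s
      using U[of s k] that by (simp add: q_def)
    have "unit_circle_arc {q..q + \<theta>} \<delta>"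
    proof -
      have "(\<delta> has_vector_derivative cos (s - q) *\<^sub>R f1 k + sin (s - q) *\<^sub>R f2 k) (at s within {q..q + \<theta>})"
        if "s \<in> {q..q + \<theta>}" for s
        using has_vector_derivative_at_within[OF d\<delta>, of s "{q..q + \<theta>}"] Uq[of s] that by simp
      from circle_of_tangent[OF _ this] obtain m where
        "\<And>s. s \<in> {q..q + \<theta>} \<Longrightarrow> \<delta> s = m + sin (s - q) *\<^sub>R f1 k - cos (s - q) *\<^sub>R f2 k"
        by (metis convex_real_interval(5))
      then show ?thesis using f by (intro unit_circle_arcI) auto
    qed
    \<comment> \<open>Both one-sided normals at once: \<sigma> is 1 to the right of q and -1 to its
      left, and |s - q| = \<sigma> (s - q) produces the flip.\<close>
    moreover have normal: "principal_normal {a..b} \<delta> q = \<sigma> *\<^sub>R f2 k"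
      if ab: "a < b" "q \<in> {a..b}" and \<sigma>: "\<sigma> = 1 \<or> \<sigma> = -1"
        and near: "\<And>s. s \<in> {a..b} \<Longrightarrow> \<bar>s - q\<bar> \<le> \<theta> \<and> \<bar>s - q\<bar> = \<sigma> * (s - q)" for a b \<sigma>
    proof -
      have ut: "unit_tangent {a..b} \<delta> s = U s" if "s \<in> {a..b}" for s
        unfolding unit_tangent_def
        using vector_derivative_within_cbox[of a b s \<delta> "U s"] ab that
          has_vector_derivative_at_within[OF d\<delta>, of s "{a..b}"] by simp
      have "((\<lambda>s. cos (\<sigma> * (s - q)) *\<^sub>R f1 k + sin (\<sigma> * (s - q)) *\<^sub>R f2 k) has_vector_derivative \<sigma> *\<^sub>R f2 k)
          (at q within {a..b})"
        by (auto intro!: derivative_eq_intros)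
      then have "(unit_tangent {a..b} \<delta> has_vector_derivative \<sigma> *\<^sub>R f2 k) (at q within {a..b})"
      proof (rule has_vector_derivative_transform[OF ab(2), rotated])
        fix s assume s: "s \<in> {a..b}"
        note n = near[OF s]
        show "unit_tangent {a..b} \<delta> s = cos (\<sigma> * (s - q)) *\<^sub>R f1 k + sin (\<sigma> * (s - q)) *\<^sub>R f2 k"
          using Uq[OF n[THEN conjunct1]] unfolding ut[OF s] n[THEN conjunct2] .
      qed
      then have "curvature {a..b} \<delta> q = \<sigma> *\<^sub>R f2 k"
        unfolding curvature_def
        using vector_derivative_within_cbox[of a b q "unit_tangent {a..b} \<delta>"] ab by simp
      then show ?thesis using f(2)[of k] \<sigma> by (auto simp: principal_normal_def)
    qed
    have "principal_normal {q - \<theta>..q} \<delta> q = - principal_normal {q..q + \<theta>} \<delta> q"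
      using normal[of "q - \<theta>" q "-1"] normal[of q "q + \<theta>" 1] \<theta>0 by simp
    ultimately show "let q = p + of_int k * \<theta> in unit_circle_arc {q..q + \<theta>} \<delta> \<and>
        principal_normal {q - \<theta>..q} \<delta> q = - principal_normal {q..q + \<theta>} \<delta> q"
      unfolding q_def Let_def by blast
  qed
  have "wave \<delta>"
    unfolding wave_def
  proof (rule exI[of _ \<theta>], rule exI[of _ p], intro conjI)
    show "\<exists>P. affine P \<and> aff_dim P = 2 \<and> range \<delta> \<subseteq> P"
    proof (intro exI[of _ "(+) x0 ` span {e1, e2}"] conjI)
      show "affine ((+) x0 ` span {e1, e2})"
        by (simp add: affine_translation[symmetric] subspace_imp_affine)
      have "e1 \<noteq> e2" "0 \<notin> {e1, e2}" using e by auto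
      moreover have "pairwise orthogonal {e1, e2}"
        using e(3) by (auto simp: pairwise_def orthogonal_def inner_commute)
      ultimately have "independent {e1, e2}" by (intro pairwise_orthogonal_independent)
      then have "dim {e1, e2} = 2"
        using \<open>e1 \<noteq> e2\<close> by (subst dim_eq_card_independent) auto
      then show "aff_dim ((+) x0 ` span {e1, e2}) = 2"
        by (simp add: aff_dim_translation_eq aff_dim_subspace)
      have "a *\<^sub>R e1 + b *\<^sub>R e2 \<in> span {e1, e2}" for a b
        by (intro span_add span_scale span_base) auto
      then show "range \<delta> \<subseteq> (+) x0 ` span {e1, e2}" by (auto simp: \<delta>_def)
    qed
    show "arclength_param UNIV \<delta>"
      unfolding arclength_param_def utU using normU differentiableI_vector[OF d\<delta>] by simp
    show "continuous_on UNIV (unit_tangent UNIV \<delta>)"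
      unfolding utU U_def by (intro continuous_intros \<omega>)
    show "\<forall>k::int. let q = p + of_int k * \<theta> in unit_circle_arc {q..q + \<theta>} \<delta> \<and>
        principal_normal {q - \<theta>..q} \<delta> q = - principal_normal {q..q + \<theta>} \<delta> q"
      by (rule arcs)
  qed (use \<theta> in auto)
  then show thesis
    using that[of \<delta> U] d\<delta> U by (simp add: \<delta>_def f1_def f2_def)
qed

section \<open>Balanced curves with c = 0 and |V| > 1\<close>

locale supercritical = untwisted +
  assumes V_gt_1: "1 < norm V"
begin

text \<open>The length of F' = T - V at every zero of \<phi>.\<close>

definition \<beta> where "\<beta> = sqrt ((norm V)\<^sup>2 - 1)"
definition \<theta> where "\<theta> = wave_angle \<beta>"
text \<open>The direction in which F crosses 0 at a zero p; it stands in for the normal there, being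
  its limit from the right and minus its limit from the left.\<close>

definition M where "M p = (T p - V) /\<^sub>R \<beta>"

lemma \<beta>: "0 < \<beta>" "\<beta>\<^sup>2 = (norm V)\<^sup>2 - 1"
proof -
  have "1 < (norm V)\<^sup>2" using V_gt_1 by (simp add: one_less_power)
  then show "0 < \<beta>" "\<beta>\<^sup>2 = (norm V)\<^sup>2 - 1" by (simp_all add: \<beta>_def)
qed

lemmas \<theta> = wave_angle[OF \<beta>(1), folded \<theta>_def]

lemma \<theta>_pos: "0 < \<theta>" using \<theta>(1) pi_gt_zero by linarith

lemma M:
  assumes "p \<in> D" "\<phi> p = 0"
  shows "norm (M p) = 1" "inner (T p) (M p) = 0" "V = T p - \<beta> *\<^sub>R M p"
proof -
  have "(norm (T p - V))\<^sup>2 = \<beta>\<^sup>2" using zero_facts(3)[OF assms] \<beta> by simp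
  then have "norm (T p - V) = \<beta>" using \<beta>(1) by (simp add: power2_eq_iff_nonneg)
  then show "norm (M p) = 1" using \<beta>(1) by (simp add: M_def)
  show "inner (T p) (M p) = 0"
    using zero_facts(1)[OF assms] norm_T[OF assms(1)] by (simp add: M_def inner_diff_right inner_commute)
  show "V = T p - \<beta> *\<^sub>R M p" using \<beta>(1) by (simp add: M_def)
qed

text \<open>The arc formula leaves one sign open: the length of V determines <V, n> up to sign, and
  \<phi> \<ge> 0 next to p decides. Since r may lie on either side of p, both directions yield the
  same formula in |s - p| with the same \<open>M p\<close>, which is the flip of the normal.\<close>

lemma arc_from_zero_aux:
  assumes p: "p \<in> D" "\<phi> p = 0" and r: "r \<in> D" "r \<noteq> p"
    and pos: "\<And>s. s \<in> open_segment p r \<Longrightarrow> 0 < \<phi> s" and s: "s \<in> closed_segment p r"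
  shows "T s = cos \<bar>s - p\<bar> *\<^sub>R T p + sin \<bar>s - p\<bar> *\<^sub>R M p"
    and "\<phi> s = 1 - cos \<bar>s - p\<bar> + \<beta> * sin \<bar>s - p\<bar>"
proof -
  let ?I = "open_segment p r"
  have cl: "closure ?I = closed_segment p r" using r(2) by simp
  have sub: "closed_segment p r \<subseteq> D" using closed_segment_subset[OF p(1) r(1) convex_D] .
  then have "?I \<subseteq> D" using open_closed_segment by blast
  moreover have "convex ?I" "?I \<noteq> {}" "p \<in> closure ?I" using r(2) unfolding cl by auto
  ultimately obtain n where n: "norm n = 1" "inner (T p) n = 0"
    and V: "V = inner V (T p) *\<^sub>R T p + inner V n *\<^sub>R n"
    and T: "\<And>s. s \<in> closure ?I \<Longrightarrow> T s = cos (s - p) *\<^sub>R T p + sin (s - p) *\<^sub>R n"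
    and \<phi>: "\<And>s. s \<in> closure ?I \<Longrightarrow> 1 - \<phi> s = cos (s - p) * (1 - \<phi> p) + sin (s - p) * inner V n"
    using arc_formula[of ?I p] pos by metis
  note T = T[unfolded cl] and \<phi> = \<phi>[unfolded cl]
  define b where "b = inner V n"
  have V': "V = T p + b *\<^sub>R n" using V zero_facts(1)[OF p] by (simp add: b_def)
  define \<sigma> :: real where "\<sigma> = (if p < r then 1 else - 1)"
  have \<sigma>: "\<sigma> * \<sigma> = 1" by (simp add: \<sigma>_def)
  have sgn: "s - p = \<sigma> * \<bar>s - p\<bar>" if "s \<in> closed_segment p r" for s
    using that r(2) by (auto simp: \<sigma>_def closed_segment_eq_real_ivl split: if_splits)
  have trig: "cos (s - p) = cos \<bar>s - p\<bar>" "sin (s - p) = \<sigma> * sin \<bar>s - p\<bar>"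
    if "s \<in> closed_segment p r" for s
  proof -
    have "cos (\<sigma> * y) = cos y" "sin (\<sigma> * y) = \<sigma> * sin y" for y
      by (simp_all add: \<sigma>_def)
    from this[of "\<bar>s - p\<bar>"] show "cos (s - p) = cos \<bar>s - p\<bar>" "sin (s - p) = \<sigma> * sin \<bar>s - p\<bar>"
      unfolding sgn[OF that, symmetric] .
  qed
  have \<phi>': "\<phi> s = 1 - cos \<bar>s - p\<bar> - sin \<bar>s - p\<bar> * (\<sigma> * b)" if "s \<in> closed_segment p r" for s
    using \<phi>[OF that] p(2) unfolding trig[OF that] by (simp add: b_def algebra_simps)
  have "\<beta>\<^sup>2 = b\<^sup>2"
  proof -
    have "inner V V = inner V (T p + b *\<^sub>R n)" using V' by simp
    also have "\<dots> = 1 + b\<^sup>2"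
      unfolding inner_add_right using zero_facts(1)[OF p] by (simp add: b_def power2_eq_square)
    finally show ?thesis using \<beta>(2) by (simp add: power2_norm_eq_inner)
  qed
  then have "\<sigma> * b = \<beta> \<or> \<sigma> * b = - \<beta>"
    by (auto simp: \<sigma>_def power2_eq_iff)
  moreover have "\<sigma> * b \<noteq> \<beta>"
  proof
    assume b: "\<sigma> * b = \<beta>"
    \<comment> \<open>The value of \<phi> at distance x under the wrong sign: it vanishes at 0 with
      slope -\<beta>, so \<phi> would become negative.\<close>
    define h where "h x = 1 - cos x - sin x * \<beta>" for x
    have "(h has_real_derivative - \<beta>) (at 0)"
      unfolding h_def by (auto intro!: derivative_eq_intros)
    from DERIV_neg_dec_right[OF this] \<beta>(1) obtain d where d: "0 < d" "\<And>x. 0 < x \<Longrightarrow> x < d \<Longrightarrow> h x < h 0"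
      by auto
    define x where "x = min (d / 2) \<bar>r - p\<bar>"
    have x: "0 < x" "x < d" "x \<le> \<bar>r - p\<bar>" using d r(2) by (auto simp: x_def)
    then have seg: "p + \<sigma> * x \<in> closed_segment p r"
      by (auto simp: \<sigma>_def closed_segment_eq_real_ivl)
    have "\<bar>p + \<sigma> * x - p\<bar> = x" using x by (simp add: \<sigma>_def)
    then have "\<phi> (p + \<sigma> * x) = h x" using \<phi>'[OF seg] b by (simp add: h_def)
    then show False using d(2)[OF x(1,2)] \<phi>_nonneg[of "p + \<sigma> * x"] sub seg by (auto simp: h_def)
  qed
  ultimately have b: "\<sigma> * b = - \<beta>" by simp
  then show "\<phi> s = 1 - cos \<bar>s - p\<bar> + \<beta> * sin \<bar>s - p\<bar>" using \<phi>'[OF s] by simp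
  have "b = - \<sigma> * \<beta>" using arg_cong[OF b, of "\<lambda>x. \<sigma> * x"] \<sigma> by (simp add: mult.assoc[symmetric])
  moreover have "T p - V = - (b *\<^sub>R n)" using arg_cong[OF V', of "\<lambda>v. T p - v"] by simp
  ultimately have "T p - V = \<beta> *\<^sub>R (\<sigma> *\<^sub>R n)" by (simp add: mult.commute)
  then have "M p = \<sigma> *\<^sub>R n" using \<beta>(1) by (simp add: M_def)
  then show "T s = cos \<bar>s - p\<bar> *\<^sub>R T p + sin \<bar>s - p\<bar> *\<^sub>R M p"
    using T[OF s] unfolding trig[OF s] by (simp add: mult.commute)
qed

text \<open>F' is nonzero at p, so p is an isolated zero. If there were another zero closer than
  \<theta>, the nearest one towards r would end a positive arc from p, where \<phi> = 1 - cos x +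
  \<beta> sin x is still positive.\<close>

lemma positive_near_zero:
  assumes p: "p \<in> D" "\<phi> p = 0" and r: "r \<in> D" "r \<noteq> p" "\<bar>r - p\<bar> < \<theta>"
  shows "0 < \<phi> r"
proof (rule ccontr)
  assume "\<not> 0 < \<phi> r"
  then have r0: "\<phi> r = 0" using \<phi>_nonneg[OF r(1)] by simp
  have "T p - V \<noteq> 0" using M(1)[OF p] by (auto simp: M_def)
  with has_vector_derivative_nonzero_eventually[OF zero_facts(4,5)[OF p]]
  have "eventually (\<lambda>y. F y \<noteq> 0) (at p within D)" by blast
  then obtain d where d: "0 < d" "\<And>s. s \<in> D \<Longrightarrow> s \<noteq> p \<Longrightarrow> \<bar>s - p\<bar> < d \<Longrightarrow> F s \<noteq> 0"
    by (auto simp: eventually_at dist_real_def)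
  have near: "0 < \<phi> s" if "s \<in> D" "s \<noteq> p" "\<bar>s - p\<bar> < d" for s
    using d(2)[OF that] \<phi>_nonneg[OF that(1)] by (force simp: F_def)
  define \<sigma> :: real where "\<sigma> = (if p < r then 1 else - 1)"
  define L where "L = \<bar>r - p\<bar>"
  have L: "0 < L" "L < \<theta>" "p + \<sigma> * L = r" using r by (auto simp: L_def \<sigma>_def)
  have seg: "p + \<sigma> * x \<in> closed_segment p r" if "0 \<le> x" "x \<le> L" for x
    using that L r by (auto simp: \<sigma>_def L_def closed_segment_eq_real_ivl)
  have inD: "p + \<sigma> * x \<in> D" if "0 \<le> x" "x \<le> L" for x
    using seg[OF that] closed_segment_subset[OF p(1) r(1) convex_D] by blast
  \<comment> \<open>Starting the search at distance c < d removes p itself, so the remaining zeros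
    form a compact set with a nearest element.\<close>
  define c where "c = min (d / 2) L"
  have c: "0 < c" "c \<le> L" "c < d" using d L by (auto simp: c_def)
  define f where "f x = \<phi> (p + \<sigma> * x)" for x
  have "continuous_on {c..L} f"
    unfolding f_def using inD c by (intro continuous_on_compose2[OF cont_\<phi>] continuous_intros) auto
  note compact = compact_zeros[OF this]
  have "L \<in> {x \<in> {c..L}. f x = 0}" using c L r0 by (simp add: f_def)
  then have "{x \<in> {c..L}. f x = 0} \<noteq> {}" by blast
  from compact_attains_inf[OF compact this]
  obtain x where x: "x \<in> {x \<in> {c..L}. f x = 0}" "\<And>y. y \<in> {x \<in> {c..L}. f x = 0} \<Longrightarrow> x \<le> y"
    by blast
  have "0 < x" using x(1) c(1) by auto
  define q where "q = p + \<sigma> * x"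
  have q: "q \<in> D" "q \<noteq> p" "\<phi> q = 0" "\<bar>q - p\<bar> = x"
  proof -
    have "f x = 0" "0 \<le> x" "x \<le> L" using x(1) c(1) by auto
    then show "\<phi> q = 0" "q \<in> D" using inD[of x] by (simp_all only: q_def f_def)
    show "q \<noteq> p" "\<bar>q - p\<bar> = x" using \<open>0 < x\<close> by (simp_all add: q_def \<sigma>_def)
  qed
  have "0 < \<phi> s" if "s \<in> open_segment p q" for s
  proof -
    define y where "y = \<bar>s - p\<bar>"
    have y: "s = p + \<sigma> * y" "0 < y" "y < x"
      using that \<open>0 < x\<close> by (simp_all add: y_def q_def \<sigma>_def open_segment_eq_real_ivl split: if_splits)
    have "0 \<le> y" "y \<le> L" using y x(1) by auto
    note sD = inD[OF this]
    show ?thesis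
    proof (cases "y < d")
      case True
      moreover have "s \<in> D" "s \<noteq> p" using sD y(1,2) unfolding y_def by auto
      ultimately show ?thesis using near[of s] by (simp add: y_def)
    next
      case False
      then have "y \<in> {c..L}" "\<not> x \<le> y" using y x(1) c by auto
      then have "f y \<noteq> 0" using x(2)[of y] by auto
      then show ?thesis using \<phi>_nonneg[OF sD] y(1) by (simp add: f_def)
    qed
  qed
  from arc_from_zero_aux(2)[OF p q(1,2) this, of q] have "\<phi> q = 1 - cos x + \<beta> * sin x"
    using q by simp
  moreover have "0 < x" "x < \<theta>" using x(1) c L by auto
  ultimately show False using \<theta>(5)[of x] q(3) by simp
qed

lemma arc_from_zero:
  assumes p: "p \<in> D" "\<phi> p = 0" and s: "s \<in> D" "\<bar>s - p\<bar> \<le> \<theta>"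
  shows "T s = cos \<bar>s - p\<bar> *\<^sub>R T p + sin \<bar>s - p\<bar> *\<^sub>R M p"
    and "\<phi> s = 1 - cos \<bar>s - p\<bar> + \<beta> * sin \<bar>s - p\<bar>"
proof -
  have "T s = cos \<bar>s - p\<bar> *\<^sub>R T p + sin \<bar>s - p\<bar> *\<^sub>R M p \<and> \<phi> s = 1 - cos \<bar>s - p\<bar> + \<beta> * sin \<bar>s - p\<bar>"
  proof (cases "s = p")
    case False
    have "0 < \<phi> x" if "x \<in> open_segment p s" for x
    proof (rule positive_near_zero[OF p])
      show "x \<in> D"
        using that closed_segment_subset[OF p(1) s(1) convex_D] open_closed_segment by blast
      show "x \<noteq> p" "\<bar>x - p\<bar> < \<theta>"
        using that s(2) by (auto simp: open_segment_eq_real_ivl split: if_splits)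
    qed
    from arc_from_zero_aux[OF p s(1) False this ends_in_segment(2)] show ?thesis by blast
  qed (use p in simp)
  then show "T s = cos \<bar>s - p\<bar> *\<^sub>R T p + sin \<bar>s - p\<bar> *\<^sub>R M p"
    "\<phi> s = 1 - cos \<bar>s - p\<bar> + \<beta> * sin \<bar>s - p\<bar>" by auto
qed

text \<open>V is the same vector at p and q, so \<beta> M q = T q - V can be evaluated in the frame
  at p. The identities defining \<theta> turn the result into a multiple of \<beta>.\<close>

lemma next_zero:
  assumes p: "p \<in> D" "\<phi> p = 0" and q: "q \<in> D" "\<bar>q - p\<bar> = \<theta>"
  shows "\<phi> q = 0" "T q = cos \<theta> *\<^sub>R T p + sin \<theta> *\<^sub>R M p"
    "M q = sin \<theta> *\<^sub>R T p - cos \<theta> *\<^sub>R M p"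
proof -
  show "\<phi> q = 0" using arc_from_zero(2)[OF p q(1)] q(2) \<theta>(3) by simp
  show T: "T q = cos \<theta> *\<^sub>R T p + sin \<theta> *\<^sub>R M p" using arc_from_zero(1)[OF p q(1)] q(2) by simp
  have "\<beta> *\<^sub>R M q = T q - V" using \<beta>(1) by (simp add: M_def)
  also have "\<dots> = (cos \<theta> - 1) *\<^sub>R T p + (sin \<theta> + \<beta>) *\<^sub>R M p"
    unfolding T by (subst M(3)[OF p]) (simp add: algebra_simps)
  also have "cos \<theta> - 1 = \<beta> * sin \<theta>" using \<theta>(3) by simp
  also have "sin \<theta> + \<beta> = - \<beta> * cos \<theta>" using \<theta>(4) by simp
  finally have "\<beta> *\<^sub>R M q = \<beta> *\<^sub>R (sin \<theta> *\<^sub>R T p - cos \<theta> *\<^sub>R M p)" by (simp add: algebra_simps)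
  then show "M q = sin \<theta> *\<^sub>R T p - cos \<theta> *\<^sub>R M p" using \<beta>(1) by simp
qed

text \<open>Induction along the junctions, with \<sigma> choosing the direction; convexity keeps the
  earlier ones inside D. Two successive steps restore the frame because the step is an
  involution.\<close>

lemma zeros:
  assumes p: "p \<in> D" "\<phi> p = 0" and \<sigma>: "\<sigma> = 1 \<or> \<sigma> = - 1"
    and q: "p + of_int (\<sigma> * int n) * \<theta> \<in> D"
  shows "\<phi> (p + of_int (\<sigma> * int n) * \<theta>) = 0 \<and>
    (T (p + of_int (\<sigma> * int n) * \<theta>), M (p + of_int (\<sigma> * int n) * \<theta>)) = wave_frame \<theta> (T p) (M p) (\<sigma> * int n)"
  using q
proof (induction n)
  case 0
  then show ?case using p by (simp add: wave_frame_def)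
next
  case (Suc n)
  let ?q = "p + of_int (\<sigma> * int n) * \<theta>" and ?r = "p + of_int (\<sigma> * int (Suc n)) * \<theta>"
  have "p + of_int \<sigma> * y \<in> closed_segment p (p + of_int \<sigma> * (y + \<theta>))" if "0 \<le> y" for y
    using that \<sigma> \<theta>_pos by (auto simp: closed_segment_eq_real_ivl)
  from this[of "real n * \<theta>"] have "?q \<in> closed_segment p ?r"
    using \<theta>_pos by (simp add: algebra_simps)
  then have qD: "?q \<in> D" using closed_segment_subset[OF p(1) Suc.prems convex_D] by blast
  note IH = Suc.IH[OF qD]
  have "\<bar>?r - ?q\<bar> = \<theta>" using \<sigma> \<theta>_pos by (auto simp: algebra_simps)
  note nz = next_zero[OF qD conjunct1[OF IH] Suc.prems this]
  have sc: "sin \<theta> * sin \<theta> + cos \<theta> * cos \<theta> = 1" "cos \<theta> * cos \<theta> + sin \<theta> * sin \<theta> = 1"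
    using sin_cos_squared_add3[of \<theta>] by linarith+
  have TM: "T ?q = fst (wave_frame \<theta> (T p) (M p) (\<sigma> * int n))" "M ?q = snd (wave_frame \<theta> (T p) (M p) (\<sigma> * int n))"
    using conjunct2[OF IH] by (metis fst_conv, metis snd_conv)
  have parity: "even (\<sigma> * int (Suc n)) \<longleftrightarrow> \<not> even (\<sigma> * int n)" using \<sigma> by auto
  have "(T ?r, M ?r) = wave_frame \<theta> (T p) (M p) (\<sigma> * int (Suc n))"
  proof (cases "even (\<sigma> * int n)")
    case True
    then show ?thesis using nz(2,3) TM parity by (simp only: wave_frame_def fst_conv snd_conv if_True if_False not_True_eq_False)
  next
    case False
    have "cos \<theta> *\<^sub>R (cos \<theta> *\<^sub>R u + sin \<theta> *\<^sub>R v) + sin \<theta> *\<^sub>R (sin \<theta> *\<^sub>R u - cos \<theta> *\<^sub>R v) = u"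
      "sin \<theta> *\<^sub>R (cos \<theta> *\<^sub>R u + sin \<theta> *\<^sub>R v) - cos \<theta> *\<^sub>R (sin \<theta> *\<^sub>R u - cos \<theta> *\<^sub>R v) = v" for u v :: "real^3"
    proof -
      have "cos \<theta> *\<^sub>R (cos \<theta> *\<^sub>R u + sin \<theta> *\<^sub>R v) + sin \<theta> *\<^sub>R (sin \<theta> *\<^sub>R u - cos \<theta> *\<^sub>R v)
          = (cos \<theta> * cos \<theta>) *\<^sub>R u + (sin \<theta> * sin \<theta>) *\<^sub>R u"
        "sin \<theta> *\<^sub>R (cos \<theta> *\<^sub>R u + sin \<theta> *\<^sub>R v) - cos \<theta> *\<^sub>R (sin \<theta> *\<^sub>R u - cos \<theta> *\<^sub>R v)
          = (sin \<theta> * sin \<theta>) *\<^sub>R v + (cos \<theta> * cos \<theta>) *\<^sub>R v"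
        by (simp_all add: algebra_simps)
      then show "cos \<theta> *\<^sub>R (cos \<theta> *\<^sub>R u + sin \<theta> *\<^sub>R v) + sin \<theta> *\<^sub>R (sin \<theta> *\<^sub>R u - cos \<theta> *\<^sub>R v) = u"
        "sin \<theta> *\<^sub>R (cos \<theta> *\<^sub>R u + sin \<theta> *\<^sub>R v) - cos \<theta> *\<^sub>R (sin \<theta> *\<^sub>R u - cos \<theta> *\<^sub>R v) = v"
        by (simp_all only: scaleR_add_left[symmetric] sc scaleR_one)
    qed
    then have "T ?r = T p" "M ?r = M p"
      unfolding nz(2,3) TM using False by (simp_all only: wave_frame_def if_False fst_conv snd_conv)
    then show ?thesis
      using False parity by (simp only: wave_frame_def not_False_eq_True if_True)
  qed
  with nz(1) show ?case by blast
qed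

lemma wave_if_zero:
  assumes p: "p \<in> D" "\<phi> p = 0"
  shows "\<exists>\<delta>. wave \<delta> \<and> (\<forall>s\<in>D. \<gamma> s = \<delta> s)"
proof -
  obtain \<delta> U where \<delta>: "wave \<delta>" "\<delta> p = \<gamma> p" and d\<delta>: "\<And>s. (\<delta> has_vector_derivative U s) (at s)"
    and U: "\<And>s j. \<bar>s - (p + of_int j * \<theta>)\<bar> \<le> \<theta> \<Longrightarrow>
      U s = cos \<bar>s - (p + of_int j * \<theta>)\<bar> *\<^sub>R fst (wave_frame \<theta> (T p) (M p) j)
          + sin \<bar>s - (p + of_int j * \<theta>)\<bar> *\<^sub>R snd (wave_frame \<theta> (T p) (M p) j)"
    using wave_exists[OF \<theta>(1,2) norm_T[OF p(1)] M(1,2)[OF p]] by metis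
  have TU: "T s = U s" if s: "s \<in> D" for s
  proof -
    define \<sigma> :: int where "\<sigma> = (if p \<le> s then 1 else - 1)"
    \<comment> \<open>The number of whole arcs between p and s. Rounding towards p places the
      junction between the two points, hence in D.\<close>
    define n where "n = nat \<lfloor>\<bar>s - p\<bar> / \<theta>\<rfloor>"
    define j where "j = \<sigma> * int n"
    have "0 \<le> \<bar>s - p\<bar> / \<theta>" using \<theta>_pos by simp
    then have "of_nat n \<le> \<bar>s - p\<bar> / \<theta>" "\<bar>s - p\<bar> / \<theta> \<le> of_nat n + 1"
      unfolding n_def by linarith+
    then have n: "of_nat n * \<theta> \<le> \<bar>s - p\<bar>" "\<bar>s - p\<bar> \<le> of_nat n * \<theta> + \<theta>"
      using \<theta>_pos by (simp_all add: field_simps)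
    have n0: "0 \<le> of_nat n * \<theta>" using \<theta>_pos by simp
    have "p + of_int j * \<theta> \<in> closed_segment p s" "\<bar>s - (p + of_int j * \<theta>)\<bar> \<le> \<theta>"
      using n n0 by (auto simp: j_def \<sigma>_def closed_segment_eq_real_ivl)
    then have q: "p + of_int j * \<theta> \<in> D" and sq: "\<bar>s - (p + of_int j * \<theta>)\<bar> \<le> \<theta>"
      using closed_segment_subset[OF p(1) s convex_D] by auto
    have "\<sigma> = 1 \<or> \<sigma> = - 1" by (simp add: \<sigma>_def)
    from zeros[OF p this q[unfolded j_def], folded j_def]
    have z: "\<phi> (p + of_int j * \<theta>) = 0"
      and fr: "T (p + of_int j * \<theta>) = fst (wave_frame \<theta> (T p) (M p) j)"
        "M (p + of_int j * \<theta>) = snd (wave_frame \<theta> (T p) (M p) j)"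
      by (auto simp: prod_eq_iff)
    show ?thesis using arc_from_zero(1)[OF q z s sq] U[OF sq] unfolding fr by simp
  qed
  have "\<gamma> s = \<delta> s" if "s \<in> D" for s
  proof -
    have "\<gamma> s - \<delta> s = \<gamma> p - \<delta> p"
    proof (rule has_vector_derivative_zero_const[OF convex_D _ that p(1)])
      show "((\<lambda>s. \<gamma> s - \<delta> s) has_vector_derivative 0) (at s within D)" if "s \<in> D" for s
        using has_vector_derivative_diff[OF \<gamma>_deriv[OF that] has_vector_derivative_at_within[OF d\<delta>, of s D]] TU[OF that]
        by simp
    qed
    then show ?thesis using \<delta>(2) by simp
  qed
  with \<delta>(1) show ?thesis by blast
qed

text \<open>On each arc <V, T> = cos x - \<beta> sin x has the primitive sin x + \<beta> cos x,
  which runs from \<beta> to -\<beta>. So <V, \<gamma>> falls by 2\<beta> per arc, which is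
  impossible on a bounded curve.\<close>

lemma not_closed_if_zero:
  assumes D: "D = UNIV" and bnd: "bounded (range \<gamma>)" and p: "\<phi> p = 0"
  shows False
proof -
  obtain K where K: "\<And>s. norm (\<gamma> s) \<le> K" using bnd by (auto simp: bounded_iff)
  have step: "\<phi> (q + \<theta>) = 0 \<and> inner V (\<gamma> (q + \<theta>)) = inner V (\<gamma> q) - 2 * \<beta>" if "\<phi> q = 0" for q
  proof -
    let ?g = "\<lambda>s. inner V (\<gamma> s) - (sin (s - q) + \<beta> * cos (s - q))"
    have "?g (q + \<theta>) = ?g q"
    proof (rule has_real_derivative_zero_const[of "{q..q + \<theta>}" ?g "q + \<theta>" q])
      fix s assume s: "s \<in> {q..q + \<theta>}"
      have "inner V (T s) = cos (s - q) - \<beta> * sin (s - q)"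
        using V_T[of s] arc_from_zero(2)[of q s] that s D by simp
      then have "((\<lambda>s. inner V (\<gamma> s)) has_real_derivative cos (s - q) - \<beta> * sin (s - q)) (at s within {q..q + \<theta>})"
        using has_vector_derivative_inner_const[OF has_vector_derivative_at_within, of \<gamma> "T s" s V] \<gamma>_deriv[of s] D
        by simp
      then show "(?g has_real_derivative 0) (at s within {q..q + \<theta>})"
        by (auto intro!: derivative_eq_intros)
    qed (use \<theta>_pos in auto)
    then show ?thesis using \<theta>(4) next_zero(1)[of q "q + \<theta>"] that D \<theta>_pos by simp
  qed
  have it: "\<phi> (p + real n * \<theta>) = 0 \<and> inner V (\<gamma> (p + real n * \<theta>)) = inner V (\<gamma> p) - 2 * \<beta> * real n" for n
  proof (induction n)
    case (Suc n)
    then show ?case using step[of "p + real n * \<theta>"] by (simp add: algebra_simps)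
  qed (use p in simp)
  have b: "\<bar>inner V (\<gamma> s)\<bar> \<le> norm V * K" for s
    using Cauchy_Schwarz_ineq2[of V "\<gamma> s"] mult_left_mono[OF K[of s] norm_ge_zero[of V]] by linarith
  obtain n where "norm V * K < real n * \<beta>" using reals_Archimedean3[OF \<beta>(1)] by blast
  moreover have "inner V (\<gamma> (p + real n * \<theta>)) = inner V (\<gamma> p) - 2 * (real n * \<beta>)"
    using it[of n] by simp
  ultimately show False using b[of p] b[of "p + real n * \<theta>"] by linarith
qed

end

section \<open>The classification\<close>

lemma bounded_range_periodic:
  fixes f :: "real \<Rightarrow> 'a::metric_space"
  assumes l: "0 < l" and per: "\<And>s. f (s + l) = f s" and f: "continuous_on {0..l} f"
  shows "bounded (range f)"
proof -
  have per': "f (s + real n * l) = f s" for s n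
  proof (induction n)
    case (Suc n)
    then show ?case using per[of "s + real n * l"] by (simp add: algebra_simps)
  qed simp
  have "f s \<in> f ` {0..l}" for s
  proof -
    define j where "j = \<lfloor>s / l\<rfloor>"
    have "of_int j \<le> s / l" "s / l \<le> of_int j + 1" unfolding j_def by linarith+
    then have "s - of_int j * l \<in> {0..l}" using l by (simp add: field_simps)
    moreover have "f (s - of_int j * l) = f s"
    proof (cases "0 \<le> j")
      case True
      then show ?thesis using per'[of "s - of_int j * l" "nat j"] by simp
    next
      case False
      then show ?thesis using per'[of s "nat (- j)"] by simp
    qed
    ultimately show ?thesis by (metis image_eqI)
  qed
  then have "range f \<subseteq> f ` {0..l}" by blast
  then show ?thesis
    using compact_imp_bounded[OF compact_continuous_image[OF f compact_Icc]] bounded_subset by blast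
qed

text \<open>The kink force must be continuous before its weak derivative can be upgraded. On the
  support, which is open in D, this comes from the continuity of the curvature; at a zero, from |F|
  = \<phi> tending to 0.\<close>

lemma kink_balanced_if_tension:
  assumes C11: "C11_curve k l \<gamma>" and tension: "kink_tension_function k l \<gamma> \<phi>"
    and D: "D = param_domain k l"
  obtains V where "kink_balanced D \<gamma> (unit_tangent D \<gamma>) (principal_normal D \<gamma>) \<phi> V"
proof -
  let ?T = "unit_tangent D \<gamma>" and ?N = "principal_normal D \<gamma>"
  have l: "0 < l" and arclength: "arclength_param D \<gamma>" and lip: "1-lipschitz_on D ?T"
    using C11 unfolding C11_curve_def D by auto
  have D': "D = {0..l} \<and> 0 < l \<or> D = UNIV" using l D by (cases k) auto
  let ?U = "tension_support D \<phi>"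
  have \<phi>_nonneg: "\<And>s. s \<in> D \<Longrightarrow> 0 \<le> \<phi> s" and W: "W1BV D \<phi>"
    and diff: "\<And>s. s \<in> ?U \<Longrightarrow> ?T differentiable (at s within D)"
    and cont_curv: "continuous_on ?U (curvature D \<gamma>)"
    and norm_curv: "\<And>s. s \<in> ?U \<Longrightarrow> norm (curvature D \<gamma> s) = 1"
    using tension unfolding kink_tension_function_def Let_def D[symmetric] by auto
  obtain V where wd: "has_weak_derivative (kink_force D \<gamma> \<phi>) (\<lambda>s. (1 - 2 * \<phi> s) *\<^sub>R ?T s - V) D"
    using tension unfolding kink_tension_function_def Let_def D[symmetric] by auto
  have cont_\<phi>: "continuous_on D \<phi>" using W by (simp add: W1BV_def)
  have cont_T: "continuous_on D ?T" by (rule lipschitz_on_continuous_on[OF lip])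
  have U: "s \<in> ?U \<longleftrightarrow> s \<in> D \<and> 0 < \<phi> s" for s by (simp add: tension_support_def)
  have N: "?N s = curvature D \<gamma> s" if "s \<in> ?U" for s
    using norm_curv[OF that] by (simp add: principal_normal_def)
  have force: "kink_force D \<gamma> \<phi> s = \<phi> s *\<^sub>R ?N s" if "s \<in> D" for s
    using \<phi>_nonneg[OF that] that by (auto simp: kink_force_def U)
  have cont_force: "continuous_on D (kink_force D \<gamma> \<phi>)"
    unfolding continuous_on_eq_continuous_within
  proof
    fix s assume s: "s \<in> D"
    show "continuous (at s within D) (kink_force D \<gamma> \<phi>)"
    proof (cases "0 < \<phi> s")
      case True
      obtain d where d: "0 < d" "\<forall>x\<in>D. dist x s < d \<longrightarrow> dist (\<phi> x) (\<phi> s) < \<phi> s"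
        using cont_\<phi>[unfolded continuous_on_iff] s True by blast
      have "x \<in> ?U" if "x \<in> D" "x \<in> ball s d" for x
        using d(2) that by (force simp: U dist_real_def dist_commute)
      then have eq: "at s within D = at s within ?U"
        using d(1) by (intro at_within_nhd[of s "ball s d"]) (auto simp: U)
      have "continuous_on ?U \<phi>" by (rule continuous_on_subset[OF cont_\<phi>]) (auto simp: U)
      then have "continuous_on ?U (\<lambda>x. \<phi> x *\<^sub>R curvature D \<gamma> x)"
        using cont_curv by (rule continuous_on_scaleR)
      then have "continuous_on ?U (kink_force D \<gamma> \<phi>)"
        by (rule continuous_on_eq) (auto simp: force N U)
      then show ?thesis
        using s True unfolding eq by (simp add: continuous_on_eq_continuous_within U)
    next
      case False
      then have s0: "\<phi> s = 0" using \<phi>_nonneg[OF s] by simp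
      have "(\<phi> \<longlongrightarrow> \<phi> s) (at s within D)"
        using cont_\<phi> s by (simp add: continuous_on_def)
      moreover have "norm (kink_force D \<gamma> \<phi> x) \<le> \<phi> x" if "x \<in> D" for x
        using N[of x] norm_curv[of x] \<phi>_nonneg[OF that] by (auto simp: kink_force_def)
      then have "eventually (\<lambda>x. norm (kink_force D \<gamma> \<phi> x) \<le> \<phi> x) (at s within D)"
        by (auto simp: eventually_at_filter)
      ultimately have "(kink_force D \<gamma> \<phi> \<longlongrightarrow> 0) (at s within D)"
        unfolding s0 by (rule Lim_null_comparison[rotated])
      then show ?thesis using s0 by (simp add: continuous_within kink_force_def U)
    qed
  qed
  have "kink_balanced D \<gamma> ?T ?N \<phi> V"
  proof
    show "convex D" "closed D" using D' by auto
    show "at s within D \<noteq> bot" if "s \<in> D" for s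
      using D'
    proof
      assume "D = {0..l} \<and> 0 < l"
      then show ?thesis using that
        by (auto simp: trivial_limit_within intro!: islimpt_closure_open[where s = "{0<..<l}"])
    qed simp
    show "(\<gamma> has_vector_derivative ?T s) (at s within D)" "norm (?T s) = 1" if "s \<in> D" for s
      using arclength that unfolding arclength_param_def
      by (auto simp: unit_tangent_def vector_derivative_works)
    show "continuous_on D ?T" by (rule cont_T)
    show "0 \<le> \<phi> s" if "s \<in> D" for s by (rule \<phi>_nonneg[OF that])
    show "(?T has_vector_derivative ?N s) (at s within D)" "norm (?N s) = 1" if "s \<in> D" "0 < \<phi> s" for s
      using diff[of s] N[of s] norm_curv[of s] that
      by (auto simp: U vector_derivative_works curvature_def)
    fix s assume s: "s \<in> D"
    have "(kink_force D \<gamma> \<phi> has_vector_derivative (1 - 2 * \<phi> s) *\<^sub>R ?T s - V) (at s within D)"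
      using D' by (intro weak_derivative_imp_derivative_within[OF wd _ cont_force _ s] continuous_intros cont_\<phi> cont_T)
    then show "((\<lambda>s. \<phi> s *\<^sub>R ?N s) has_vector_derivative (1 - 2 * \<phi> s) *\<^sub>R ?T s - V) (at s within D)"
      by (rule has_vector_derivative_transform[OF s, rotated]) (simp add: force)
  qed
  then show thesis by (rule that)
qed

theorem theorem5p6:
  fixes k :: curve_kind and l :: real
    and \<gamma> :: "real \<Rightarrow> real^3" and \<phi> :: "real \<Rightarrow> real"
  assumes "C11_curve k l \<gamma>"
    and "embedded k l \<gamma>"
    and "kink_tension_function k l \<gamma> \<phi>"
  shows "((\<exists>s \<in> tension_support (param_domain k l) \<phi>. torsion (param_domain k l) \<gamma> s \<noteq> 0) \<longrightarrow>
            (\<exists>\<delta>. supercoiled_helix \<delta> \<and> subarc_of k l \<gamma> \<delta>)) \<and>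
         (\<not> (\<exists>s \<in> tension_support (param_domain k l) \<phi>. torsion (param_domain k l) \<gamma> s \<noteq> 0) \<longrightarrow>
            segment_with_arcs k l \<gamma> \<or>
            unit_circle_arc (param_domain k l) \<gamma> \<or>
            (\<exists>\<delta>. wave \<delta> \<and> subarc_of k l \<gamma> \<delta>))"
proof -
  define D where "D = param_domain k l"
  obtain V where "kink_balanced D \<gamma> (unit_tangent D \<gamma>) (principal_normal D \<gamma>) \<phi> V"
    using kink_balanced_if_tension[OF assms(1,3) D_def] .
  then interpret kink_balanced D \<gamma> "unit_tangent D \<gamma>" "principal_normal D \<gamma>" \<phi> V .
  have l: "0 < l" using assms(1) by (simp add: C11_curve_def)
  have "continuous_on D \<gamma>"
    using \<gamma>_deriv continuous_on_eq_continuous_within has_vector_derivative_continuous by blast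
  then have bnd: "bounded (range \<gamma>)" if "k = Closed"
    using that assms(1) l
    by (intro bounded_range_periodic[OF l]) (auto simp: C11_curve_def D_def intro: continuous_on_subset)
  have subarc: "subarc_of k l \<gamma> \<delta>" if "k = Arc" "\<forall>s\<in>{0..l}. \<gamma> s = \<delta> s" for \<delta>
    unfolding subarc_of_def using that by (intro conjI exI[of _ 0]) auto
  have tors: "torsion D \<gamma> s = \<tau> s" for s
    by (simp add: torsion_def \<tau>_def N'_def B_def binormal_def)
  have supp: "s \<in> tension_support D \<phi> \<longleftrightarrow> s \<in> D \<and> 0 < \<phi> s" for s by (simp add: tension_support_def)
  have "\<exists>\<delta>. supercoiled_helix \<delta> \<and> subarc_of k l \<gamma> \<delta>"
    if s: "s \<in> tension_support D \<phi>" "torsion D \<gamma> s \<noteq> 0" for s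
  proof -
    have sD: "s \<in> D" and "C s \<noteq> 0" using s C_eq[of s] by (auto simp: supp tors)
    show ?thesis
    proof (cases k)
      case Arc
      then show ?thesis using supercoiled_if_twisted[OF _ l sD \<open>C s \<noteq> 0\<close>] subarc by (auto simp: D_def)
    next
      case Closed
      then show ?thesis using not_closed_if_twisted[OF _ bnd \<open>C s \<noteq> 0\<close>] by (simp add: D_def)
    qed
  qed
  moreover have "segment_with_arcs k l \<gamma> \<or> unit_circle_arc D \<gamma> \<or> (\<exists>\<delta>. wave \<delta> \<and> subarc_of k l \<gamma> \<delta>)"
    if "\<not> (\<exists>s \<in> tension_support D \<phi>. torsion D \<gamma> s \<noteq> 0)"
  proof -
    interpret untwisted D \<gamma> "unit_tangent D \<gamma>" "principal_normal D \<gamma>" \<phi> V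
    proof
      fix s assume s: "s \<in> D"
      show "C s = 0"
      proof (cases "0 < \<phi> s")
        case True
        then show ?thesis using that s C_eq[OF s] by (simp add: supp tors)
      next
        case False
        then show ?thesis using \<phi>_nonneg[OF s] by (simp add: C_def F_def)
      qed
    qed
    have "D \<noteq> {}" using l by (cases k) (auto simp: D_def)
    show ?thesis
    \<comment> \<open>Without zeros all of D is one interval of positivity, so the whole curve, open
      or closed, is a single circular arc.\<close>
    proof (cases "\<forall>s\<in>D. 0 < \<phi> s")
      case True
      then have "unit_circle_arc (closure D) \<gamma>"
        using \<open>D \<noteq> {}\<close> by (intro circle_on_closure convex_D) auto
      then show ?thesis using closed_D by simp
    next
      case False
      then obtain p where p: "p \<in> D" "\<phi> p = 0" using \<phi>_nonneg by (metis order_le_less)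
      show ?thesis
      proof (cases "norm V = 1")
        case True
        show ?thesis
        proof (cases k)
          case Arc
          then show ?thesis
            using critical_arc[OF _ _ True p, of l] assms(2) by (simp add: embedded_def D_def)
        next
          case Closed
          have "D = UNIV" using Closed by (simp add: D_def)
          moreover have "\<And>s. \<gamma> (s + l) = \<gamma> s" using assms(1) Closed by (simp add: C11_curve_def)
          moreover have "\<And>s. \<phi> (s + l) = \<phi> s"
            using assms(3) Closed by (simp add: kink_tension_function_def Let_def)
          moreover have "inj_on \<gamma> {0..<l}" using assms(2) Closed by (simp add: embedded_def)
          ultimately show ?thesis using critical_closed[OF _ l _ _ _ True p(2)] by simp
        qed
      next
        case False
        then interpret supercritical D \<gamma> "unit_tangent D \<gamma>" "principal_normal D \<gamma>" \<phi> V
          using zero_facts(2)[OF p] by unfold_locales simp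
        show ?thesis
        proof (cases k)
          case Arc
          then show ?thesis using wave_if_zero[OF p] subarc by (auto simp: D_def)
        next
          case Closed
          then show ?thesis using not_closed_if_zero[OF _ bnd p(2)] by (simp add: D_def)
        qed
      qed
    qed
  qed
  ultimately show ?thesis unfolding D_def by blast
qed

end
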